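(* Let $\mathbb{F}$ be a field with a non-identity involution $x\mapsto x^\star$, and $\mathbb{K}=\{x\in\mathbb{F}:x^\star=x\}$. Let $V$ be an $n$-dimensional $\mathbb{F}$-vector space and $b$ a non-degenerate Hermitian form on $V$ with Witt index $\nu$. Let $\mathcal{V}$ be a $\mathbb{K}$-linear subspace of $\mathcal{H}_b$ consisting of nilpotent endomorphisms. Then $\dim_{\mathbb{K}}\mathcal{V}\le \nu(2n-2\nu-1)$. If moreover $|\mathbb{F}|>4$ and $\dim_{\mathbb{K}}\mathcal{V}=\nu(2n-2\nu-1)$, then there exists a maximal partially complete $b$-singular flag $\mathcal{F}$ of the $\mathbb{F}$-vector space $V$ such that $\mathcal{V}=\mathrm{WH}_{b,\mathcal{F}}$.
   Context: A sesquilinear form $b$ on $V$ is linear in the second argument and satisfies $b(\alpha x+x',y)=\alpha^\star b(x,y)+b(x',y)$; it is Hermitian if $b(y,x)=b(x,y)^\star$ for all $x,y$; non-degenerate if $b(x,y)=0$ for all $x$ forces $y=0$. An $\mathbb{F}$-subspace $X$ is totally $b$-singular if $b(x,y)=0$ for all $x,y\in X$; the Witt index is the maximal $\mathbb{F}$-dimension of such a subspace. An $\mathbb{F}$-linear endomorphism $u$ of $V$ is $b$-Hermitian if $b(u(x),y)=b(x,u(y))$ for all $x,y$; $\mathcal{H}_b$ is the $\mathbb{K}$-linear space of these. A flag $(F_0,\dots,F_p)$ of $\mathbb{F}$-subspaces is partially complete if $\dim_{\mathbb{F}}F_i=i$ for all $i$, $b$-singular if $F_p$ is totally $b$-singular,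 and maximal if $p=\nu$. $\mathrm{WH}_{b,\mathcal{F}}$ is the set of nilpotent $u\in\mathcal{H}_b$ with $u(F_i)\subseteq F_i$ for all $i$. *)

theory Defs
  imports Main "HOL.Vector_Spaces"
begin

definition field_involution :: "('a::field \<Rightarrow> 'a) \<Rightarrow> bool" where
  "field_involution st \<longleftrightarrow>
     (\<forall>x y. st (x + y) = st x + st y) \<and> (\<forall>x y. st (x * y) = st x * st y) \<and>
     (\<forall>x. st (st x) = x)"

definition fixed_field :: "('a::field \<Rightarrow> 'a) \<Rightarrow> 'a set" where
  "fixed_field st = {x. st x = x}"

definition sesquilinear ::
  "('a::field \<Rightarrow> 'a) \<Rightarrow> ('a \<Rightarrow> 'v::ab_group_add \<Rightarrow> 'v) \<Rightarrow> ('v \<Rightarrow> 'v \<Rightarrow> 'a) \<Rightarrow> bool" where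
  "sesquilinear st scale b \<longleftrightarrow>
     (\<forall>x y y'. b x (y + y') = b x y + b x y') \<and>
     (\<forall>c x y. b x (scale c y) = c * b x y) \<and>
     (\<forall>\<alpha> x x' y. b (scale \<alpha> x + x') y = st \<alpha> * b x y + b x' y)"

definition hermitian_form :: "('a::field \<Rightarrow> 'a) \<Rightarrow> ('v \<Rightarrow> 'v \<Rightarrow> 'a) \<Rightarrow> bool" where
  "hermitian_form st b \<longleftrightarrow> (\<forall>x y. b y x = st (b x y))"

definition nondegenerate :: "('v::zero \<Rightarrow> 'v \<Rightarrow> 'a::zero) \<Rightarrow> bool" where
  "nondegenerate b \<longleftrightarrow> (\<forall>y. (\<forall>x. b x y = 0) \<longrightarrow> y = 0)"

definition totally_singular ::
  "('a::field \<Rightarrow> 'v::ab_group_add \<Rightarrow> 'v) \<Rightarrow> ('v \<Rightarrow> 'v \<Rightarrow> 'a) \<Rightarrow> 'v set \<Rightarrow> bool" where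
  "totally_singular scale b X \<longleftrightarrow>
     module.subspace scale X \<and> (\<forall>x\<in>X. \<forall>y\<in>X. b x y = 0)"

definition witt_index ::
  "('a::field \<Rightarrow> 'v::ab_group_add \<Rightarrow> 'v) \<Rightarrow> ('v \<Rightarrow> 'v \<Rightarrow> 'a) \<Rightarrow> nat" where
  "witt_index scale b = Max {vector_space.dim scale X | X. totally_singular scale b X}"

definition herm_endos ::
  "('a::field \<Rightarrow> 'v::ab_group_add \<Rightarrow> 'v) \<Rightarrow> ('v \<Rightarrow> 'v \<Rightarrow> 'a) \<Rightarrow> ('v \<Rightarrow> 'v) set" where
  "herm_endos scale b =
     {u. Vector_Spaces.linear scale scale u \<and> (\<forall>x y. b (u x) y = b x (u y))}"

definition nilpotent_endo :: "('v::zero \<Rightarrow> 'v) \<Rightarrow> bool" where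
  "nilpotent_endo u \<longleftrightarrow> (\<exists>k. (u ^^ k) = (\<lambda>x. 0))"

definition K_subspace ::
  "'a set \<Rightarrow> ('a::field \<Rightarrow> 'v::ab_group_add \<Rightarrow> 'v) \<Rightarrow> ('v \<Rightarrow> 'v) set \<Rightarrow> bool" where
  "K_subspace K scale W \<longleftrightarrow>
     (\<lambda>x. 0) \<in> W \<and> (\<forall>u\<in>W. \<forall>w\<in>W. (\<lambda>x. u x + w x) \<in> W) \<and>
     (\<forall>c\<in>K. \<forall>u\<in>W. (\<lambda>x. scale c (u x)) \<in> W)"

definition K_independent ::
  "'a set \<Rightarrow> ('a::field \<Rightarrow> 'v::ab_group_add \<Rightarrow> 'v) \<Rightarrow> ('v \<Rightarrow> 'v) set \<Rightarrow> bool" where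
  "K_independent K scale S \<longleftrightarrow>
     (\<forall>c. (\<forall>u\<in>S. c u \<in> K) \<longrightarrow> (\<forall>x. (\<Sum>u\<in>S. scale (c u) (u x)) = 0) \<longrightarrow> (\<forall>u\<in>S. c u = 0))"

definition K_dim ::
  "'a set \<Rightarrow> ('a::field \<Rightarrow> 'v::ab_group_add \<Rightarrow> 'v) \<Rightarrow> ('v \<Rightarrow> 'v) set \<Rightarrow> nat" where
  "K_dim K scale W = Max {card S | S. finite S \<and> S \<subseteq> W \<and> K_independent K scale S}"

definition max_singular_flag ::
  "('a::field \<Rightarrow> 'v::ab_group_add \<Rightarrow> 'v) \<Rightarrow> ('v \<Rightarrow> 'v \<Rightarrow> 'a) \<Rightarrow> (nat \<Rightarrow> 'v set) \<Rightarrow> bool" where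
  "max_singular_flag scale b Fl \<longleftrightarrow>
     (\<forall>i\<le>witt_index scale b. module.subspace scale (Fl i) \<and> vector_space.dim scale (Fl i) = i) \<and>
     (\<forall>i<witt_index scale b. Fl i \<subseteq> Fl (Suc i)) \<and>
     totally_singular scale b (Fl (witt_index scale b))"

definition WH ::
  "('a::field \<Rightarrow> 'v::ab_group_add \<Rightarrow> 'v) \<Rightarrow> ('v \<Rightarrow> 'v \<Rightarrow> 'a) \<Rightarrow> (nat \<Rightarrow> 'v set) \<Rightarrow> ('v \<Rightarrow> 'v) set" where
  "WH scale b Fl = {u \<in> herm_endos scale b. nilpotent_endo u \<and>
                     (\<forall>i\<le>witt_index scale b. u ` Fl i \<subseteq> Fl i)}"

end

theory Submission
  imports Defs "HOL-Library.Function_Algebras" "HOL-Analysis.Determinants" "HOL-Computational_Algebra.Polynomial"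
begin

text \<open>
  Fix an isotropic vector \<open>x \<noteq> 0\<close>, let \<open>Wx\<close> be the set of values at \<open>x\<close> and \<open>L\<close> the set of all
  \<open>y \<bottom> x\<close> such that \<open>z \<mapsto> b(x,z)y + b(y,z)x\<close> lies in \<open>W\<close>. Nilpotency forces \<open>L\<close> to be orthogonal to
  \<open>Wx \<oplus> Fx\<close> for the \<open>K\<close>-bilinear trace form of \<open>b\<close>, and the elements of \<open>W\<close> killing \<open>x\<close> act on
  \<open>x\<^sup>\<bottom>/Fx\<close>, whose Witt index is smaller; counting dimensions gives the bound by induction.

  In the case of equality \<open>L\<close> is exactly the orthogonal of \<open>Wx \<oplus> Fx\<close>, for every isotropic \<open>x\<close>. If \<open>K\<close> has
  an element other than 0 and 1, the first two coefficients (in \<open>t\<close>) of the characteristic polynomials of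
  \<open>u + tr\<close> vanish for \<open>r\<close> of small rank. This yields first an isotropic \<open>x\<close> with \<open>b(x, ux) = 0\<close> on all
  of \<open>W\<close>, for which \<open>Wx \<oplus> Fx\<close> is a totally singular \<open>F\<close>-subspace, and then, combining \<open>x\<close> with a common
  kernel vector of the induced space on \<open>x\<^sup>\<bottom>/Fx\<close>, an isotropic vector killed by \<open>W\<close>. The latter starts
  the flag, and induction provides the rest.
\<close>

section \<open>Dimension over a subfield\<close>

text \<open>The size of F enters through a count of scalars. For u, r in W the nilpotency of u + tr
  is an identity in t whose coefficients are the sums E1, E2, E3 of principal minors of a small
  matrix of polynomials in s. In rank two, t = 1 and one further nonzero t in K give E1 = E2 = 0;
  since F has dimension two over K, |F| > 4 supplies that t. In rank three there is one unknown too
  many when K has three elements: E1 and E2 only become multiples of s^2 E3 and s E3, which suffices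
  because only the lowest coefficients are used. The bound itself uses t = 1 alone. All dimensions
  are over K, so N = 2n. With a = dim Wx, the orthogonal of Wx + Fx has dimension N - a - 2, and
  passing from y to its symmetric map loses one more dimension, the trace-zero multiples of x. One
  step therefore accounts for at most N - 3, and summing over N, N - 4, N - 8, ... gives m(N - 2m -
  1). Characteristic two is not treated apart: an element \<open>tau\<close> of trace one replaces
  1/2.\<close>

locale subfield_space = vector_space sc
  for sc :: "'a::field \<Rightarrow> 'v::ab_group_add \<Rightarrow> 'v" +
  fixes K :: "'a set"
  assumes K_one: "1 \<in> K"
    and K_add: "a \<in> K \<Longrightarrow> c \<in> K \<Longrightarrow> a + c \<in> K"
    and K_mult: "a \<in> K \<Longrightarrow> c \<in> K \<Longrightarrow> a * c \<in> K"
    and K_minus: "a \<in> K \<Longrightarrow> - a \<in> K"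
    and K_inverse: "a \<in> K \<Longrightarrow> inverse a \<in> K"
begin

lemma K_zero: "0 \<in> K"
  using K_add[OF K_one K_minus[OF K_one]] by simp

lemma K_divide: "a \<in> K \<Longrightarrow> c \<in> K \<Longrightarrow> a / c \<in> K"
  by (simp add: K_mult K_inverse divide_inverse)

definition ksub :: "'v set \<Rightarrow> bool" where
  "ksub X \<longleftrightarrow> 0 \<in> X \<and> (\<forall>x\<in>X. \<forall>y\<in>X. x + y \<in> X) \<and> (\<forall>c\<in>K. \<forall>x\<in>X. sc c x \<in> X)"

lemma ksub_zero: "ksub X \<Longrightarrow> 0 \<in> X"
  and ksub_add: "ksub X \<Longrightarrow> x \<in> X \<Longrightarrow> y \<in> X \<Longrightarrow> x + y \<in> X"
  and ksub_scale: "ksub X \<Longrightarrow> c \<in> K \<Longrightarrow> x \<in> X \<Longrightarrow> sc c x \<in> X"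
  by (auto simp: ksub_def)

lemma ksub_minus: "ksub X \<Longrightarrow> x \<in> X \<Longrightarrow> - x \<in> X"
  using ksub_scale[of X "- 1" x] K_minus[OF K_one] by simp

lemma ksub_diff: "ksub X \<Longrightarrow> x \<in> X \<Longrightarrow> y \<in> X \<Longrightarrow> x - y \<in> X"
  using ksub_add[of X x "- y"] ksub_minus[of X y] by simp

lemma ksub_Int: "ksub X \<Longrightarrow> ksub Y \<Longrightarrow> ksub (X \<inter> Y)"
  by (auto simp: ksub_def)

lemma ksub_subspace: "subspace X \<Longrightarrow> ksub X"
  by (auto simp: ksub_def subspace_0 subspace_add subspace_scale)

definition kext :: "'v set \<Rightarrow> 'v \<Rightarrow> 'v set" where
  "kext X e = {x + sc c e | x c. x \<in> X \<and> c \<in> K}"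

lemma kextI: "x \<in> X \<Longrightarrow> c \<in> K \<Longrightarrow> x + sc c e \<in> kext X e"
  by (auto simp: kext_def)

lemma kextE:
  assumes "z \<in> kext X e"
  obtains x c where "x \<in> X" "c \<in> K" "z = x + sc c e"
  using assms by (auto simp: kext_def)

lemma kext_diffI: "z - sc c e \<in> X \<Longrightarrow> c \<in> K \<Longrightarrow> z \<in> kext X e"
  using kextI[of "z - sc c e" X c e] by simp

lemma kext_superset: "X \<subseteq> kext X e"
  using kextI[OF _ K_zero] by fastforce

lemma kext_self: "0 \<in> X \<Longrightarrow> e \<in> kext X e"
  using kextI[OF _ K_one, of 0 X e] by simp

lemma kext_subset: "ksub Y \<Longrightarrow> X \<subseteq> Y \<Longrightarrow> e \<in> Y \<Longrightarrow> kext X e \<subseteq> Y"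
  by (auto simp: kext_def ksub_def)

lemma ksub_kext: assumes "ksub X" shows "ksub (kext X e)"
  unfolding ksub_def
proof (intro conjI ballI)
  show "0 \<in> kext X e" using ksub_zero[OF assms] kext_superset by blast
next
  fix x y assume "x \<in> kext X e" "y \<in> kext X e"
  then obtain x' c y' d where *: "x' \<in> X" "c \<in> K" "x = x' + sc c e" "y' \<in> X" "d \<in> K" "y = y' + sc d e"
    by (auto elim!: kextE)
  have "x + y = (x' + y') + sc (c + d) e" using * by (simp add: algebra_simps)
  then show "x + y \<in> kext X e" using * kextI ksub_add[OF assms] K_add by metis
next
  fix a x assume "a \<in> K" "x \<in> kext X e"
  then obtain x' c where *: "x' \<in> X" "c \<in> K" "x = x' + sc c e" by (auto elim!: kextE)
  have "sc a x = sc a x' + sc (a * c) e" using * by (simp add: algebra_simps)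
  then show "sc a x \<in> kext X e" using * \<open>a \<in> K\<close> kextI ksub_scale[OF assms] K_mult by metis
qed

text \<open>\<open>kd X n\<close>: the set \<open>X\<close> is a \<open>K\<close>-linear subspace of finite dimension \<open>n\<close>.\<close>

inductive kd :: "'v set \<Rightarrow> nat \<Rightarrow> bool" where
  kd_zero: "kd {0} 0"
| kd_ext: "kd X n \<Longrightarrow> e \<notin> X \<Longrightarrow> kd (kext X e) (Suc n)"

lemma kd_ksub: "kd X n \<Longrightarrow> ksub X"
proof (induction rule: kd.induct)
  case kd_zero
  show ?case by (simp add: ksub_def)
qed (rule ksub_kext)

lemma kd_0_iff: "kd X 0 \<longleftrightarrow> X = {0}"
  by (auto elim: kd.cases intro: kd_zero)

text \<open>The exchange argument on which invariance of dimension rests. Let Y = Y1 + K e be the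
  last step of the construction of Y. If \<open>Y0\<close> contains \<open>Y1\<close> the two
  coincide; otherwise their intersection is a hyperplane of \<open>Y1\<close>, and one more vector
  restores \<open>Y0\<close>.\<close>

lemma kd_hyperplane:
  assumes "kd Y m" "ksub Y0" "Y0 \<subseteq> Y" "y \<in> Y" "y \<notin> Y0" "Y \<subseteq> kext Y0 y"
  shows "\<exists>m0. m = Suc m0 \<and> kd Y0 m0"
  using assms
proof (induction arbitrary: Y0 y rule: kd.induct)
  case kd_zero
  then show ?case using ksub_zero by auto
next
  case (kd_ext Y1 m1 e)
  note Y0 = kd_ext.prems(1)
  note Y1 = kd_ksub[OF kd_ext.hyps(1)]
  note Y = ksub_kext[OF Y1, of e]
  show ?case
  proof (cases "Y1 \<subseteq> Y0")
    case True
    have e: "e \<notin> Y0"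
      using kext_subset[OF Y0 True, of e] kd_ext.prems(3,4) by blast
    have "Y0 \<subseteq> Y1"
    proof
      fix z assume z: "z \<in> Y0"
      with kd_ext.prems(2) obtain y1 c where *: "y1 \<in> Y1" "c \<in> K" "z = y1 + sc c e" by (metis kextE subsetD)
      have "c = 0"
      proof (rule ccontr)
        assume "c \<noteq> 0"
        then have "e = sc (inverse c) (z - y1)" using * by simp
        moreover have "z - y1 \<in> Y0" using z * True ksub_diff[OF Y0] by blast
        ultimately show False using e ksub_scale[OF Y0 K_inverse[OF \<open>c \<in> K\<close>]] by simp
      qed
      then show "z \<in> Y1" using * by simp
    qed
    then show ?thesis using True kd_ext.hyps(1) by auto
  next
    case False
    then obtain y' where y': "y' \<in> Y1" "y' \<notin> Y0" by blast
    have "y' \<in> kext Y0 y" using y' kd_ext.prems(5) kext_superset by blast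
    then obtain y0 c where y0: "y0 \<in> Y0" "c \<in> K" "y' = y0 + sc c y" by (auto elim!: kextE)
    have c: "c \<noteq> 0" using y0 y' by auto
    \<comment> \<open>Since \<open>y'\<close> lies outside \<open>Y0\<close>, it can replace
      \<open>y\<close>: modulo \<open>Y0\<close> every vector is a K-multiple of
      \<open>y'\<close>.\<close>
    have red: "\<exists>d\<in>K. w - sc d y' \<in> Y0" if "w \<in> kext Y1 e" for w
    proof -
      have "w \<in> kext Y0 y" using that kd_ext.prems(5) by blast
      then obtain w0 d where w: "w0 \<in> Y0" "d \<in> K" "w = w0 + sc d y" by (auto elim: kextE)
      have "w - sc (d / c) y' = w0 - sc (d / c) y0"
        using c by (simp add: w y0 scale_right_distrib)
      then show ?thesis
        using w y0 ksub_diff[OF Y0] ksub_scale[OF Y0] K_divide by metis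
    qed
    have sub: "Y1 \<subseteq> kext (Y0 \<inter> Y1) y'"
    proof
      fix w assume w: "w \<in> Y1"
      then obtain d where d: "d \<in> K" "w - sc d y' \<in> Y0" using red kext_superset by blast
      then have "w - sc d y' \<in> Y0 \<inter> Y1" using w y' ksub_diff[OF Y1] ksub_scale[OF Y1] by blast
      then show "w \<in> kext (Y0 \<inter> Y1) y'" using d kext_diffI by blast
    qed
    obtain k where k: "m1 = Suc k" "kd (Y0 \<inter> Y1) k"
      using kd_ext.IH[OF ksub_Int[OF Y0 Y1] _ y'(1) _ sub] y' by blast
    obtain d where d: "d \<in> K" "e - sc d y' \<in> Y0" using red[OF kext_self[OF ksub_zero[OF Y1]]] by blast
    \<comment> \<open>Correcting \<open>e\<close> by a multiple of \<open>y'\<close>, which lies in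
      \<open>Y1\<close>, moves it into \<open>Y0\<close> and keeps it outside
      \<open>Y1\<close>.\<close>
    define e2 where "e2 = e - sc d y'"
    have e2: "e2 \<in> Y0" "e2 \<notin> Y1"
    proof -
      show "e2 \<in> Y0" using d e2_def by simp
      show "e2 \<notin> Y1"
      proof
        assume "e2 \<in> Y1"
        then have "e2 + sc d y' \<in> Y1" using ksub_add[OF Y1] ksub_scale[OF Y1 d(1) y'(1)] by blast
        then show False using kd_ext.hyps(2) e2_def by simp
      qed
    qed
    have "Y0 = kext (Y0 \<inter> Y1) e2"
    proof
      show "kext (Y0 \<inter> Y1) e2 \<subseteq> Y0" using kext_subset[OF Y0 _ e2(1)] by blast
      show "Y0 \<subseteq> kext (Y0 \<inter> Y1) e2"
      proof
        fix z assume z: "z \<in> Y0"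
        with kd_ext.prems(2) obtain y1 c' where *: "y1 \<in> Y1" "c' \<in> K" "z = y1 + sc c' e" by (metis kextE subsetD)
        have "z - sc c' e2 = y1 + sc c' (sc d y')" using * by (simp add: e2_def algebra_simps)
        then have "z - sc c' e2 \<in> Y1"
          using * d y' ksub_add[OF Y1] ksub_scale[OF Y1] by metis
        moreover have "z - sc c' e2 \<in> Y0" using z * e2 ksub_diff[OF Y0] ksub_scale[OF Y0] by blast
        ultimately show "z \<in> kext (Y0 \<inter> Y1) e2" using * kext_diffI by blast
      qed
    qed
    moreover have "kd (kext (Y0 \<inter> Y1) e2) (Suc k)" using kd.kd_ext[OF k(2)] e2 by blast
    ultimately show ?thesis using k by auto
  qed
qed

lemma kext_Int_subset:
  assumes "ksub Y" "ksub X" "y \<in> Y" "y \<notin> X" "Y \<subseteq> kext X e"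
  shows "Y \<subseteq> kext (Y \<inter> X) y"
proof
  fix z assume z: "z \<in> Y"
  obtain x c where y: "x \<in> X" "c \<in> K" "y = x + sc c e" using assms(3,5) by (metis kextE subsetD)
  obtain x' c' where z': "x' \<in> X" "c' \<in> K" "z = x' + sc c' e" using z assms(5) by (metis kextE subsetD)
  have c: "c \<noteq> 0" using y assms by auto
  have "z - sc (c' / c) y = x' - sc (c' / c) x" using c by (simp add: y z' algebra_simps)
  then have "z - sc (c' / c) y \<in> X" using y z' ksub_diff[OF assms(2)] ksub_scale[OF assms(2)] K_divide by metis
  moreover have "z - sc (c' / c) y \<in> Y" 
    using ksub_diff[OF assms(1) z ksub_scale[OF assms(1) K_divide[OF z'(2) y(2)] assms(3)]] .
  ultimately show "z \<in> kext (Y \<inter> X) y" using kext_diffI[OF _ K_divide[OF z'(2) y(2)]] by blast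
qed

text \<open>One induction on X serves comparison of dimensions, uniqueness of the dimension and
  equality of nested spaces: when Y is not inside \<open>X0\<close>, intersecting it with
  \<open>X0\<close> costs exactly one dimension.\<close>

lemma kd_mono:
  assumes "kd X n" "kd Y m" "Y \<subseteq> X"
  shows "m \<le> n \<and> (m = n \<longrightarrow> Y = X)"
  using assms
proof (induction arbitrary: Y m rule: kd.induct)
  case kd_zero
  then have Y: "Y = {0}" using kd_ksub ksub_zero by blast
  from kd_zero(1) have "m = 0"
  proof cases
    case (kd_ext X n e)
    then have "0 \<in> X" "e \<in> Y" using ksub_zero[OF kd_ksub] kext_self by blast+
    then have "e = 0" using Y by simp
    then show ?thesis using \<open>e \<notin> X\<close> \<open>0 \<in> X\<close> by simp
  qed
  then show ?case using Y by simp
next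
  case (kd_ext X0 n0 e)
  note X0 = kd_ksub[OF kd_ext.hyps(1)] and Y = kd_ksub[OF kd_ext.prems(1)]
  show ?case
  proof (cases "Y \<subseteq> X0")
    case True
    then show ?thesis using kd_ext by fastforce
  next
    case False
    then obtain y where y: "y \<in> Y" "y \<notin> X0" by blast
    obtain m0 where m0: "m = Suc m0" "kd (Y \<inter> X0) m0"
      using kd_hyperplane[OF kd_ext.prems(1) ksub_Int[OF Y X0] _ y(1) _
          kext_Int_subset[OF Y X0 y kd_ext.prems(2)]] y by blast
    have "m0 \<le> n0" "m0 = n0 \<longrightarrow> Y \<inter> X0 = X0" using kd_ext.IH[OF m0(2)] by auto
    moreover have "Y = kext X0 e" if "Y \<inter> X0 = X0"
    proof -
      obtain x c where *: "x \<in> X0" "c \<in> K" "y = x + sc c e" using y kd_ext.prems(2) by (metis kextE subsetD)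
      have "c \<noteq> 0" using * y by auto
      then have "e = sc (inverse c) (y - x)" using * by simp
      moreover have "y - x \<in> Y" using * y that ksub_diff[OF Y] by blast
      ultimately have "e \<in> Y" using ksub_scale[OF Y] K_inverse * by blast
      then show ?thesis using kext_subset[OF Y, of X0 e] that kd_ext.prems(2) by blast
    qed
    ultimately show ?thesis using m0 by auto
  qed
qed

lemma kd_le: "kd X n \<Longrightarrow> kd Y m \<Longrightarrow> Y \<subseteq> X \<Longrightarrow> m \<le> n"
  by (simp add: kd_mono)

lemma kd_eq: "kd X n \<Longrightarrow> kd Y n \<Longrightarrow> Y \<subseteq> X \<Longrightarrow> Y = X"
  using kd_mono[of X n Y n] by simp

lemma kd_unique: "kd X n \<Longrightarrow> kd X m \<Longrightarrow> m = n"
  using kd_mono[of X n X m] kd_mono[of X m X n] by simp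

lemma kd_subset_exists:
  assumes "kd X n" "ksub Y" "Y \<subseteq> X"
  shows "\<exists>m\<le>n. kd Y m"
  using assms
proof (induction arbitrary: Y rule: kd.induct)
  case kd_zero
  then have "Y = {0}" using ksub_zero by blast
  then show ?case using kd.kd_zero by auto
next
  case (kd_ext X0 n0 e)
  note X0 = kd_ksub[OF kd_ext.hyps(1)] and Y = kd_ext.prems(1)
  obtain m0 where m0: "m0 \<le> n0" "kd (Y \<inter> X0) m0" using kd_ext.IH[OF ksub_Int[OF Y X0]] by blast
  show ?case
  proof (cases "Y \<subseteq> X0")
    case True
    then show ?thesis using m0 by (metis Int_absorb2 le_SucI)
  next
    case False
    then obtain y where y: "y \<in> Y" "y \<notin> X0" by blast
    have "kext (Y \<inter> X0) y = Y"
      using kext_Int_subset[OF Y X0 y kd_ext.prems(2)] kext_subset[OF Y _ y(1), of "Y \<inter> X0"] by blast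
    then have "kd Y (Suc m0)" using kd.kd_ext[OF m0(2), of y] y by auto
    then show ?thesis using m0 by auto
  qed
qed

lemma kd_direct_sum:
  assumes "kd Y m" "kd X n" "X \<inter> Y = {0}"
  shows "kd {x + y | x y. x \<in> X \<and> y \<in> Y} (n + m)"
  using assms
proof (induction rule: kd.induct)
  case kd_zero
  then show ?case by simp
next
  case (kd_ext Y0 m0 e)
  note Y0 = kd_ksub[OF kd_ext.hyps(1)] and X = kd_ksub[OF kd_ext.prems(1)]
  let ?S = "{x + y | x y. x \<in> X \<and> y \<in> Y0}"
  have "X \<inter> Y0 = {0}" using kd_ext.prems(2) kext_superset[of Y0 e] ksub_zero[OF X] ksub_zero[OF Y0] by blast
  then have S: "kd ?S (n + m0)" using kd_ext.IH[OF kd_ext.prems(1)] by simp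
  have "e \<notin> ?S"
  proof
    assume "e \<in> ?S"
    then obtain x y where *: "e = x + y" "x \<in> X" "y \<in> Y0" by blast
    have "x = e - y" using * by simp
    then have "x = - y + sc 1 e" by simp
    then have "x \<in> kext Y0 e" using * kextI[OF _ K_one] ksub_minus[OF Y0] by metis
    then have "x = 0" using * kd_ext.prems(2) by blast
    then show False using * kd_ext.hyps by simp
  qed
  then have "kd (kext ?S e) (Suc (n + m0))" using kd.kd_ext[OF S] by blast
  moreover have "kext ?S e = {x + y | x y. x \<in> X \<and> y \<in> kext Y0 e}"
  proof (intro set_eqI iffI)
    fix z assume "z \<in> kext ?S e"
    then obtain x y c where "x \<in> X" "y \<in> Y0" "c \<in> K" "z = x + y + sc c e" by (auto elim!: kextE)
    then have "z = x + (y + sc c e)" "y + sc c e \<in> kext Y0 e" by (auto simp: add.assoc intro: kextI)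
    then show "z \<in> {x + y | x y. x \<in> X \<and> y \<in> kext Y0 e}" using \<open>x \<in> X\<close> by blast
  next
    fix z assume "z \<in> {x + y | x y. x \<in> X \<and> y \<in> kext Y0 e}"
    then obtain x y c where "x \<in> X" "y \<in> Y0" "c \<in> K" "z = x + (y + sc c e)" by (auto elim!: kextE)
    then have "z = (x + y) + sc c e" "x + y \<in> ?S" by (auto simp: add.assoc)
    then show "z \<in> kext ?S e" using kextI[of "x + y" ?S c e] \<open>c \<in> K\<close> by simp
  qed
  ultimately show ?case by simp
qed

section \<open>Independence over K and maximal independent sets\<close>

definition kindep :: "'v set \<Rightarrow> bool" where
  "kindep S \<longleftrightarrow> (\<forall>c. (\<forall>u\<in>S. c u \<in> K) \<longrightarrow> (\<Sum>u\<in>S. sc (c u) u) = 0 \<longrightarrow> (\<forall>u\<in>S. c u = 0))"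

lemma kindepD:
  "kindep S \<Longrightarrow> \<forall>u\<in>S. c u \<in> K \<Longrightarrow> (\<Sum>u\<in>S. sc (c u) u) = 0 \<Longrightarrow> u \<in> S \<Longrightarrow> c u = 0"
  by (simp add: kindep_def)

lemma K_sum_in:
  assumes "ksub X" "finite S" "S \<subseteq> X" "\<forall>u\<in>S. c u \<in> K"
  shows "(\<Sum>u\<in>S. sc (c u) u) \<in> X"
  using assms(2,3,4) by (induction) (auto simp: ksub_zero[OF assms(1)] intro!: ksub_add[OF assms(1)] ksub_scale[OF assms(1)])

lemma kd_imp_kindep:
  assumes "kd X n" shows "\<exists>S. finite S \<and> S \<subseteq> X \<and> card S = n \<and> kindep S"
  using assms
proof (induction rule: kd.induct)
  case kd_zero
  show ?case by (rule exI[of _ "{}"]) (simp add: kindep_def)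
next
  case (kd_ext X n e)
  note X = kd_ksub[OF kd_ext.hyps(1)]
  obtain S where S: "finite S" "S \<subseteq> X" "card S = n" "kindep S" using kd_ext.IH by auto
  have e: "e \<notin> S" using S kd_ext.hyps by auto
  have "kindep (insert e S)"
    unfolding kindep_def
  proof (intro allI impI)
    fix c assume c: "\<forall>u\<in>insert e S. c u \<in> K" and s: "(\<Sum>u\<in>insert e S. sc (c u) u) = 0"
    have eq: "sc (c e) e = - (\<Sum>u\<in>S. sc (c u) u)" using s S e by (simp add: eq_neg_iff_add_eq_0)
    have inX: "- (\<Sum>u\<in>S. sc (c u) u) \<in> X" using K_sum_in[OF X S(1,2)] c ksub_minus[OF X] by simp
    have "c e = 0"
    proof (rule ccontr)
      assume "c e \<noteq> 0"
      then have "e = sc (inverse (c e)) (sc (c e) e)" by simp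
      also have "\<dots> \<in> X" unfolding eq using ksub_scale[OF X _ inX] K_inverse c by simp
      finally show False using kd_ext by simp
    qed
    moreover have "\<forall>u\<in>S. c u = 0" using S(4) c eq \<open>c e = 0\<close> by (simp add: kindep_def)
    ultimately show "\<forall>u\<in>insert e S. c u = 0" by simp
  qed
  moreover have "insert e S \<subseteq> kext X e" using S kext_superset kext_self[OF ksub_zero[OF X]] by blast
  ultimately show ?case using S e by (intro exI[of _ "insert e S"]) auto
qed

text \<open>The clause on linear combinations carries the induction: it shows that the next
  independent vector lies outside the space built so far.\<close>

lemma kindep_imp_kd:
  assumes "finite S" "kindep S" "S \<subseteq> Y" "ksub Y"
  shows "\<exists>X. X \<subseteq> Y \<and> kd X (card S) \<and> (\<forall>x\<in>X. \<exists>c. (\<forall>u\<in>S. c u \<in> K) \<and> x = (\<Sum>u\<in>S. sc (c u) u))"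
  using assms
proof (induction)
  case empty
  then show ?case using ksub_zero by (intro exI[of _ "{0}"]) (auto simp: kd_zero)
next
  case (insert e S)
  have "kindep S"
    unfolding kindep_def
  proof (intro allI impI)
    fix c assume c: "\<forall>u\<in>S. c u \<in> K" and s: "(\<Sum>u\<in>S. sc (c u) u) = 0"
    have "(\<Sum>u\<in>S. sc ((c(e := 0)) u) u) = (\<Sum>u\<in>S. sc (c u) u)"
      using insert.hyps by (intro sum.cong) auto
    then have "(\<Sum>u\<in>insert e S. sc ((c(e := 0)) u) u) = 0" using insert.hyps s by simp
    moreover have "\<forall>u\<in>insert e S. (c(e := 0)) u \<in> K" using c K_zero by simp
    ultimately have *: "(c(e := 0)) u = 0" if "u \<in> insert e S" for u
      using kindepD[OF insert.prems(1)] that by blast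
    show "\<forall>u\<in>S. c u = 0"
    proof
      fix u assume "u \<in> S"
      then show "c u = 0" using *[of u] insert.hyps by (auto split: if_splits)
    qed
  qed
  then obtain X where X: "X \<subseteq> Y" "kd X (card S)" "\<forall>x\<in>X. \<exists>c. (\<forall>u\<in>S. c u \<in> K) \<and> x = (\<Sum>u\<in>S. sc (c u) u)"
    using insert.IH[OF _ _ insert.prems(3)] insert.prems(2) by auto
  have "e \<notin> X"
  proof
    assume "e \<in> X"
    then obtain c where c: "\<forall>u\<in>S. c u \<in> K" "e = (\<Sum>u\<in>S. sc (c u) u)" using X(3) by auto
    have "(\<Sum>u\<in>S. sc ((c(e := -1)) u) u) = (\<Sum>u\<in>S. sc (c u) u)"
      using insert.hyps by (intro sum.cong) auto
    then have "(\<Sum>u\<in>insert e S. sc ((c(e := -1)) u) u) = 0" using insert.hyps c(2) by simp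
    moreover have "\<forall>u\<in>insert e S. (c(e := -1)) u \<in> K" using c K_minus K_one by simp
    ultimately have "(c(e := -1)) e = 0" using kindepD[OF insert.prems(1)] by blast
    then show False by simp
  qed
  then have 1: "kd (kext X e) (card (insert e S))" using kd_ext[OF X(2)] insert.hyps by simp
  have 2: "kext X e \<subseteq> Y" using kext_subset insert.prems X by simp
  have 3: "\<exists>c. (\<forall>u\<in>insert e S. c u \<in> K) \<and> x = (\<Sum>u\<in>insert e S. sc (c u) u)" if "x \<in> kext X e" for x
  proof -
    obtain y a where y: "y \<in> X" "a \<in> K" "x = y + sc a e"
      using \<open>x \<in> kext X e\<close> by (auto elim: kextE)
    obtain c where c: "\<forall>u\<in>S. c u \<in> K" "y = (\<Sum>u\<in>S. sc (c u) u)" using y X(3) by auto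
    have "(\<Sum>u\<in>S. sc ((c(e := a)) u) u) = (\<Sum>u\<in>S. sc (c u) u)"
      using insert.hyps by (intro sum.cong) auto
    then have "x = (\<Sum>u\<in>insert e S. sc ((c(e := a)) u) u)" using y c insert.hyps by (simp add: add.commute)
    then show ?thesis using c y by (intro exI[of _ "c(e := a)"]) simp
  qed
  show ?case using 1 2 3 by (intro exI[of _ "kext X e"]) simp
qed

lemma kd_Max:
  assumes "kd X n"
  shows "Max {card S | S. finite S \<and> S \<subseteq> X \<and> kindep S} = n"
proof (rule Max_eqI)
  have le: "card S \<le> n" if "finite S" "S \<subseteq> X" "kindep S" for S
  proof -
    obtain Y where "Y \<subseteq> X" "kd Y (card S)" 
      using kindep_imp_kd[OF \<open>finite S\<close> \<open>kindep S\<close> \<open>S \<subseteq> X\<close> kd_ksub[OF assms]] by auto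
    then show ?thesis using kd_le[OF assms] by simp
  qed
  have sub: "{card S | S. finite S \<and> S \<subseteq> X \<and> kindep S} \<subseteq> {..n}" using le by blast
  then show "finite {card S | S. finite S \<and> S \<subseteq> X \<and> kindep S}"
    by (rule finite_subset) simp
  show "\<And>y. y \<in> {card S | S. finite S \<and> S \<subseteq> X \<and> kindep S} \<Longrightarrow> y \<le> n" using sub by auto
  obtain S where "finite S" "S \<subseteq> X" "card S = n" "kindep S" using kd_imp_kindep[OF assms] by auto
  then show "n \<in> {card S | S. finite S \<and> S \<subseteq> X \<and> kindep S}"
    unfolding mem_Collect_eq by (intro exI[of _ S]) simp
qed

end

text \<open>Rank-nullity, by induction on the image: dropping its last vector replaces X by a
  preimage of codimension one. Two scalings occur because evaluation sends endomorphisms to vectors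
  and \<open>sym_tensor\<close> sends vectors to endomorphisms.\<close>

lemma kd_fiber:
  fixes s1 :: "'a::field \<Rightarrow> 'v::ab_group_add \<Rightarrow> 'v" and s2 :: "'a \<Rightarrow> 'w::ab_group_add \<Rightarrow> 'w"
  assumes "subfield_space s1 K" "subfield_space s2 K"
    and "subfield_space.kd s1 K {x\<in>X. f x = 0} p" "subfield_space.kd s2 K (f ` X) q"
    and "subfield_space.ksub s1 K X"
    and add: "\<And>x y. x \<in> X \<Longrightarrow> y \<in> X \<Longrightarrow> f (x + y) = f x + f y"
    and scale: "\<And>c x. c \<in> K \<Longrightarrow> x \<in> X \<Longrightarrow> f (s1 c x) = s2 c (f x)"
  shows "subfield_space.kd s1 K X (p + q)"
proof -
  interpret A: subfield_space s1 K by fact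
  interpret B: subfield_space s2 K by fact
  have "A.kd X (p + q)" if "B.kd Z q" "A.ksub X" "f ` X = Z" "A.kd {x\<in>X. f x = 0} p"
    "\<And>x y. x \<in> X \<Longrightarrow> y \<in> X \<Longrightarrow> f (x + y) = f x + f y"
    "\<And>c x. c \<in> K \<Longrightarrow> x \<in> X \<Longrightarrow> f (s1 c x) = s2 c (f x)" for Z X
    using that
  proof (induction arbitrary: X rule: B.kd.induct)
    case kd_zero
    then have "{x\<in>X. f x = 0} = X" by auto
    then show ?case using kd_zero by simp
  next
    case (kd_ext Z n e)
    note X = kd_ext.prems(1) and fX = kd_ext.prems(2) and add = kd_ext.prems(4) and scale = kd_ext.prems(5)
    note Z = B.kd_ksub[OF kd_ext.hyps(1)]
    define X0 where "X0 = {x\<in>X. f x \<in> Z}"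
    have X0X: "X0 \<subseteq> X" by (auto simp: X0_def)
    have "f 0 = 0" using scale[OF A.K_zero A.ksub_zero[OF X]] by simp
    then have X0: "A.ksub X0"
      using X Z by (auto simp: X0_def A.ksub_def B.ksub_def add scale)
    have fX0: "f ` X0 = Z"
    proof
      show "Z \<subseteq> f ` X0"
      proof
        fix z assume z: "z \<in> Z"
        then have "z \<in> f ` X" using fX B.kext_superset[of Z e] by blast
        then show "z \<in> f ` X0" using z by (auto simp: X0_def)
      qed
    qed (auto simp: X0_def)
    have "{x\<in>X0. f x = 0} = {x\<in>X. f x = 0}" using B.ksub_zero[OF Z] by (auto simp: X0_def)
    then have kd0: "A.kd X0 (p + n)"
      using kd_ext.IH[OF X0 fX0] kd_ext.prems(3) add scale X0X by (simp add: subset_iff)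
    have "e \<in> f ` X" using fX B.kext_self[OF B.ksub_zero[OF Z]] by simp
    then obtain x1 where x1: "x1 \<in> X" "f x1 = e" by blast
    have "x1 \<notin> X0" using x1 kd_ext.hyps by (simp add: X0_def)
    then have "A.kd (A.kext X0 x1) (Suc (p + n))" using A.kd_ext[OF kd0] by simp
    moreover have "A.kext X0 x1 = X"
    proof
      show "A.kext X0 x1 \<subseteq> X" by (rule A.kext_subset[OF X X0X x1(1)])
      show "X \<subseteq> A.kext X0 x1"
      proof
        fix x assume x: "x \<in> X"
        then have "f x \<in> B.kext Z e" using fX by auto
        then obtain z c where z: "z \<in> Z" "c \<in> K" "f x = z + s2 c e" by (auto elim: B.kextE)
        have c: "- c \<in> K" using A.K_minus z by simp
        have "f (x + s1 (- c) x1) = z" using z x1 add[OF x A.ksub_scale[OF X c x1(1)]] scale[OF c x1(1)] by simp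
        then have "x + s1 (- c) x1 \<in> X0" using z A.ksub_add[OF X x A.ksub_scale[OF X c x1(1)]] by (simp add: X0_def)
        then have "x - s1 c x1 \<in> X0" by simp
        then show "x \<in> A.kext X0 x1" by (rule A.kext_diffI[OF _ z(2)])
      qed
    qed
    ultimately show ?case by simp
  qed
  from this[OF assms(4) assms(5) refl assms(3) add scale] show ?thesis .
qed

section \<open>Hermitian spaces and the trace form\<close>

lemma (in subfield_space) kd_functional:
  assumes "kd Y p"
    and add: "\<And>x y. x \<in> Y \<Longrightarrow> y \<in> Y \<Longrightarrow> f (x + y) = f x + f y"
    and scale: "\<And>c x. c \<in> K \<Longrightarrow> x \<in> Y \<Longrightarrow> f (sc c x) = c * f x"
    and val: "\<And>x. x \<in> Y \<Longrightarrow> f x \<in> K"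
  shows "\<exists>q. kd {y\<in>Y. f y = 0} q \<and> p \<le> Suc q"
proof -
  note Y = kd_ksub[OF assms(1)]
  have f0: "f 0 = 0" using scale[OF K_zero, of 0] ksub_zero[OF Y] by simp
  show ?thesis
  proof (cases "\<forall>y\<in>Y. f y = 0")
    case True
    then have "{y\<in>Y. f y = 0} = Y" by blast
    then show ?thesis using assms(1) by (intro exI[of _ p]) simp
  next
    case False
    then obtain y where y: "y \<in> Y" "f y \<noteq> 0" by blast
    have sub: "ksub {y\<in>Y. f y = 0}"
      using Y f0 by (auto simp: ksub_def add scale)
    have "Y \<subseteq> kext {y\<in>Y. f y = 0} y"
    proof
      fix z assume z: "z \<in> Y"
      let ?c = "f z / f y"
      have c: "?c \<in> K" using val y z K_divide by blast
      have c': "- ?c \<in> K" using c K_minus by blast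
      have "z - sc ?c y = z + sc (- ?c) y" by simp
      moreover have "f (z + sc (- ?c) y) = 0"
        using add[OF z ksub_scale[OF Y c' y(1)]] scale[OF c' y(1)] y(2) by simp
      moreover have "z + sc (- ?c) y \<in> Y" using ksub_add[OF Y z ksub_scale[OF Y c' y(1)]] .
      ultimately have "z - sc ?c y \<in> {y\<in>Y. f y = 0}" by simp
      then show "z \<in> kext {y\<in>Y. f y = 0} y" by (rule kext_diffI[OF _ c])
    qed
    then obtain q where "p = Suc q" "kd {y\<in>Y. f y = 0} q"
      using kd_hyperplane[OF assms(1) sub _ y(1)] y by blast
    then show ?thesis by auto
  qed
qed

text \<open>Nondegeneracy is left to \<open>nondeg_on\<close>: the form stays on all of V while the
  subspace under study shrinks.\<close>

locale hermitian_space = vector_space scale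
  for scale :: "'a::field \<Rightarrow> 'v::ab_group_add \<Rightarrow> 'v" +
  fixes st :: "'a \<Rightarrow> 'a" and b :: "'v \<Rightarrow> 'v \<Rightarrow> 'a"
  assumes inv: "field_involution st" and nonid: "\<exists>x. st x \<noteq> x"
    and sesq: "sesquilinear st scale b" and herm: "hermitian_form st b"
begin

lemma st_add [simp]: "st (x + y) = st x + st y"
  and st_mult [simp]: "st (x * y) = st x * st y"
  and st_st [simp]: "st (st x) = x"
  using inv by (auto simp: field_involution_def)

lemma st_0 [simp]: "st 0 = 0"
proof -
  have "st 0 + st 0 = st 0 + 0" using st_add[of 0 0] by simp
  then show ?thesis by (simp only: add_left_cancel)
qed

lemma st_eq_0_iff [simp]: "st x = 0 \<longleftrightarrow> x = 0"
  by (metis st_0 st_st)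

lemma st_1 [simp]: "st 1 = 1"
proof -
  have "st 1 * st 1 = st 1 * 1" by (metis st_mult mult_1 mult_1_right)
  then show ?thesis by simp
qed

lemma st_minus [simp]: "st (- x) = - st x"
  using st_add[of x "- x"] by (simp add: eq_neg_iff_add_eq_0 add.commute)

lemma st_diff [simp]: "st (x - y) = st x - st y"
  using st_add[of x "- y"] by simp

lemma st_inverse [simp]: "st (inverse x) = inverse (st x)"
proof (cases "x = 0")
  case False
  then have "st x * st (inverse x) = 1" by (simp flip: st_mult)
  then show ?thesis using inverse_unique by metis
qed simp

lemma st_divide [simp]: "st (x / y) = st x / st y"
  by (simp add: divide_inverse)

abbreviation K :: "'a set" where "K \<equiv> fixed_field st"

lemma K_iff: "c \<in> K \<longleftrightarrow> st c = c"
  by (simp add: fixed_field_def)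

sublocale kv: subfield_space scale K
  by unfold_locales (auto simp: fixed_field_def)

abbreviation fscale :: "'a \<Rightarrow> ('v \<Rightarrow> 'v) \<Rightarrow> 'v \<Rightarrow> 'v" where
  "fscale c u \<equiv> (\<lambda>x. scale c (u x))"

sublocale kf: subfield_space "\<lambda>c u. fscale c u" K
  by unfold_locales (auto simp: fixed_field_def plus_fun_def algebra_simps)

text \<open>If the trace vanished identically, then st x = -x, and x = 1 would give 1 = -1, hence st
  = id. An element of nonzero trace is then divided by its trace.\<close>

lemma trace_one: "\<exists>\<tau>. \<tau> + st \<tau> = 1"
proof -
  obtain a where a: "a + st a \<noteq> 0"
  proof (rule ccontr)
    assume "\<not> thesis"
    then have *: "x + st x = 0" for x using that by blast
    have "st x = x" for x
    proof -
      have "st x = - x" using *[of x] by (simp add: eq_neg_iff_add_eq_0 add.commute)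
      also have "\<dots> = x" using *[of 1] by (metis st_1 distrib_left mult.right_neutral mult_zero_right neg_eq_iff_add_eq_0)
      finally show ?thesis .
    qed
    then show False using nonid by blast
  qed
  have "a / (a + st a) + st (a / (a + st a)) = (a + st a) / (a + st a)"
    unfolding st_divide st_add st_st add.commute[of "st a" a] add_divide_distrib ..
  then show ?thesis using a by (intro exI[of _ "a / (a + st a)"]) simp
qed

definition tau :: 'a where "tau = (SOME t. t + st t = 1)"

lemma tau: "tau + st tau = 1"
  unfolding tau_def using someI_ex[OF trace_one] .

lemma ex_trace_zero: "\<exists>j. j \<noteq> 0 \<and> j + st j = 0"
proof -
  obtain c where "st c \<noteq> c" using nonid by blast
  then show ?thesis by (intro exI[of _ "c - st c"]) simp
qed

definition jj :: 'a where "jj = (SOME j. j \<noteq> 0 \<and> j + st j = 0)"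

lemma jj: "jj \<noteq> 0" "jj + st jj = 0" "st jj = - jj"
proof -
  show 1: "jj \<noteq> 0" "jj + st jj = 0" unfolding jj_def using someI_ex[OF ex_trace_zero] by auto
  then show "st jj = - jj" by (simp add: eq_neg_iff_add_eq_0 add.commute)
qed

lemma trace_in_K: "c + st c \<in> K"
  by (simp add: K_iff add.commute)

text \<open>The trace of c is its coordinate along \<open>tau\<close>; the rest has trace zero,
  hence is a K-multiple of \<open>jj\<close>.\<close>

lemma K_decomposition: "\<exists>k\<in>K. \<exists>l\<in>K. c = k * jj + l * tau"
proof -
  let ?l = "c + st c"
  have "(c - ?l * tau) + st (c - ?l * tau) = ?l - ?l * (tau + st tau)"
    by (simp add: algebra_simps)
  also have "\<dots> = 0" by (simp add: tau)
  finally have "st (c - ?l * tau) = - (c - ?l * tau)" by (simp only: eq_neg_iff_add_eq_0 add.commute)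
  then have "(c - ?l * tau) / jj \<in> K" by (simp only: K_iff st_divide jj minus_divide_divide)
  moreover have "c = (c - ?l * tau) / jj * jj + ?l * tau" using jj by simp
  ultimately show ?thesis using trace_in_K by blast
qed

lemma b_add_right [simp]: "b x (y + z) = b x y + b x z"
  and b_scale_right [simp]: "b x (scale c y) = c * b x y"
  using sesq by (auto simp: sesquilinear_def)

lemma b_comm: "b y x = st (b x y)"
  using herm unfolding hermitian_form_def by blast

lemma st_b [simp]: "st (b x y) = b y x"
  by (rule b_comm[symmetric])

lemma b_add_left [simp]: "b (x + y) z = b x z + b y z"
  and b_scale_left [simp]: "b (scale c x) z = st c * b x z"
  unfolding b_comm[of _ z] by (simp_all del: st_b)

lemma b_zero [simp]: "b x 0 = 0" "b 0 x = 0"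
  using b_scale_right[of x 0 0] b_scale_left[of 0 0 x] by simp_all

lemma b_minus [simp]: "b x (- y) = - b x y" "b (- x) y = - b x y"
  using b_add_right[of x y "- y"] b_add_left[of x "- x" y] by (simp_all add: eq_neg_iff_add_eq_0 add.commute)

lemma b_diff [simp]: "b x (y - z) = b x y - b x z" "b (x - y) z = b x z - b y z"
  using b_add_right[of x y "- z"] b_add_left[of x "- y" z] by simp_all

lemma b_sum_right: "b x (sum f S) = (\<Sum>i\<in>S. b x (f i))"
  by (induction S rule: infinite_finite_induct) simp_all

lemma b_eq_0_comm: "b x y = 0 \<longleftrightarrow> b y x = 0"
  by (metis b_comm st_eq_0_iff)

section \<open>The trace form and its orthogonals\<close>

definition btr :: "'v \<Rightarrow> 'v \<Rightarrow> 'a" where "btr x z = b x z + b z x"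

lemma btr_simps:
  "btr x (y + z) = btr x y + btr x z" "btr (x + y) z = btr x z + btr y z"
  "btr x 0 = 0" "btr 0 x = 0"
  "c \<in> K \<Longrightarrow> btr x (scale c y) = c * btr x y" "c \<in> K \<Longrightarrow> btr (scale c x) y = c * btr x y"
  by (simp_all add: btr_def algebra_simps K_iff)

lemma btr_comm: "btr x y = btr y x"
  by (simp add: btr_def add.commute)

lemma btr_in_K: "btr x y \<in> K"
  by (simp add: btr_def K_iff add.commute)

text \<open>A nonzero value of b can be rescaled to \<open>tau\<close>, whose trace is one. This is
  why b and its trace form define the same orthogonal of an F-subspace.\<close>

lemma btr_all_zero:
  assumes "\<And>c. btr x (scale c y) = 0"
  shows "b x y = 0"
proof (rule ccontr)
  assume n: "b x y \<noteq> 0"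
  have "btr x (scale (tau / b x y) y) = tau + st tau"
    using n b_eq_0_comm[of x y] by (simp add: btr_def)
  then show False using assms tau by simp
qed

definition nondeg_on :: "'v set \<Rightarrow> bool" where
  "nondeg_on U \<longleftrightarrow> (\<forall>y\<in>U. (\<forall>x\<in>U. b x y = 0) \<longrightarrow> y = 0)"

definition perp :: "'v set \<Rightarrow> 'v set \<Rightarrow> 'v set" where
  "perp U X = {z\<in>U. \<forall>x\<in>X. btr x z = 0}"

lemma perp_kext: "0 \<in> X \<Longrightarrow> perp U (kv.kext X e) = {z\<in>perp U X. btr e z = 0}"
proof (intro set_eqI iffI)
  fix z assume "0 \<in> X" "z \<in> perp U (kv.kext X e)"
  then show "z \<in> {z\<in>perp U X. btr e z = 0}"
    using kv.kext_superset[of X e] kv.kext_self[of X e] by (auto simp: perp_def)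
next
  fix z assume "z \<in> {z\<in>perp U X. btr e z = 0}"
  then show "z \<in> perp U (kv.kext X e)" by (auto simp: perp_def btr_simps elim!: kv.kextE)
qed

lemma kd_perp_step:
  assumes "kv.kd X m" "kv.kd (perp U X) r"
  shows "\<exists>r'. kv.kd (perp U (kv.kext X e)) r' \<and> r \<le> Suc r'"
proof -
  have "0 \<in> X" using kv.kd_ksub[OF assms(1)] kv.ksub_zero by blast
  show ?thesis
    unfolding perp_kext[OF \<open>0 \<in> X\<close>]
    by (rule kv.kd_functional[OF assms(2)]) (auto simp: btr_simps btr_in_K)
qed

lemma kd_perp_lower:
  assumes U: "kv.kd U N" and "kv.kd X m" "X \<subseteq> U"
  shows "\<exists>r. kv.kd (perp U X) r \<and> N \<le> r + m"
  using assms(2,3)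
proof (induction rule: kv.kd.induct)
  case kd_zero
  have "perp U {0} = U" by (auto simp: perp_def btr_simps)
  then show ?case using U by auto
next
  case (kd_ext X n e)
  then obtain r where "kv.kd (perp U X) r" "N \<le> r + n" using kv.kext_superset[of X e] by blast
  then show ?case using kd_perp_step[OF kd_ext.hyps(1), of U r e] by fastforce
qed

text \<open>Induction on the codimension of X: adjoining a vector costs the orthogonal at most one
  dimension, and at X = U nothing is left of it by nondegeneracy.\<close>

lemma kd_perp_upper:
  assumes U: "kv.kd U N" "subspace U" "nondeg_on U"
    and "kv.kd X m" "X \<subseteq> U" "kv.kd (perp U X) r"
  shows "r + m \<le> N"
  using assms(4-6)
proof (induction "N - m" arbitrary: X m r)
  case 0
  then have "m = N" using kv.kd_le[OF U(1)] by fastforce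
  then have "X = U" using kv.kd_eq[OF U(1), of X] 0 by simp
  have "perp U U = {0}"
  proof -
    have "z = 0" if z: "z \<in> perp U U" for z
    proof -
      have "b z x = 0" if "x \<in> U" for x
      proof (rule btr_all_zero)
        fix c
        have "scale c x \<in> U" using that U(2) subspace_scale by blast
        then show "btr z (scale c x) = 0" using z btr_comm[of z] by (simp add: perp_def)
      qed
      then show ?thesis using U(3) z b_eq_0_comm by (auto simp: nondeg_on_def perp_def)
    qed
    moreover have "0 \<in> perp U U" using U(2) subspace_0 by (auto simp: perp_def btr_simps)
    ultimately show ?thesis by blast
  qed
  then have "kv.kd {0} r" using 0 \<open>X = U\<close> by simp
  then have "r = 0" using kv.kd_unique[OF kv.kd_zero] by simp
  then show ?case using \<open>m = N\<close> by simp
next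
  case (Suc k)
  have "X \<noteq> U" using Suc kv.kd_unique[OF U(1), of m] by auto
  then obtain e where e: "e \<in> U" "e \<notin> X" using Suc by blast
  have X': "kv.kd (kv.kext X e) (Suc m)" using kv.kd_ext[OF Suc.prems(1) e(2)] .
  have sub: "kv.kext X e \<subseteq> U" using kv.kext_subset[OF kv.kd_ksub[OF U(1)]] Suc e by blast
  obtain r' where r': "kv.kd (perp U (kv.kext X e)) r'" "r \<le> Suc r'"
    using kd_perp_step[OF Suc.prems(1,3)] by auto
  have "r' + Suc m \<le> N" using Suc.hyps(1)[OF _ X' sub r'(1)] Suc.hyps(2) by simp
  then show ?case using r' by simp
qed

lemma kd_perp:
  assumes "kv.kd U N" "subspace U" "nondeg_on U" "kv.kd X m" "X \<subseteq> U"
  shows "kv.kd (perp U X) (N - m)" "m \<le> N"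
proof -
  obtain r where r: "kv.kd (perp U X) r" "N \<le> r + m" using kd_perp_lower[OF assms(1,4,5)] by auto
  have "r + m \<le> N" using kd_perp_upper[OF assms r(1)] .
  with r(2) have "r = N - m" "m \<le> N" by auto
  then show "kv.kd (perp U X) (N - m)" "m \<le> N" using r by auto
qed

lemma perp_perp:
  assumes "kv.kd U N" "subspace U" "nondeg_on U" "kv.ksub X" "X \<subseteq> U"
  shows "perp U (perp U X) = X"
proof -
  obtain m where m: "kv.kd X m" using kv.kd_subset_exists[OF assms(1,4,5)] by auto
  note 1 = kd_perp[OF assms(1-3) m assms(5)]
  have "perp U X \<subseteq> U" by (auto simp: perp_def)
  then have "kv.kd (perp U (perp U X)) (N - (N - m))" using kd_perp(1)[OF assms(1-3) 1(1)] by simp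
  moreover have "X \<subseteq> perp U (perp U X)" using assms(5) btr_comm by (auto simp: perp_def)
  ultimately show ?thesis using kv.kd_eq[of "perp U (perp U X)" m X] m 1(2) by simp
qed

lemma perp_subspace:
  assumes "subspace X"
  shows "perp U X = {z\<in>U. \<forall>x\<in>X. b x z = 0}"
proof -
  have "b x z = 0" if "z \<in> perp U X" "x \<in> X" for x z
  proof -
    have "b z x = 0"
      by (rule btr_all_zero) (use that assms subspace_scale btr_comm in \<open>auto simp: perp_def\<close>)
    then show ?thesis using b_eq_0_comm by blast
  qed
  moreover have "btr x z = 0" if "b x z = 0" for x z
    using that b_eq_0_comm by (simp add: btr_def)
  ultimately show ?thesis by (auto simp: perp_def)
qed

lemma mem_subspace_by_perp:
  assumes "kv.kd U N" "subspace U" "nondeg_on U" "subspace X" "X \<subseteq> U" "z \<in> U"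
    and "\<And>g. g \<in> U \<Longrightarrow> (\<And>x. x \<in> X \<Longrightarrow> b x g = 0) \<Longrightarrow> b g z = 0"
  shows "z \<in> X"
proof -
  have "z \<in> perp U (perp U X)"
    unfolding perp_subspace[OF assms(4)]
  proof (subst perp_def, intro CollectI conjI ballI)
    fix g assume "g \<in> {z\<in>U. \<forall>x\<in>X. b x z = 0}"
    then have "b g z = 0" using assms(7) by simp
    then show "btr g z = 0" using b_eq_0_comm[of g z] by (simp add: btr_def)
  qed (rule assms(6))
  then show ?thesis using perp_perp[OF assms(1-3) kv.ksub_subspace[OF assms(4)] assms(5)] by simp
qed

section \<open>F-subspaces as K-spaces of doubled dimension\<close>

lemma kd_line:
  assumes "x \<noteq> 0"
  shows "kv.kd (range (\<lambda>c. scale c x)) 2"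
proof -
  have 1: "kv.kd (kv.kext {0} (scale jj x)) 1"
    using kv.kd_ext[OF kv.kd_zero, of "scale jj x"] jj assms by simp
  have "scale tau x \<notin> kv.kext {0} (scale jj x)"
  proof
    assume "scale tau x \<in> kv.kext {0} (scale jj x)"
    then obtain c where c: "c \<in> K" "scale tau x = scale (c * jj) x" by (auto elim!: kv.kextE)
    then have "tau = c * jj" using assms scale_cancel_right by blast
    then have "tau + st tau = c * (jj + st jj)" using c by (simp add: K_iff algebra_simps)
    then show False using tau jj by simp
  qed
  then have 2: "kv.kd (kv.kext (kv.kext {0} (scale jj x)) (scale tau x)) 2"
    using kv.kd_ext[OF 1] by (simp add: numeral_2_eq_2)
  have "range (\<lambda>c. scale c x) = kv.kext (kv.kext {0} (scale jj x)) (scale tau x)" (is "?A = ?B")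
  proof (intro set_eqI iffI)
    fix z assume "z \<in> ?A"
    then obtain c where "z = scale c x" by blast
    moreover obtain k l where "k \<in> K" "l \<in> K" "c = k * jj + l * tau" using K_decomposition by blast
    ultimately have z: "z = (0 + scale k (scale jj x)) + scale l (scale tau x)" by (simp add: scale_left_distrib)
    show "z \<in> ?B" unfolding z by (intro kv.kextI) (use \<open>k \<in> K\<close> \<open>l \<in> K\<close> in auto)
  next
    fix z assume "z \<in> ?B"
    then obtain k l where "z = scale (k * jj) x + scale l (scale tau x)" by (auto elim!: kv.kextE)
    then have "z = scale (k * jj + l * tau) x" by (simp add: scale_left_distrib)
    then show "z \<in> ?A" by blast
  qed
  then show ?thesis using 2 by simp
qed

lemma kd_subspace_insert:
  assumes "kv.kd S n" "subspace S" "x \<notin> S"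
  shows "kv.kd {s + scale c x | s c. s \<in> S} (n + 2)"
proof -
  have x: "x \<noteq> 0" using assms subspace_0 by blast
  have "S \<inter> range (\<lambda>c. scale c x) = {0}"
  proof -
    have "c = 0" if "scale c x \<in> S" for c
    proof (rule ccontr)
      assume "c \<noteq> 0"
      then have "x = scale (inverse c) (scale c x)" by simp
      then show False using that assms subspace_scale by metis
    qed
    then show ?thesis using subspace_0[OF assms(2)] by auto
  qed
  then have "kv.kd {s + y | s y. s \<in> S \<and> y \<in> range (\<lambda>c. scale c x)} (n + 2)"
    using kv.kd_direct_sum[OF kd_line[OF x] assms(1)] by simp
  moreover have "{s + y | s y. s \<in> S \<and> y \<in> range (\<lambda>c. scale c x)} = {s + scale c x | s c. s \<in> S}" by blast
  ultimately show ?thesis by simp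
qed

lemma kd_span:
  assumes "finite B" "independent B"
  shows "kv.kd (span B) (2 * card B)"
  using assms
proof induction
  case empty
  then show ?case using kv.kd_zero by simp
next
  case (insert x B)
  have i: "independent B" "x \<notin> span B" using insert by (auto simp: independent_insert)
  have "span (insert x B) = {s + scale c x | s c. s \<in> span B}"
    unfolding span_insert by (auto, metis diff_add_cancel, metis add_diff_cancel_right')
  then show ?case using kd_subspace_insert[OF insert.IH[OF i(1)] subspace_span i(2)] insert.hyps by simp
qed

lemma kd_subspace_dim:
  assumes "subspace S" "S \<subseteq> span B" "finite B"
  shows "kv.kd S (2 * dim S)"
proof -
  obtain C where C: "C \<subseteq> S" "independent C" "S \<subseteq> span C" "card C = dim S" using basis_exists by blast
  have "finite C" using independent_span_bound[OF assms(3) C(2)] C(1) assms(2) by blast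
  moreover have "span C = S" using C assms(1) by (simp add: span_minimal subset_antisym)
  ultimately show ?thesis using kd_span C by metis
qed

end

section \<open>Low-rank perturbations of nilpotent endomorphisms\<close>

context hermitian_space
begin

section \<open>Hermitian endomorphisms and their resolvents\<close>

abbreviation H :: "('v \<Rightarrow> 'v) set" where "H \<equiv> herm_endos scale b"

lemma H_add: "u \<in> H \<Longrightarrow> u (x + y) = u x + u y"
  and H_scale: "u \<in> H \<Longrightarrow> u (scale c x) = scale c (u x)"
  and H_adj: "u \<in> H \<Longrightarrow> b (u x) y = b x (u y)"
  by (auto simp: herm_endos_def Vector_Spaces.linear_iff)

lemma H_I:
  assumes "\<And>x y. u (x + y) = u x + u y" "\<And>c x. u (scale c x) = scale c (u x)"
    "\<And>x y. b (u x) y = b x (u y)"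
  shows "u \<in> H"
  using assms vector_space_axioms by (auto simp: herm_endos_def Vector_Spaces.linear_iff)

lemma H_0: "u \<in> H \<Longrightarrow> u 0 = 0"
  using H_scale[of u 0 0] by simp

lemma H_minus: "u \<in> H \<Longrightarrow> u (- x) = - u x"
  using H_scale[of u "- 1" x] by simp

lemma H_diff: "u \<in> H \<Longrightarrow> u (x - y) = u x - u y"
  using H_add[of u x "- y"] H_minus[of u y] by simp

lemmas H_simps = H_add H_scale H_0 H_minus H_diff

lemma H_sum: "u \<in> H \<Longrightarrow> u (sum f S) = (\<Sum>i\<in>S. u (f i))"
  by (induction S rule: infinite_finite_induct) (simp_all add: H_simps)

lemma H_power: "u \<in> H \<Longrightarrow> u ^^ k \<in> H"
proof (induction k)
  case 0
  then show ?case by (intro H_I) simp_all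
next
  case (Suc k)
  then show ?case by (intro H_I) (simp_all add: H_simps H_adj funpow_swap1)
qed

lemma H_plus: "u \<in> H \<Longrightarrow> v \<in> H \<Longrightarrow> u + v \<in> H"
  by (intro H_I) (simp_all add: H_simps H_adj algebra_simps)

lemma H_fscale: "c \<in> K \<Longrightarrow> u \<in> H \<Longrightarrow> fscale c u \<in> H"
  by (intro H_I) (simp_all add: H_simps H_adj K_iff algebra_simps)

lemma b_st_adj: "u \<in> H \<Longrightarrow> b y (u x) = st (b x (u y))"
  using H_adj[of u x y] by (simp add: b_comm[of y "u x"] del: st_b)

lemma b_self_in_K: "u \<in> H \<Longrightarrow> b x (u x) \<in> K"
  using b_st_adj[of u x x] by (simp add: K_iff H_adj)

text \<open>Polynomial in \<open>s\<close> giving \<open>b(g, (1 - s u)\<^sup>-\<^sup>1 x)\<close>; it is meaningful only for nilpotent \<open>u\<close>.\<close>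

definition qpoly :: "('v \<Rightarrow> 'v) \<Rightarrow> 'v \<Rightarrow> 'v \<Rightarrow> 'a poly" where
  "qpoly u g x = Abs_poly (\<lambda>k. b g ((u ^^ k) x))"

lemma coeff_qpoly:
  assumes "u \<in> H" "nilpotent_endo u"
  shows "coeff (qpoly u g x) k = b g ((u ^^ k) x)"
proof -
  obtain n where n: "u ^^ n = (\<lambda>x. 0)" using assms by (auto simp: nilpotent_endo_def)
  have "(u ^^ i) x = 0" if "i > n" for i
  proof -
    have "u ^^ i = u ^^ (i - n) \<circ> u ^^ n" using that by (simp flip: funpow_add)
    then show ?thesis using n H_0[OF H_power[OF assms(1)]] by simp
  qed
  then show ?thesis unfolding qpoly_def by (subst coeff_Abs_poly[of n]) auto
qed

text \<open>Noncommutative factorization of a difference of powers; summed over k against powers of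
  s it becomes the resolvent identity.\<close>

lemma funpow_telescope:
  assumes "u \<in> H" "w \<in> H"
  shows "(w ^^ Suc k) z = (u ^^ Suc k) z + (\<Sum>p\<le>k. (u ^^ p) (w ((w ^^ (k - p)) z) - u ((w ^^ (k - p)) z)))"
proof (induction k)
  case 0
  then show ?case by simp
next
  case (Suc k)
  let ?d = "\<lambda>y. w y - u y"
  have "(w ^^ Suc (Suc k)) z = ?d ((w ^^ Suc k) z) + u ((w ^^ Suc k) z)" by simp
  moreover have "u ((w ^^ Suc k) z) = (u ^^ Suc (Suc k)) z + (\<Sum>p\<le>k. (u ^^ Suc p) (?d ((w ^^ (k - p)) z)))"
    by (rule trans[OF arg_cong[OF Suc.IH, of u]]) (simp add: H_add[OF assms(1)] H_sum[OF assms(1)])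
  moreover have "(\<Sum>p\<le>Suc k. (u ^^ p) (?d ((w ^^ (Suc k - p)) z))) =
      ?d ((w ^^ Suc k) z) + (\<Sum>p\<le>k. (u ^^ Suc p) (?d ((w ^^ (k - p)) z)))"
    by (simp add: sum.atMost_Suc_shift del: sum.atMost_Suc)
  ultimately show ?case by (simp only: add.left_commute)
qed

text \<open>With R_u = (1 - s u)^-1 this is R_w = R_u + s R_u (w - u) R_w, read coefficientwise. The
  shape of w - u is demanded on the orbit of z under w only, because
  \<open>Phi_imp_kernel_vector\<close> knows a rank-two shape just there.\<close>

lemma resolvent_identity:
  assumes uw: "u \<in> H" "w \<in> H" "nilpotent_endo u" "nilpotent_endo w"
    and d: "\<And>q. w ((w ^^ q) z) - u ((w ^^ q) z) =
        scale t (scale (b g1 ((w ^^ q) z)) x1 + scale (b g2 ((w ^^ q) z)) x2 + scale (b g3 ((w ^^ q) z)) x3)"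
  shows "qpoly w g z = qpoly u g z +
     [:0, t:] * (qpoly u g x1 * qpoly w g1 z + qpoly u g x2 * qpoly w g2 z + qpoly u g x3 * qpoly w g3 z)"
proof (rule poly_eqI)
  fix k
  note [simp] = coeff_qpoly[OF uw(1,3)] coeff_qpoly[OF uw(2,4)]
  show "coeff (qpoly w g z) k = coeff (qpoly u g z +
     [:0, t:] * (qpoly u g x1 * qpoly w g1 z + qpoly u g x2 * qpoly w g2 z + qpoly u g x3 * qpoly w g3 z)) k"
  proof (cases k)
    case 0
    then show ?thesis by simp
  next
    case (Suc k)
    have "coeff (qpoly w g z) (Suc k) = b g ((u ^^ Suc k) z) +
        (\<Sum>p\<le>k. b g ((u ^^ p) (w ((w ^^ (k - p)) z) - u ((w ^^ (k - p)) z))))"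
      by (simp only: coeff_qpoly[OF uw(2,4)] funpow_telescope[OF uw(1,2)] b_add_right b_sum_right)
    also have "(\<Sum>p\<le>k. b g ((u ^^ p) (w ((w ^^ (k - p)) z) - u ((w ^^ (k - p)) z)))) =
        t * coeff (qpoly u g x1 * qpoly w g1 z + qpoly u g x2 * qpoly w g2 z + qpoly u g x3 * qpoly w g3 z) k"
      by (simp add: d H_simps[OF H_power[OF uw(1)]] coeff_mult sum.distrib sum_distrib_left algebra_simps)
    finally show ?thesis using Suc by simp
  qed
qed

text \<open>
  The relation says that \<open>(I - t s M)(I + t s M') = I\<close> over the polynomial ring in \<open>s\<close>, so the determinant of
  the first factor is a unit with constant coefficient 1, hence equal to 1.
\<close>

lemma det3_unit_identity:
  fixes m n :: "3 \<Rightarrow> 3 \<Rightarrow> 'a poly" and t :: 'a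
  assumes t: "t \<noteq> 0"
    and rel: "\<And>i j. n i j = m i j + [:0, t:] * (m i 1 * n 1 j + m i 2 * n 2 j + m i 3 * n 3 j)"
  shows "(m 1 1 + m 2 2 + m 3 3)
      - [:0, t:] * (m 1 1 * m 2 2 - m 1 2 * m 2 1 + (m 1 1 * m 3 3 - m 1 3 * m 3 1) + (m 2 2 * m 3 3 - m 2 3 * m 3 2))
      + [:0, t:]^2 * (m 1 1 * m 2 2 * m 3 3 + m 1 2 * m 2 3 * m 3 1 + m 1 3 * m 2 1 * m 3 2
          - m 1 1 * m 2 3 * m 3 2 - m 1 2 * m 2 1 * m 3 3 - m 1 3 * m 2 2 * m 3 1) = 0"
    (is "?E1 - _ * ?E2 + _ * ?E3 = 0")
proof -
  define c where "c = [:0, t:]"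
  define A where "A = (\<chi> i j. (if i = j then 1 else 0) - c * m i j)"
  define B where "B = (\<chi> i j. (if i = j then 1 else 0) + c * n i j)"
  have "A ** B = mat 1"
  proof -
    have "(A ** B) $ i $ j = mat 1 $ i $ j" for i j
    proof -
      have "(A ** B) $ i $ j = (\<Sum>l\<in>UNIV. ((if i = l then 1 else 0) - c * m i l) * ((if l = j then 1 else 0) + c * n l j))"
        by (simp add: A_def B_def matrix_matrix_mult_def)
      also have "\<dots> = (\<Sum>l\<in>UNIV. (if i = l then (if i = j then 1 else 0) + c * n i j else 0)
            - (if l = j then c * m i j else 0) - c * c * (m i l * n l j))"
        by (intro sum.cong) (auto simp: algebra_simps)
      also have "\<dots> = (if i = j then 1 else 0) + c * n i j - c * m i j - c * c * (m i 1 * n 1 j + m i 2 * n 2 j + m i 3 * n 3 j)"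
        by (simp add: sum_subtractf flip: sum_distrib_left) (simp add: sum_3)
      also have "\<dots> = (if i = j then 1 else 0)"
        unfolding rel[of i j, folded c_def] by (simp add: algebra_simps)
      finally show ?thesis by (simp add: mat_def)
    qed
    then show ?thesis by (simp add: vec_eq_iff)
  qed
  then have "det A * det B = 1" by (metis det_mul det_I)
  then have "is_unit (det A)" by (metis dvd_triv_left)
  then obtain k where k: "det A = [:k:]" by (auto elim: is_unit_polyE)
  have detA: "det A = 1 - c * (?E1 - c * ?E2 + c^2 * ?E3)"
    unfolding det_3 by (simp add: A_def power2_eq_square) (simp add: algebra_simps)
  have "poly (det A) 0 = 1" unfolding detA by (simp add: c_def)
  then have "det A = 1" using k by (simp add: one_pCons)
  then have "c * (?E1 - c * ?E2 + c^2 * ?E3) = 0" using detA by simp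
  moreover have "c \<noteq> 0" using t by (simp add: c_def)
  ultimately show ?thesis unfolding c_def by simp
qed

lemma resolvent3:
  assumes uw: "u \<in> H" "w \<in> H" "nilpotent_endo u" "nilpotent_endo w" and t: "t \<noteq> 0"
    and d: "\<And>q z. z \<in> {x1, x2, x3} \<Longrightarrow> w ((w ^^ q) z) - u ((w ^^ q) z) =
        scale t (scale (b g1 ((w ^^ q) z)) x1 + scale (b g2 ((w ^^ q) z)) x2 + scale (b g3 ((w ^^ q) z)) x3)"
    and m: "m = qpoly u"
  shows "(m g1 x1 + m g2 x2 + m g3 x3)
      - [:0, t:] * (m g1 x1 * m g2 x2 - m g1 x2 * m g2 x1 + (m g1 x1 * m g3 x3 - m g1 x3 * m g3 x1)
          + (m g2 x2 * m g3 x3 - m g2 x3 * m g3 x2))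
      + [:0, t:]^2 * (m g1 x1 * m g2 x2 * m g3 x3 + m g1 x2 * m g2 x3 * m g3 x1 + m g1 x3 * m g2 x1 * m g3 x2
          - m g1 x1 * m g2 x3 * m g3 x2 - m g1 x2 * m g2 x1 * m g3 x3 - m g1 x3 * m g2 x2 * m g3 x1) = 0"
proof -
  define G where "G = (\<lambda>i::3. if i = 1 then g1 else if i = 2 then g2 else g3)"
  define X where "X = (\<lambda>i::3. if i = 1 then x1 else if i = 2 then x2 else x3)"
  have GX: "G 1 = g1" "G 2 = g2" "G 3 = g3" "X 1 = x1" "X 2 = x2" "X 3 = x3"
    by (simp_all add: G_def X_def)
  have X: "X j \<in> {x1, x2, x3}" for j by (simp add: X_def)
  have "qpoly w (G i) (X j) = qpoly u (G i) (X j) + [:0, t:] * (qpoly u (G i) (X 1) * qpoly w (G 1) (X j)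
      + qpoly u (G i) (X 2) * qpoly w (G 2) (X j) + qpoly u (G i) (X 3) * qpoly w (G 3) (X j))" for i j
    unfolding GX using resolvent_identity[OF uw d[OF X]] .
  from det3_unit_identity[of t "\<lambda>i j. qpoly w (G i) (X j)" "\<lambda>i j. qpoly u (G i) (X j)", OF t this]
  show ?thesis unfolding GX m .
qed

end

section \<open>Spaces of nilpotent Hermitian endomorphisms\<close>

context hermitian_space
begin

section \<open>Symmetric tensors and the projection along x and y\<close>

definition sym_tensor :: "'v \<Rightarrow> 'v \<Rightarrow> 'v \<Rightarrow> 'v" where
  "sym_tensor x y = (\<lambda>z. scale (b x z) y + scale (b y z) x)"

lemma sym_in_H: "sym_tensor x y \<in> H"
  by (intro H_I) (simp_all add: sym_tensor_def algebra_simps)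

lemma sym_add: "sym_tensor x (y + z) = sym_tensor x y + sym_tensor x z"
  by (rule ext) (simp add: sym_tensor_def algebra_simps)

lemma sym_scale: "c \<in> K \<Longrightarrow> sym_tensor x (scale c y) = fscale c (sym_tensor x y)"
  by (rule ext) (simp add: sym_tensor_def algebra_simps K_iff)

lemma sym_self: "sym_tensor x (scale c x) = (\<lambda>z. scale ((c + st c) * b x z) x)"
  by (rule ext) (simp add: sym_tensor_def algebra_simps)

text \<open>Trace one turns the factor \<open>c + st c\<close> into 1, so the rank-one map of x is
  itself a symmetric tensor, in characteristic two as well.\<close>

lemma sym_tau: "sym_tensor x (scale tau x) = (\<lambda>z. scale (b x z) x)"
  unfolding sym_self tau by simp

lemma qpoly_0: "u \<in> H \<Longrightarrow> qpoly u 0 x = 0" "u \<in> H \<Longrightarrow> qpoly u g 0 = 0"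
  unfolding qpoly_def using H_0[OF H_power] by (simp_all add: zero_poly.abs_eq)

lemma nilpotent_no_eigenvalue:
  assumes "u \<in> H" "nilpotent_endo u" "u x = scale c x" "x \<noteq> 0"
  shows "c = 0"
proof -
  have "(u ^^ k) x = scale (c ^ k) x" for k
    by (induction k) (simp_all add: assms H_scale mult.commute)
  moreover obtain k where "u ^^ k = (\<lambda>x. 0)" using assms by (auto simp: nilpotent_endo_def)
  ultimately have "scale (c ^ k) x = 0" by metis
  then show ?thesis using assms(4) by simp
qed

text \<open>With n the least exponent killing u, the witness is a nonzero value u^(n-1) z: its value
  under b is b(z, u^(2n-2) z), and 2n - 2 >= n because u is nonzero.\<close>

lemma nilpotent_last_power:
  assumes "u \<in> H" "nilpotent_endo u" "u \<noteq> 0"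
  shows "\<exists>x. x \<in> range u \<and> x \<noteq> 0 \<and> b x x = 0 \<and> u x = 0"
proof -
  define n where "n = (LEAST n. u ^^ n = (\<lambda>x. 0))"
  have n: "u ^^ n = (\<lambda>x. 0)" using assms(2) unfolding n_def nilpotent_endo_def by (rule LeastI_ex)
  have "n \<noteq> 0"
  proof
    assume "n = 0"
    then have "x = 0" for x :: 'v using n by (simp add: id_def fun_eq_iff)
    then have "u x = 0" for x by blast
    then show False using assms(3) by (simp add: fun_eq_iff)
  qed
  moreover have "n \<noteq> 1" using n assms(3) by (auto simp: fun_eq_iff)
  ultimately obtain k where k: "n = Suc (Suc k)" by (metis One_nat_def not0_implies_Suc)
  have "u ^^ Suc k \<noteq> (\<lambda>x. 0)" using not_less_Least[of "Suc k" "\<lambda>n. u ^^ n = (\<lambda>x. 0)"] k n_def by auto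
  then obtain z where z: "(u ^^ Suc k) z \<noteq> 0" by (auto simp: fun_eq_iff)
  have "b ((u ^^ Suc k) z) ((u ^^ Suc k) z) = b z ((u ^^ Suc k) ((u ^^ Suc k) z))"
    using H_adj[OF H_power[OF assms(1)]] .
  also have "(u ^^ Suc k) ((u ^^ Suc k) z) = (u ^^ k) ((u ^^ n) z)" unfolding k by (simp add: funpow_swap1)
  also have "\<dots> = 0" using n H_0[OF H_power[OF assms(1)]] by simp
  finally have "b ((u ^^ Suc k) z) ((u ^^ Suc k) z) = 0" by simp
  moreover have "u ((u ^^ Suc k) z) = 0" using n k by (metis funpow.simps(2) o_apply)
  moreover have "(u ^^ Suc k) z \<in> range u" by simp
  ultimately show ?thesis using z by blast
qed

text \<open>
  If \<open>b x x = 0\<close> and \<open>b x y = 1\<close> this is the orthogonal projection with kernel spanned by \<open>x\<close> and \<open>y\<close>; its image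
  serves as a model of \<open>x\<^sup>\<bottom>/Fx\<close>.
\<close>

definition pr :: "'v \<Rightarrow> 'v \<Rightarrow> 'v \<Rightarrow> 'v" where
  "pr x y = (\<lambda>z. z - scale (b x z) y - scale (b y z - b x z * b y y) x)"

lemma pr_in_H: "pr x y \<in> H"
  by (intro H_I) (simp_all add: pr_def algebra_simps)

lemma pr_perp:
  assumes "b x x = 0" "b x y = 1"
  shows "b x (pr x y z) = 0" "b y (pr x y z) = 0"
proof -
  have "b y x = 1" using assms(2) b_comm[of y x] by (simp del: st_b)
  then show "b x (pr x y z) = 0" "b y (pr x y z) = 0" using assms by (simp_all add: pr_def)
qed

lemma pr_id: "b x z = 0 \<Longrightarrow> b y z = 0 \<Longrightarrow> pr x y z = z"
  by (simp add: pr_def)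

lemma pr_perp_diff: "b x z = 0 \<Longrightarrow> pr x y z = z - scale (b y z) x"
  by (simp add: pr_def)

lemma pr_in_subspace: "subspace U \<Longrightarrow> x \<in> U \<Longrightarrow> y \<in> U \<Longrightarrow> z \<in> U \<Longrightarrow> pr x y z \<in> U"
  by (simp add: pr_def subspace_diff subspace_scale)

text \<open>Such a u induces zero on x^perp/Fx, so it is determined by u y, up to the right
  correction along x.\<close>

lemma eq_sym_of_compression_zero:
  assumes u: "u \<in> H" "u x = 0" and xy: "b x x = 0" "b x y = 1"
    and z: "\<And>z. pr x y (u (pr x y z)) = 0"
  shows "\<exists>h c. h = u y - scale c x \<and> b x h = 0 \<and> u = sym_tensor x h"
proof -
  have yx: "b y x = 1" using xy(2) b_comm[of y x] by (simp del: st_b)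
  have xu: "b x (u v) = 0" for v using H_adj[OF u(1), of x v] u(2) by simp
  define k where "k = b y (u y)"
  have k: "st k = k" using b_self_in_K[OF u(1)] by (simp add: k_def K_iff)
  \<comment> \<open>The map \<open>sym_tensor x h\<close> sends y to h + b(h,y) x. Removing the
    share \<open>tau\<close> of k from u y leaves b(h,y) = \<open>tau * k\<close>, which restores
    exactly what was removed.\<close>
  define h where "h = u y - scale (tau * k) x"
  have 1: "u (pr x y v) = scale (b h (pr x y v)) x" for v
  proof -
    have "u (pr x y v) = scale (b y (u (pr x y v))) x"
      using z[of v] by (simp add: pr_perp_diff xu)
    also have "b y (u (pr x y v)) = b h (pr x y v)"
      using pr_perp[OF xy] by (simp add: h_def H_adj[OF u(1)])
    finally show ?thesis .
  qed
  have hy: "b h y = k - st tau * k"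
    using xy k H_adj[OF u(1), of y y] by (simp add: h_def k_def)
  have hx: "b h x = 0" using xu[of y] b_eq_0_comm[of x "u y"] xy by (simp add: h_def)
  have "u v = sym_tensor x h v" for v
  proof -
    define q where "q = b y v - b x v * b y y"
    have v: "v = pr x y v + scale (b x v) y + scale q x" by (simp add: pr_def q_def)
    have "u v = u (pr x y v) + scale (b x v) (u y)"
      by (subst v) (simp add: H_simps[OF u(1)] u(2))
    also have "\<dots> = scale (b h (pr x y v)) x + scale (b x v) (u y)" by (simp only: 1)
    also have "b h (pr x y v) = b h v - b x v * (k - st tau * k)"
      unfolding pr_def by (simp add: hx hy)
    finally have *: "u v = scale (b h v - b x v * (k - st tau * k)) x + scale (b x v) (u y)" .
    have "u y = h + scale (tau * k) x" by (simp add: h_def)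
    then have "u v = scale (b x v) h + scale (b h v + b x v * k * (tau + st tau - 1)) x"
      unfolding * by (simp add: algebra_simps)
    then show ?thesis by (simp add: tau sym_tensor_def)
  qed
  then have "u = sym_tensor x h" by (rule ext)
  moreover have "b x h = 0" using hx b_eq_0_comm[of h x] by simp
  ultimately show ?thesis using h_def by blast
qed

end

text \<open>The maps stay endomorphisms of V with values in U. Being Hermitian, they vanish on the
  vectors orthogonal to U, so in effect they are endomorphisms of U, and the induction can shrink U
  without changing types.\<close>

locale nil_space = hermitian_space scale st b
  for scale :: "'a::field \<Rightarrow> 'v::ab_group_add \<Rightarrow> 'v" and st b +
  fixes U :: "'v set" and W :: "('v \<Rightarrow> 'v) set" and N :: nat
  assumes U: "subspace U" "nondeg_on U" "kv.kd U N"
    and W_H: "u \<in> W \<Longrightarrow> u \<in> H"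
    and W_ksub: "kf.ksub W"
    and W_nil: "u \<in> W \<Longrightarrow> nilpotent_endo u"
    and W_range: "u \<in> W \<Longrightarrow> u z \<in> U"
begin

lemma W_add: "u \<in> W \<Longrightarrow> v \<in> W \<Longrightarrow> u + v \<in> W"
  and W_scale: "c \<in> K \<Longrightarrow> u \<in> W \<Longrightarrow> fscale c u \<in> W"
  and W_zero: "0 \<in> W"
  using W_ksub kf.ksub_add kf.ksub_scale kf.ksub_zero by auto

text \<open>Both u and u + t r lie in W and so are nilpotent, which is what
  \<open>resolvent3\<close> asks for. Smaller ranks are obtained by padding with zero
  vectors.\<close>

lemma rank3_identity:
  assumes "u \<in> W" "r \<in> W" "t \<in> K" "t \<noteq> 0"
    and r: "\<And>w q z. w \<in> W \<Longrightarrow> z \<in> {x1, x2, x3} \<Longrightarrow> r ((w ^^ q) z) =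
      scale (b g1 ((w ^^ q) z)) x1 + scale (b g2 ((w ^^ q) z)) x2 + scale (b g3 ((w ^^ q) z)) x3"
    and m: "m = qpoly u"
  shows "(m g1 x1 + m g2 x2 + m g3 x3)
      - [:0, t:] * (m g1 x1 * m g2 x2 - m g1 x2 * m g2 x1 + (m g1 x1 * m g3 x3 - m g1 x3 * m g3 x1)
          + (m g2 x2 * m g3 x3 - m g2 x3 * m g3 x2))
      + [:0, t:]^2 * (m g1 x1 * m g2 x2 * m g3 x3 + m g1 x2 * m g2 x3 * m g3 x1 + m g1 x3 * m g2 x1 * m g3 x2
          - m g1 x1 * m g2 x3 * m g3 x2 - m g1 x2 * m g2 x1 * m g3 x3 - m g1 x3 * m g2 x2 * m g3 x1) = 0"
proof -
  have w: "u + fscale t r \<in> W" using assms W_add W_scale by blast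
  show ?thesis
    by (rule resolvent3[OF W_H[OF assms(1)] W_H[OF w] W_nil[OF assms(1)] W_nil[OF w] assms(4) _ m])
      (use r[OF w] in simp)
qed

lemma rank2_identity:
  assumes "u \<in> W" "r \<in> W" "t \<in> K" "t \<noteq> 0"
    and r: "\<And>w q z. w \<in> W \<Longrightarrow> z \<in> {x1, x2} \<Longrightarrow> r ((w ^^ q) z) =
      scale (b g1 ((w ^^ q) z)) x1 + scale (b g2 ((w ^^ q) z)) x2"
    and m: "m = qpoly u"
  shows "(m g1 x1 + m g2 x2) = [:0, t:] * (m g1 x1 * m g2 x2 - m g1 x2 * m g2 x1)"
proof -
  have "r ((w ^^ q) z) = scale (b g1 ((w ^^ q) z)) x1 + scale (b g2 ((w ^^ q) z)) x2 + scale (b 0 ((w ^^ q) z)) 0"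
    if "w \<in> W" "z \<in> {x1, x2, 0}" for w q z
  proof (cases "z = 0")
    case True
    then show ?thesis using H_0[OF H_power[OF W_H[OF that(1)]]] H_0[OF W_H[OF assms(2)]] by simp
  next
    case False
    then show ?thesis using r[OF that(1), of z q] that by simp
  qed
  from rank3_identity[OF assms(1-4) this m] show ?thesis
    by (simp add: m qpoly_0[OF W_H[OF assms(1)]])
qed

text \<open>E1 = t s E2 holds for t = 1 and for t = \<open>t0\<close>; subtracting makes E2 and then
  E1 vanish.\<close>

lemma rank2_zero:
  assumes "u \<in> W" "r \<in> W" and t0: "t0 \<in> K" "t0 \<noteq> 0" "t0 \<noteq> 1"
    and r: "\<And>w q z. w \<in> W \<Longrightarrow> z \<in> {x1, x2} \<Longrightarrow> r ((w ^^ q) z) =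
      scale (b g1 ((w ^^ q) z)) x1 + scale (b g2 ((w ^^ q) z)) x2"
    and m: "m = qpoly u"
  shows "m g1 x1 + m g2 x2 = 0" "m g1 x1 * m g2 x2 - m g1 x2 * m g2 x1 = 0"
proof -
  let ?E = "m g1 x1 * m g2 x2 - m g1 x2 * m g2 x1"
  have "m g1 x1 + m g2 x2 = [:0, 1:] * ?E"
    by (rule rank2_identity[OF assms(1,2) _ _ r m]) (simp_all add: K_iff)
  moreover have "m g1 x1 + m g2 x2 = [:0, t0:] * ?E"
    by (rule rank2_identity[OF assms(1,2) t0(1,2) r m])
  ultimately have "([:0, t0:] - [:0, 1:]) * ?E = 0" and 1: "m g1 x1 + m g2 x2 = [:0, 1:] * ?E"
    by (simp_all only: left_diff_distrib diff_self)
  then show "?E = 0" using t0 by simp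
  then show "m g1 x1 + m g2 x2 = 0" using 1 by simp
qed

text \<open>In rank one all minors of size two vanish, so t = 1 alone gives the result.\<close>

lemma rank1_zero:
  assumes "u \<in> W" "(\<lambda>z. scale (b x z) x) \<in> W"
  shows "b x ((u ^^ k) x) = 0"
proof -
  have "qpoly u x x + qpoly u 0 0 = [:0, 1:] * (qpoly u x x * qpoly u 0 0 - qpoly u x 0 * qpoly u 0 x)"
  proof (rule rank2_identity[OF assms])
    fix w q z assume "w \<in> W" "z \<in> {x, 0}"
    then show "scale (b x ((w ^^ q) z)) x = scale (b x ((w ^^ q) z)) x + scale (b 0 ((w ^^ q) z)) 0" by simp
  qed (simp_all add: K_iff)
  then have "qpoly u x x = 0" using qpoly_0[OF W_H[OF assms(1)]] by simp
  then show ?thesis using coeff_qpoly[OF W_H[OF assms(1)] W_nil[OF assms(1)], of x x k] by simp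
qed

text \<open>The coefficient of s in E1 = s E2 is the constant term of E2, which vanishes because x
  is isotropic and orthogonal to y. Only t = 1 enters, so the dimension bound holds over every
  F.\<close>

lemma sym_orthogonal:
  assumes "u \<in> W" "sym_tensor x y \<in> W" "b x x = 0" "b x y = 0"
  shows "btr y (u x) = 0"
proof -
  let ?m = "qpoly u"
  note c = coeff_qpoly[OF W_H[OF assms(1)] W_nil[OF assms(1)]]
  have "?m y x + ?m x y = [:0, 1:] * (?m y x * ?m x y - ?m y y * ?m x x)"
    by (rule rank2_identity[OF assms(1,2)]) (simp_all add: K_iff sym_tensor_def add.commute)
  then have "coeff (?m y x + ?m x y) 1 = coeff ([:0, 1:] * (?m y x * ?m x y - ?m y y * ?m x x)) 1" by simp
  then have "b y (u x) + b x (u y) = 0"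
    using assms b_eq_0_comm[of x y] by (simp add: c coeff_mult_0)
  then show ?thesis using H_adj[OF W_H[OF assms(1)], of x y] by (simp add: btr_def)
qed

definition L :: "'v \<Rightarrow> 'v set" where
  "L x = {y\<in>U. b x y = 0 \<and> sym_tensor x y \<in> W}"

definition Wx :: "'v \<Rightarrow> 'v set" where
  "Wx x = (\<lambda>u. u x) ` W"

definition P :: "'v \<Rightarrow> 'v set" where
  "P x = {v + scale c x | v c. v \<in> Wx x}"

lemma ksub_L: "kv.ksub (L x)"
  unfolding kv.ksub_def L_def
  using U(1) W_add W_scale W_zero
  by (auto simp: subspace_0 subspace_add subspace_scale sym_add sym_scale) (simp add: sym_tensor_def zero_fun_def)

lemma ksub_Wx: "kv.ksub (Wx x)"
  unfolding kv.ksub_def Wx_def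
proof (intro conjI ballI)
  show "0 \<in> (\<lambda>u. u x) ` W" using W_zero by (auto simp: image_iff intro!: bexI[of _ 0])
  fix v w assume "v \<in> (\<lambda>u. u x) ` W" "w \<in> (\<lambda>u. u x) ` W"
  then obtain u1 u2 where *: "u1 \<in> W" "u2 \<in> W" "v = u1 x" "w = u2 x" by blast
  then show "v + w \<in> (\<lambda>u. u x) ` W" using W_add[OF *(1,2)] by (auto simp: image_iff intro!: bexI[of _ "u1 + u2"])
next
  fix c v assume "c \<in> K" "v \<in> (\<lambda>u. u x) ` W"
  then obtain u1 where *: "u1 \<in> W" "v = u1 x" by blast
  then show "scale c v \<in> (\<lambda>u. u x) ` W"
    using W_scale[OF \<open>c \<in> K\<close> *(1)] by (auto simp: image_iff intro!: bexI[of _ "fscale c u1"])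
qed

lemma Wx_subset_U: "Wx x \<subseteq> U"
  using W_range by (auto simp: Wx_def)

lemma P_subset_U: "x \<in> U \<Longrightarrow> P x \<subseteq> U"
  using Wx_subset_U U(1) by (auto simp: P_def intro!: subspace_add subspace_scale)

lemma P_E:
  assumes "q \<in> P x" obtains u c where "u \<in> W" "q = u x + scale c x"
  using assms by (auto simp: P_def Wx_def)

lemma P_I: "u \<in> W \<Longrightarrow> u x + scale c x \<in> P x"
  by (auto simp: P_def Wx_def)

lemma P_I0: "u \<in> W \<Longrightarrow> u x \<in> P x"
  using P_I[of u x 0] by simp

lemma x_in_P: "scale c x \<in> P x"
  using P_I[OF W_zero, of x c] by simp

text \<open>The sum is direct because u x = c x forces c = 0 for a nilpotent u.\<close>

lemma kd_P:
  assumes "x \<noteq> 0" "kv.kd (Wx x) a"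
  shows "kv.kd (P x) (a + 2)"
proof -
  have "Wx x \<inter> range (\<lambda>c. scale c x) = {0}"
  proof -
    have "scale c x = 0" if "scale c x \<in> Wx x" for c
    proof -
      from that obtain u where "u \<in> W" "scale c x = u x" unfolding Wx_def by blast
      then have "c = 0" using nilpotent_no_eigenvalue[OF W_H W_nil, of u x c] assms by simp
      then show ?thesis by simp
    qed
    moreover have "0 \<in> Wx x" using ksub_Wx kv.ksub_zero by blast
    ultimately show ?thesis by (auto intro!: image_eqI[of _ _ 0])
  qed
  from kv.kd_direct_sum[OF kd_line[OF assms(1)] assms(2) this]
  have "kv.kd {v + y | v y. v \<in> Wx x \<and> y \<in> range (\<lambda>c. scale c x)} (a + 2)" .
  moreover have "{v + y | v y. v \<in> Wx x \<and> y \<in> range (\<lambda>c. scale c x)} = P x" by (auto simp: P_def)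
  ultimately show ?thesis by simp
qed

lemma L_subset_perp_P:
  assumes "b x x = 0"
  shows "L x \<subseteq> perp U (P x)"
proof
  fix y assume y: "y \<in> L x"
  have "btr q y = 0" if q: "q \<in> P x" for q
  proof -
    obtain u c where u: "u \<in> W" "q = u x + scale c x" using q by (rule P_E)
    have "btr y (u x) = 0" using sym_orthogonal[OF u(1)] y assms by (simp add: L_def)
    moreover have "btr (scale c x) y = 0" using y b_eq_0_comm[of x y] by (simp add: L_def btr_def)
    ultimately show ?thesis using u by (simp add: btr_simps btr_comm)
  qed
  then show "y \<in> perp U (P x)" using y by (simp add: L_def perp_def)
qed

end

section \<open>Reduction modulo an isotropic vector and the dimension bound\<close>

context hermitian_space
begin

text \<open>Dimensions are over \<open>K\<close>, hence twice the dimensions over \<open>F\<close>.\<close>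

definition witt_le :: "'v set \<Rightarrow> nat \<Rightarrow> bool" where
  "witt_le U m \<longleftrightarrow> (\<forall>G k. subspace G \<longrightarrow> G \<subseteq> U \<longrightarrow> (\<forall>x\<in>G. \<forall>y\<in>G. b x y = 0) \<longrightarrow> kv.kd G k \<longrightarrow> k \<le> 2 * m)"

lemma witt_leD:
  "witt_le U m \<Longrightarrow> subspace G \<Longrightarrow> G \<subseteq> U \<Longrightarrow> \<forall>x\<in>G. \<forall>y\<in>G. b x y = 0 \<Longrightarrow> kv.kd G k \<Longrightarrow> k \<le> 2 * m"
  by (simp add: witt_le_def)

lemma subspace_insert_line:
  assumes "subspace S" shows "subspace {s + scale c x | s c. s \<in> S}"
proof (rule subspaceI)
  show "0 \<in> {s + scale c x | s c. s \<in> S}" using subspace_0[OF assms] by (auto intro!: exI[of _ 0])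
next
  fix v w assume "v \<in> {s + scale c x | s c. s \<in> S}" "w \<in> {s + scale c x | s c. s \<in> S}"
  then obtain s c s' c' where *: "s \<in> S" "s' \<in> S" "v = s + scale c x" "w = s' + scale c' x" by blast
  have "v + w = (s + s') + scale (c + c') x" using * by (simp add: algebra_simps)
  then show "v + w \<in> {s + scale c x | s c. s \<in> S}" using subspace_add[OF assms *(1,2)] by blast
next
  fix a v assume "v \<in> {s + scale c x | s c. s \<in> S}"
  then obtain s c where *: "s \<in> S" "v = s + scale c x" by blast
  have "scale a v = scale a s + scale (a * c) x" using * by (simp add: algebra_simps)
  then show "scale a v \<in> {s + scale c x | s c. s \<in> S}" using subspace_scale[OF assms *(1)] by blast
qed

lemma subspace_line: "subspace (range (\<lambda>c. scale c x))"
proof -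
  have "range (\<lambda>c. scale c x) = {s + scale c x | s c. s \<in> {0}}" by auto
  then show ?thesis using subspace_insert_line[OF subspace_single_0, of x] by simp
qed

lemma pr_idem:
  assumes "b x x = 0" "b x y = 1"
  shows "pr x y (pr x y z) = pr x y z"
  by (rule pr_id) (rule pr_perp[OF assms])+

text \<open>As u is Hermitian and kills x, its values lie in x^perp. There \<open>pr\<close> only
  subtracts a multiple of x, which the next factor u kills, so the inner projections drop
  out.\<close>

lemma compression_power:
  assumes u: "u \<in> H" "u x = 0" and xy: "b x x = 0" "b x y = 1"
  shows "((pr x y \<circ> u \<circ> pr x y) ^^ Suc k) z = pr x y ((u ^^ Suc k) (pr x y z))"
proof (induction k)
  case 0
  then show ?case by simp
next
  case (Suc k)
  have "b x ((u ^^ Suc k) v) = 0" for v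
    using H_adj[OF u(1), of x "(u ^^ k) v"] u(2) by simp
  then have "pr x y ((u ^^ Suc k) (pr x y z)) = (u ^^ Suc k) (pr x y z) - scale (b y ((u ^^ Suc k) (pr x y z))) x"
    by (rule pr_perp_diff)
  then have u_pr: "u (pr x y ((u ^^ Suc k) (pr x y z))) = u ((u ^^ Suc k) (pr x y z))"
    by (simp only: H_simps[OF u(1)] u(2) scale_zero_right diff_zero)
  define c where "c = pr x y \<circ> u \<circ> pr x y"
  have "(c ^^ Suc (Suc k)) z = c ((c ^^ Suc k) z)" by simp
  also have "(c ^^ Suc k) z = pr x y ((u ^^ Suc k) (pr x y z))" using Suc.IH unfolding c_def .
  also have "c \<dots> = pr x y (u ((u ^^ Suc k) (pr x y z)))"
    unfolding c_def o_apply pr_idem[OF xy] u_pr ..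
  finally show ?case unfolding c_def by (simp only: funpow.simps o_apply)
qed

lemma compression_nilpotent:
  assumes u: "u \<in> H" "u x = 0" "nilpotent_endo u" and xy: "b x x = 0" "b x y = 1"
  shows "nilpotent_endo (pr x y \<circ> u \<circ> pr x y)"
proof -
  obtain n where n: "u ^^ n = (\<lambda>x. 0)" using u(3) by (auto simp: nilpotent_endo_def)
  then have n': "(u ^^ Suc n) v = 0" for v using H_0[OF u(1)] by simp
  have "(pr x y \<circ> u \<circ> pr x y) ^^ Suc n = (\<lambda>x. 0)"
    by (rule ext) (simp only: compression_power[OF u(1,2) xy] n' H_0[OF pr_in_H])
  then show ?thesis unfolding nilpotent_endo_def by blast
qed

lemma compression_in_H: "u \<in> H \<Longrightarrow> pr x y \<circ> u \<circ> pr x y \<in> H"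
  by (intro H_I) (simp_all add: H_simps[OF pr_in_H] H_simps H_adj H_adj[OF pr_in_H])

end

context nil_space
begin

definition U2 :: "'v \<Rightarrow> 'v \<Rightarrow> 'v set" where
  "U2 x y = {z\<in>U. b x z = 0 \<and> b y z = 0}"

definition W2 :: "'v \<Rightarrow> 'v \<Rightarrow> ('v \<Rightarrow> 'v) set" where
  "W2 x y = (\<lambda>u. pr x y \<circ> u \<circ> pr x y) ` {u\<in>W. u x = 0}"

lemma ex_partner:
  assumes "x \<in> U" "x \<noteq> 0"
  shows "\<exists>y\<in>U. b x y = 1"
proof -
  obtain v where v: "v \<in> U" "b v x \<noteq> 0" using U(2) assms unfolding nondeg_on_def by blast
  then have "b x v \<noteq> 0" using b_eq_0_comm by blast
  then show ?thesis using subspace_scale[OF U(1) v(1)] by (intro bexI[of _ "scale (inverse (b x v)) v"]) simp_all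
qed

lemma pr_in_U2:
  assumes "x \<in> U" "y \<in> U" "b x x = 0" "b x y = 1" "z \<in> U"
  shows "pr x y z \<in> U2 x y"
  using pr_in_subspace[OF U(1)] pr_perp[OF assms(3,4)] assms by (simp add: U2_def)

lemma subspace_U2: "subspace (U2 x y)"
  using U(1) by (auto simp: U2_def subspace_0 subspace_add subspace_scale intro!: subspaceI)

lemma kd_U2:
  assumes "x \<in> U" "y \<in> U" "b x x = 0" "b x y = 1"
  shows "kv.kd (U2 x y) (N - 4)" "4 \<le> N"
proof -
  have "x \<noteq> 0" using assms(4) by auto
  let ?S = "{s + scale c y | s c. s \<in> range (\<lambda>c. scale c x)}"
  have "y \<notin> range (\<lambda>c. scale c x)" using assms by auto
  then have kd: "kv.kd ?S 4" using kd_subspace_insert[OF kd_line[OF \<open>x \<noteq> 0\<close>] subspace_line] by simp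
  have sub: "?S \<subseteq> U" using assms U(1) by (auto intro!: subspace_add subspace_scale)
  have "perp U ?S = {z\<in>U. \<forall>v\<in>?S. b v z = 0}" by (rule perp_subspace[OF subspace_insert_line[OF subspace_line]])
  also have "\<dots> = U2 x y"
  proof (intro set_eqI iffI)
    fix z assume z: "z \<in> {z\<in>U. \<forall>v\<in>?S. b v z = 0}"
    have "scale 1 x + scale 0 y \<in> ?S" "scale 0 x + scale 1 y \<in> ?S" by blast+
    then have "x \<in> ?S" "y \<in> ?S" by simp_all
    then have "b x z = 0" "b y z = 0" using z by blast+
    then show "z \<in> U2 x y" using z by (simp add: U2_def)
  qed (auto simp: U2_def)
  finally have "perp U ?S = U2 x y" .
  then show "kv.kd (U2 x y) (N - 4)" "4 \<le> N" using kd_perp[OF U(3,1,2) kd sub] by simp_all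
qed

lemma ksub_W_kernel: "kf.ksub {u\<in>W. u x = 0}"
  using W_ksub by (auto simp: kf.ksub_def)

lemma W2_E:
  assumes "w \<in> W2 x y" obtains u where "u \<in> W" "u x = 0" "w = pr x y \<circ> u \<circ> pr x y"
  using assms by (auto simp: W2_def)

lemma W2_I: "u \<in> W \<Longrightarrow> u x = 0 \<Longrightarrow> pr x y \<circ> u \<circ> pr x y \<in> W2 x y"
  by (auto simp: W2_def)

lemma reduction:
  assumes "x \<in> U" "y \<in> U" "b x x = 0" "b x y = 1"
  shows "nil_space scale st b (U2 x y) (W2 x y) (N - 4)"
proof
  show "subspace (U2 x y)" by (rule subspace_U2)
  show "kv.kd (U2 x y) (N - 4)" using kd_U2[OF assms] by simp
  show "nondeg_on (U2 x y)"
    unfolding nondeg_on_def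
  proof (intro ballI impI)
    fix z assume z: "z \<in> U2 x y" "\<forall>v\<in>U2 x y. b v z = 0"
    \<comment> \<open>\<open>pr\<close> is self-adjoint and fixes z, so pairing z with v amounts to
      pairing it with the projection of v, which is in \<open>U2\<close>.\<close>
    have "b v z = 0" if "v \<in> U" for v
    proof -
      have "b v z = b v (pr x y z)" using z pr_id by (simp add: U2_def)
      also have "\<dots> = b (pr x y v) z" using H_adj[OF pr_in_H] by simp
      also have "\<dots> = 0" using z pr_in_U2[OF assms that] by simp
      finally show ?thesis .
    qed
    then show "z = 0" using U(2) z(1) by (simp add: nondeg_on_def U2_def)
  qed
  show "kf.ksub (W2 x y)"
    unfolding kf.ksub_def
  proof (intro conjI ballI)
    show "0 \<in> W2 x y" using W2_I[OF W_zero, of x y] H_0[OF pr_in_H] by (simp add: o_def zero_fun_def)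
  next
    fix v w assume "v \<in> W2 x y" "w \<in> W2 x y"
    then obtain u u' where *: "u \<in> W" "u x = 0" "v = pr x y \<circ> u \<circ> pr x y" "u' \<in> W" "u' x = 0" "w = pr x y \<circ> u' \<circ> pr x y"
      by (metis W2_E)
    have "v + w = pr x y \<circ> (u + u') \<circ> pr x y" using * by (simp add: fun_eq_iff H_add[OF pr_in_H])
    then show "v + w \<in> W2 x y" using W2_I[OF W_add[OF *(1,4)], of x y] * by simp
  next
    fix c v assume "c \<in> K" "v \<in> W2 x y"
    then obtain u where *: "u \<in> W" "u x = 0" "v = pr x y \<circ> u \<circ> pr x y" by (metis W2_E)
    have "fscale c v = pr x y \<circ> fscale c u \<circ> pr x y" using * by (simp add: fun_eq_iff H_scale[OF pr_in_H])
    then show "fscale c v \<in> W2 x y" using W2_I[OF W_scale[OF \<open>c \<in> K\<close> *(1)], of x y] * by simp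
  qed
  fix w z assume "w \<in> W2 x y"
  then obtain u where *: "u \<in> W" "u x = 0" "w = pr x y \<circ> u \<circ> pr x y" by (rule W2_E)
  show "w \<in> H" using * compression_in_H W_H by simp
  show "nilpotent_endo w" using * compression_nilpotent W_H W_nil assms by simp
  show "w z \<in> U2 x y" using * pr_in_U2[OF assms] W_range by simp
qed

lemma compression_kernel:
  assumes "x \<in> U" "y \<in> U" "b x x = 0" "b x y = 1"
    and u: "u \<in> H" "\<And>z. u z \<in> U" "u x = 0" "pr x y \<circ> u \<circ> pr x y = 0"
  shows "\<exists>h\<in>U. b x h = 0 \<and> u = sym_tensor x h"
proof -
  have "pr x y (u (pr x y z)) = 0" for z using fun_cong[OF u(4), of z] by simp
  then obtain h c where h: "h = u y - scale c x" "b x h = 0" "u = sym_tensor x h"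
    using eq_sym_of_compression_zero[OF u(1,3) assms(3,4)] by blast
  have "h \<in> U" unfolding h(1) by (rule subspace_diff[OF U(1) u(2) subspace_scale[OF U(1) assms(1)]])
  then show ?thesis using h by blast
qed

text \<open>Let a = dim Wx and z = dim Z, where Z is the kernel of the compression; then dim W = a +
  z + d2. The map \<open>sym_tensor x\<close> sends L x onto Z and kills exactly the trace-zero
  multiples of x, so dim L x = 1 + z, while orthogonality to P x gives 1 + z <= N - (a + 2).
  Equality means that L x fills the orthogonal.\<close>

lemma reduction_dim:
  assumes xy: "x \<in> U" "y \<in> U" "b x x = 0" "b x y = 1" and d2: "kf.kd (W2 x y) d2"
  shows "\<exists>d. kf.kd W d \<and> d + 3 \<le> d2 + N \<and> (d + 3 = d2 + N \<longrightarrow> L x = perp U (P x))"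
proof -
  have x: "x \<noteq> 0" using xy(4) by auto
  have yx: "b y x = 1" using xy(4) b_comm[of y x] by (simp del: st_b)
  obtain a where a: "kv.kd (Wx x) a" using kv.kd_subset_exists[OF U(3) ksub_Wx Wx_subset_U] by blast
  note P = kd_perp[OF U(3,1,2) kd_P[OF x a] P_subset_U[OF xy(1)]]
  define Z where "Z = {u\<in>{u\<in>W. u x = 0}. pr x y \<circ> u \<circ> pr x y = 0}"
  have Z_eq: "Z = sym_tensor x ` L x"
  proof (intro set_eqI iffI)
    fix u assume "u \<in> Z"
    then have u: "u \<in> W" "u x = 0" "pr x y \<circ> u \<circ> pr x y = 0" by (auto simp: Z_def)
    then obtain h where "h \<in> U" "b x h = 0" "u = sym_tensor x h"
      using compression_kernel[OF xy W_H[OF u(1)] W_range[OF u(1)]] by blast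
    then show "u \<in> sym_tensor x ` L x" using u by (auto simp: L_def)
  next
    fix u assume "u \<in> sym_tensor x ` L x"
    then obtain h where h: "h \<in> U" "b x h = 0" "u = sym_tensor x h" "u \<in> W" by (auto simp: L_def)
    have "pr x y x = 0" using xy yx by (simp add: pr_def)
    then have "pr x y \<circ> u \<circ> pr x y = 0"
      using h pr_perp[OF xy(3,4)] by (simp add: fun_eq_iff sym_tensor_def H_simps[OF pr_in_H])
    moreover have "u x = 0" using h xy b_eq_0_comm[of x h] by (simp add: sym_tensor_def)
    ultimately show "u \<in> Z" using h by (simp add: Z_def)
  qed
  have Zsub: "kf.ksub Z"
    unfolding kf.ksub_def Z_def using ksub_W_kernel[of x]
    by (auto simp: kf.ksub_def fun_eq_iff H_simps[OF pr_in_H])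
  \<comment> \<open>Z has finite dimension because evaluation at y is injective on it: a tensor of x
    and h vanishing at y has for h a trace-zero multiple of x, and so is zero.\<close>
  have "\<exists>z. kf.kd Z z"
  proof -
    have sub: "kv.ksub ((\<lambda>u. u y) ` Z)"
      unfolding kv.ksub_def
    proof (intro conjI ballI)
      show "0 \<in> (\<lambda>u. u y) ` Z" using kf.ksub_zero[OF Zsub] by (auto simp: image_iff intro!: bexI[of _ 0])
    next
      fix v w assume "v \<in> (\<lambda>u. u y) ` Z" "w \<in> (\<lambda>u. u y) ` Z"
      then obtain u1 u2 where *: "u1 \<in> Z" "u2 \<in> Z" "v = u1 y" "w = u2 y" by blast
      then show "v + w \<in> (\<lambda>u. u y) ` Z" using kf.ksub_add[OF Zsub *(1,2)] by (auto simp: image_iff intro!: bexI[of _ "u1 + u2"])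
    next
      fix c v assume "c \<in> K" "v \<in> (\<lambda>u. u y) ` Z"
      then obtain u1 where *: "u1 \<in> Z" "v = u1 y" by blast
      then show "scale c v \<in> (\<lambda>u. u y) ` Z"
        using kf.ksub_scale[OF Zsub \<open>c \<in> K\<close> *(1)] by (auto simp: image_iff intro!: bexI[of _ "fscale c u1"])
    qed
    have "(\<lambda>u. u y) ` Z \<subseteq> U" using W_range by (auto simp: Z_def)
    then obtain q where q: "kv.kd ((\<lambda>u. u y) ` Z) q" using kv.kd_subset_exists[OF U(3) sub] by blast
    have "{u\<in>Z. u y = 0} = {0}"
    proof -
      have "u = 0" if u: "u \<in> Z" "u y = 0" for u
      proof -
        obtain h where h: "u = sym_tensor x h" using u Z_eq by blast
        then have "h = scale (- b h y) x" using u xy by (simp add: sym_tensor_def eq_neg_iff_add_eq_0)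
        then obtain c where c: "h = scale c x" by blast
        have "u y = scale (c + st c) x" using xy unfolding h c sym_self by simp
        then have "c + st c = 0" using u x by simp
        then show ?thesis unfolding h c sym_self by (simp add: fun_eq_iff)
      qed
      moreover have "0 \<in> {u\<in>Z. u y = 0}" using kf.ksub_zero[OF Zsub] by simp
      ultimately show ?thesis by blast
    qed
    then have k0: "kf.kd {u\<in>Z. u y = 0} 0" using kf.kd_zero by simp
    have "kf.kd Z (0 + q)"
      by (rule kd_fiber[OF kf.subfield_space_axioms kv.subfield_space_axioms k0 q Zsub]) simp_all
    then show ?thesis by blast
  qed
  then obtain z where z: "kf.kd Z z" by blast
  have "{h\<in>L x. sym_tensor x h = 0} = kv.kext {0} (scale jj x)"
  proof (intro set_eqI iffI)
    fix h assume h: "h \<in> {h\<in>L x. sym_tensor x h = 0}"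
    then have "sym_tensor x h y = 0" by simp
    then have "h = scale (- b h y) x" using xy by (simp add: sym_tensor_def eq_neg_iff_add_eq_0)
    then obtain c where c: "h = scale c x" by blast
    have "sym_tensor x h y = scale (c + st c) x" using xy unfolding c sym_self by simp
    then have "c + st c = 0" using \<open>sym_tensor x h y = 0\<close> x by simp
    then have "st c = - c" by (simp add: eq_neg_iff_add_eq_0 add.commute)
    then have "c / jj \<in> K" by (simp only: K_iff st_divide jj minus_divide_divide)
    then have "0 + scale (c / jj) (scale jj x) \<in> kv.kext {0} (scale jj x)" by (intro kv.kextI) simp_all
    then show "h \<in> kv.kext {0} (scale jj x)" using c jj by simp
  next
    fix h assume "h \<in> kv.kext {0} (scale jj x)"
    then obtain c where c: "c \<in> K" "h = scale (c * jj) x" by (auto elim!: kv.kextE)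
    have "c * jj + st (c * jj) = c * (jj + st jj)" using c by (simp add: K_iff algebra_simps)
    then have "sym_tensor x h = 0" unfolding c sym_self by (simp add: jj fun_eq_iff)
    then show "h \<in> {h\<in>L x. sym_tensor x h = 0}"
      using c W_zero xy subspace_scale[OF U(1) xy(1)] by (simp add: L_def)
  qed
  moreover have "kv.kd (kv.kext {0} (scale jj x)) 1"
    using kv.kd_ext[OF kv.kd_zero, of "scale jj x"] jj x by simp
  ultimately have k1: "kv.kd {h\<in>L x. sym_tensor x h = 0} 1" by simp
  have L: "kv.kd (L x) (1 + z)"
    by (rule kd_fiber[OF kv.subfield_space_axioms kf.subfield_space_axioms k1 z[unfolded Z_eq] ksub_L])
      (simp_all add: sym_add sym_scale)
  have le: "1 + z \<le> N - (a + 2)" using kv.kd_le[OF P(1) L L_subset_perp_P[OF xy(3)]] .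
  have "kf.kd {u\<in>W. u x = 0} (z + d2)"
    by (rule kd_fiber[OF kf.subfield_space_axioms kf.subfield_space_axioms z[unfolded Z_def] d2[unfolded W2_def] ksub_W_kernel])
      (simp_all add: fun_eq_iff H_simps[OF pr_in_H])
  then have W: "kf.kd W (z + d2 + a)"
    by (rule kd_fiber[OF kf.subfield_space_axioms kv.subfield_space_axioms _ a[unfolded Wx_def] W_ksub]) simp_all
  have "L x = perp U (P x)" if "z + d2 + a + 3 = d2 + N"
  proof -
    have "N - (a + 2) = 1 + z" using that by simp
    then show ?thesis using kv.kd_eq[OF P(1) _ L_subset_perp_P[OF xy(3)]] L by simp
  qed
  then show ?thesis using W le P(2) by (intro exI[of _ "z + d2 + a"]) auto
qed

lemma witt_le_reduction:
  assumes "x \<in> U" "y \<in> U" "b x x = 0" "b x y = 1" "witt_le U (Suc m)"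
  shows "witt_le (U2 x y) m"
  unfolding witt_le_def
proof (intro allI impI)
  fix G k assume G: "subspace G" "G \<subseteq> U2 x y" "\<forall>x\<in>G. \<forall>y\<in>G. b x y = 0" "kv.kd G k"
  have "b y x = 1" using assms(4) b_comm[of y x] by (simp del: st_b)
  then have "x \<notin> G" using G(2) by (auto simp: U2_def)
  have xG: "b x s = 0 \<and> b s x = 0" if "s \<in> G" for s using that G(2) b_eq_0_comm[of x s] by (auto simp: U2_def)
  let ?G = "{s + scale c x | s c. s \<in> G}"
  have 1: "kv.kd ?G (k + 2)" by (rule kd_subspace_insert[OF G(4,1) \<open>x \<notin> G\<close>])
  have 2: "subspace ?G" by (rule subspace_insert_line[OF G(1)])
  have 3: "?G \<subseteq> U" using G(2) assms(1) U(1) by (auto simp: U2_def intro!: subspace_add subspace_scale)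
  have 4: "\<forall>v\<in>?G. \<forall>w\<in>?G. b v w = 0"
  proof (intro ballI)
    fix v w assume "v \<in> ?G" "w \<in> ?G"
    then obtain s c s' c' where "s \<in> G" "s' \<in> G" "v = s + scale c x" "w = s' + scale c' x" by blast
    then show "b v w = 0" using G(3) xG[of s] xG[of s'] assms(3) by simp
  qed
  show "k \<le> 2 * m" using witt_leD[OF assms(5) 2 3 4 1] by simp
qed

lemma W_eq_zero:
  assumes "\<And>x. x \<in> U \<Longrightarrow> b x x = 0 \<Longrightarrow> x = 0"
  shows "W = {0}"
proof -
  have "u = 0" if u: "u \<in> W" for u
  proof (rule ccontr)
    assume "u \<noteq> 0"
    then obtain x where "x \<in> range u" "x \<noteq> 0" "b x x = 0" 
      using nilpotent_last_power[OF W_H[OF u] W_nil[OF u]] by blast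
    then show False using assms W_range[OF that] by blast
  qed
  then show ?thesis using W_zero by blast
qed

lemma witt_le_0: "witt_le U 0 \<Longrightarrow> x \<in> U \<Longrightarrow> b x x = 0 \<Longrightarrow> x = 0"
proof (rule ccontr)
  assume *: "witt_le U 0" "x \<in> U" "b x x = 0" "x \<noteq> 0"
  have "range (\<lambda>c. scale c x) \<subseteq> U" using * U(1) subspace_scale by blast
  then have "2 \<le> 2 * (0::nat)"
    by (intro witt_leD[OF *(1) subspace_line _ _ kd_line[OF *(4)]]) (use *(3) in auto)
  then show False by simp
qed

end

text \<open>\<open>m\<close> bounds the Witt index and may exceed it: for anisotropic U the space W
  is zero, and 4m <= N keeps the claimed bound nonnegative. Passing from (m, N - 4) to (m + 1, N)
  raises mN - m(2m + 1) by N - 3, the increment in \<open>reduction_dim\<close>. Sums in place of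
  differences avoid truncated subtraction.\<close>

lemma (in hermitian_space) nil_space_bound:
  assumes "nil_space scale st b U W N" "4 * m \<le> N" "witt_le U m"
  shows "\<exists>d. kf.kd W d \<and> d + m * (2 * m + 1) \<le> m * N"
  using assms
proof (induction m arbitrary: U W N)
  case 0
  interpret nil_space scale st b U W N by fact
  have "W = {0}" using W_eq_zero witt_le_0[OF 0(3)] by blast
  then show ?case using kf.kd_zero by auto
next
  case (Suc m)
  interpret nil_space scale st b U W N by fact
  show ?case
  proof (cases "\<exists>x\<in>U. b x x = 0 \<and> x \<noteq> 0")
    case False
    then have "W = {0}" using W_eq_zero by blast
    moreover have "Suc m * (2 * Suc m + 1) \<le> Suc m * N" using Suc.prems(2) by (intro mult_le_mono) auto
    ultimately show ?thesis using kf.kd_zero by auto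
  next
    case True
    then obtain x where x: "x \<in> U" "b x x = 0" "x \<noteq> 0" by blast
    then obtain y where y: "y \<in> U" "b x y = 1" using ex_partner by blast
    note xy = x(1) y(1) x(2) y(2)
    have "4 * m \<le> N - 4" using Suc.prems(2) by simp
    then obtain d2 where d2: "kf.kd (W2 x y) d2" "d2 + m * (2 * m + 1) \<le> m * (N - 4)"
      using Suc.IH[OF reduction[OF xy] _ witt_le_reduction[OF xy Suc.prems(3)]] by blast
    obtain d where d: "kf.kd W d" "d + 3 \<le> d2 + N" using reduction_dim[OF xy d2(1)] by blast
    obtain M where M: "N = M + 4" using kd_U2(2)[OF xy] by (metis add.commute le_Suc_ex)
    have "d + Suc m * (2 * Suc m + 1) \<le> Suc m * N" using d(2) d2(2) unfolding M by (simp add: algebra_simps)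
    then show ?thesis using d by blast
  qed
qed

section \<open>Spaces of maximal dimension\<close>

locale max_space = nil_space scale st b U W N
  for scale :: "'a::field \<Rightarrow> 'v::ab_group_add \<Rightarrow> 'v" and st b U W N +
  fixes t0 :: 'a and m :: nat
  assumes t0: "t0 \<in> K" "t0 \<noteq> 0" "t0 \<noteq> 1"
    and m_le: "4 * m \<le> N" and witt: "witt_le U m"
    and W_max: "\<exists>d. kf.kd W d \<and> d + m * (2 * m + 1) = m * N"
begin

definition iso :: "'v \<Rightarrow> bool" where
  "iso x \<longleftrightarrow> x \<in> U \<and> x \<noteq> 0 \<and> b x x = 0"

text \<open>The estimate of \<open>reduction_dim\<close> and the bound for \<open>W2\<close> add up
  to the bound for W, so equality for W forces equality in both. Hence the equality case passes to
  the reduced space.\<close>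

lemma max_reduction:
  assumes xy: "x \<in> U" "y \<in> U" "b x x = 0" "b x y = 1"
  shows "L x = perp U (P x)" "\<exists>k. m = Suc k \<and> max_space scale st b (U2 x y) (W2 x y) (N - 4) t0 k"
proof -
  have x: "x \<noteq> 0" using xy(4) by auto
  have "m \<noteq> 0" using witt_le_0 witt x xy(1,3) by metis
  then obtain k where k: "m = Suc k" using not0_implies_Suc by blast
  interpret R: nil_space scale st b "U2 x y" "W2 x y" "N - 4" by (rule reduction[OF xy])
  have k4: "4 * k \<le> N - 4" and wk: "witt_le (U2 x y) k"
    using m_le k witt_le_reduction[OF xy] witt by auto
  obtain d2 where d2: "kf.kd (W2 x y) d2" "d2 + k * (2 * k + 1) \<le> k * (N - 4)"
    using nil_space_bound[OF R.nil_space_axioms k4 wk] by blast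
  obtain d where d: "kf.kd W d" "d + 3 \<le> d2 + N" "d + 3 = d2 + N \<longrightarrow> L x = perp U (P x)"
    using reduction_dim[OF xy d2(1)] by blast
  obtain d' where d': "kf.kd W d'" "d' + m * (2 * m + 1) = m * N" using W_max by blast
  have eq: "d + m * (2 * m + 1) = m * N" using d' kf.kd_unique[OF d(1) d'(1)] by simp
  obtain M where M: "N = M + 4" using kd_U2(2)[OF xy] by (metis add.commute le_Suc_ex)
  have "d + 3 = d2 + N \<and> d2 + k * (2 * k + 1) = k * (N - 4)"
    using d(2) d2(2) eq unfolding M k by (simp add: algebra_simps)
  then show "L x = perp U (P x)" "\<exists>k. m = Suc k \<and> max_space scale st b (U2 x y) (W2 x y) (N - 4) t0 k"
  proof -
    assume *: "d + 3 = d2 + N \<and> d2 + k * (2 * k + 1) = k * (N - 4)"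
    then show "L x = perp U (P x)" using d by simp
    have "max_space scale st b (U2 x y) (W2 x y) (N - 4) t0 k"
      by unfold_locales (use t0 k4 wk d2 * in auto)
    then show "\<exists>k. m = Suc k \<and> max_space scale st b (U2 x y) (W2 x y) (N - 4) t0 k" using k by simp
  qed
qed

lemma L_eq: "iso x \<Longrightarrow> L x = perp U (P x)"
  using max_reduction(1) ex_partner unfolding iso_def by blast

lemma ksub_P:
  assumes "x \<noteq> 0" shows "kv.ksub (P x)"
proof -
  obtain a where a: "kv.kd (Wx x) a" using kv.kd_subset_exists[OF U(3) ksub_Wx Wx_subset_U] by blast
  show ?thesis using kv.kd_ksub[OF kd_P[OF assms a]] .
qed

lemma P_eq: "iso x \<Longrightarrow> P x = perp U (L x)"
  using perp_perp[OF U(3,1,2) ksub_P P_subset_U] L_eq unfolding iso_def by simp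

lemma mem_P: "iso x \<Longrightarrow> z \<in> U \<Longrightarrow> (\<And>y. y \<in> L x \<Longrightarrow> btr y z = 0) \<Longrightarrow> z \<in> P x"
  using P_eq by (auto simp: perp_def)

lemma mem_L: "iso x \<Longrightarrow> y \<in> U \<Longrightarrow> (\<And>q. q \<in> P x \<Longrightarrow> btr q y = 0) \<Longrightarrow> y \<in> L x"
  using L_eq by (auto simp: perp_def)

lemma sym_identities:
  assumes "u \<in> W" "sym_tensor x y \<in> W"
  shows "qpoly u y x + qpoly u x y = 0" "qpoly u y x * qpoly u x y - qpoly u y y * qpoly u x x = 0"
proof -
  have *: "sym_tensor x y ((w ^^ q) z) = scale (b y ((w ^^ q) z)) x + scale (b x ((w ^^ q) z)) y" for w q z
    by (simp add: sym_tensor_def add.commute)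
  from rank2_zero[OF assms t0, of x y y x, OF * refl]
  show "qpoly u y x + qpoly u x y = 0" "qpoly u y x * qpoly u x y - qpoly u y y * qpoly u x x = 0" by auto
qed

text \<open>The s^2 coefficient of E1 = 0 says that u(u x) is trace-orthogonal to L x, and the
  orthogonal of L x is P x.\<close>

lemma square_in_P:
  assumes "iso x" "u \<in> W"
  shows "u (u x) \<in> P x"
proof (rule mem_P[OF assms(1) W_range[OF assms(2)]])
  fix y assume "y \<in> L x"
  then have y: "sym_tensor x y \<in> W" by (simp add: L_def)
  have "coeff (qpoly u y x + qpoly u x y) 2 = 0" using sym_identities(1)[OF assms(2) y] by simp
  then have "b y (u (u x)) + b x (u (u y)) = 0"
    by (simp add: coeff_qpoly[OF W_H[OF assms(2)] W_nil[OF assms(2)]] numeral_2_eq_2)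
  then show "btr y (u (u x)) = 0" using H_adj[OF W_H[OF assms(2)]] by (simp add: btr_def)
qed

text \<open>Polarization of \<open>square_in_P\<close>. It makes P x stable under the elements of W
  that kill x.\<close>

lemma jordan_in_P:
  assumes "iso x" "u \<in> W" "v \<in> W"
  shows "u (v x) + v (u x) \<in> P x"
proof -
  have x: "x \<noteq> 0" using assms(1) by (simp add: iso_def)
  have "(u + v) ((u + v) x) - u (u x) - v (v x) \<in> P x"
    using kv.ksub_diff[OF ksub_P[OF x]] square_in_P[OF assms(1)] assms(2,3) W_add by meson
  moreover have "(u + v) ((u + v) x) - u (u x) - v (v x) = u (v x) + v (u x)"
    using W_H assms(2,3) by (simp add: H_simps)
  ultimately show ?thesis by simp
qed

section \<open>Isotropic vectors whose rank-one map lies in W\<close>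

definition Phi :: "'v set" where
  "Phi = {x. iso x \<and> (\<forall>u\<in>W. b x (u x) = 0)}"

lemma Phi_iso: "x \<in> Phi \<Longrightarrow> iso x"
  by (simp add: Phi_def)

lemma Phi_I: "x \<in> U \<Longrightarrow> x \<noteq> 0 \<Longrightarrow> b x x = 0 \<Longrightarrow> (\<And>u. u \<in> W \<Longrightarrow> b x (u x) = 0) \<Longrightarrow> x \<in> Phi"
  by (simp add: Phi_def iso_def)

lemma Phi_line_in_L:
  assumes "x \<in> Phi"
  shows "scale c x \<in> L x"
proof (rule mem_L[OF Phi_iso[OF assms]])
  have x: "x \<in> U" "b x x = 0" using assms by (auto simp: Phi_def iso_def)
  show "scale c x \<in> U" using x U(1) subspace_scale by blast
  fix q assume "q \<in> P x"
  then obtain u d where q: "u \<in> W" "q = u x + scale d x" by (rule P_E)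
  have "b x (u x) = 0" "b (u x) x = 0" using assms q H_adj[OF W_H[OF q(1)], of x x] by (auto simp: Phi_def)
  then show "btr q (scale c x) = 0" using x by (simp add: q btr_def)
qed

lemma Phi_tensor: "x \<in> Phi \<Longrightarrow> (\<lambda>z. scale (b x z) x) \<in> W"
  using Phi_line_in_L[of x tau] by (simp add: L_def sym_tau)

lemma Phi_tensor_I:
  assumes "iso x" "(\<lambda>z. scale (b x z) x) \<in> W"
  shows "x \<in> Phi"
  using rank1_zero[OF _ assms(2), of _ 1] assms(1) by (simp add: Phi_def)

lemma Phi_power: "x \<in> Phi \<Longrightarrow> u \<in> W \<Longrightarrow> b x ((u ^^ k) x) = 0"
  using rank1_zero[OF _ Phi_tensor] by blast

text \<open>As \<open>qpoly u x x\<close> vanishes, E2 = 0 becomes a product of two polynomials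
  equal to zero. Their coefficients are conjugate to each other, so it does not matter which factor
  vanishes.\<close>

lemma Phi_L_power:
  assumes "x \<in> Phi" "y \<in> L x" "u \<in> W"
  shows "b y ((u ^^ k) x) = 0"
proof -
  note c = coeff_qpoly[OF W_H[OF assms(3)] W_nil[OF assms(3)]]
  have y: "sym_tensor x y \<in> W" using assms by (simp add: L_def)
  have "qpoly u x x = 0" by (rule poly_eqI) (simp add: c Phi_power[OF assms(1,3)])
  then have "qpoly u y x * qpoly u x y = 0" using sym_identities(2)[OF assms(3) y] by simp
  then consider "qpoly u y x = 0" | "qpoly u x y = 0" by auto
  then show ?thesis
  proof cases
    case 1
    then show ?thesis using c[of y x k] by simp
  next
    case 2
    then have "b x ((u ^^ k) y) = 0" using c[of x y k] by simp
    then have "b ((u ^^ k) x) y = 0" using H_adj[OF H_power[OF W_H[OF assms(3)]]] by simp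
    then show ?thesis using b_eq_0_comm by blast
  qed
qed

lemma Phi_L_P:
  assumes "x \<in> Phi" "y \<in> L x" "q \<in> P x"
  shows "b y q = 0"
proof -
  obtain u d where q: "u \<in> W" "q = u x + scale d x" using assms(3) by (rule P_E)
  have "b y x = 0" using assms(2) b_eq_0_comm[of x y] by (simp add: L_def)
  moreover have "b y (u x) = 0" using Phi_L_power[OF assms(1,2) q(1), of 1] by simp
  ultimately show ?thesis using q by simp
qed

text \<open>P x is the trace orthogonal of L x. By \<open>Phi_L_P\<close> it is even orthogonal to L
  x for b itself, a relation that survives scaling by F.\<close>

lemma subspace_P:
  assumes "x \<in> Phi" shows "subspace (P x)"
proof (rule subspaceI)
  have x: "iso x" "x \<noteq> 0" "x \<in> U" using assms by (auto simp: Phi_def iso_def)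
  note Pk = ksub_P[OF x(2)]
  show "0 \<in> P x" using kv.ksub_zero[OF Pk] .
  show "\<And>p q. p \<in> P x \<Longrightarrow> q \<in> P x \<Longrightarrow> p + q \<in> P x" using kv.ksub_add[OF Pk] .
  fix c q assume q: "q \<in> P x"
  show "scale c q \<in> P x"
  proof (rule mem_P[OF x(1)])
    show "scale c q \<in> U" using q P_subset_U[OF x(3)] U(1) subspace_scale by blast
    fix y assume "y \<in> L x"
    then have "b y q = 0" using Phi_L_P[OF assms] q by blast
    then show "btr y (scale c q) = 0" using b_eq_0_comm[of y q] by (simp add: btr_def)
  qed
qed

text \<open>Since b(u x, u x) = b(x, u^2 x) = 0, polarization makes P x singular for the trace form;
  so it lies in its own orthogonal, which is L x.\<close>

lemma P_subset_L:
  assumes "x \<in> Phi" shows "P x \<subseteq> L x"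
proof
  fix q assume "q \<in> P x"
  then obtain v d where q: "v \<in> W" "q = v x + scale d x" by (rule P_E)
  have x: "iso x" "x \<in> U" "b x x = 0" using assms by (auto simp: Phi_def iso_def)
  have 0: "b x (u x) = 0 \<and> b (u x) x = 0" if "u \<in> W" for u
    using assms H_adj[OF W_H[OF that], of x x] that by (auto simp: Phi_def)
  have sq: "b (u x) (u x) = 0" if "u \<in> W" for u
  proof -
    have "b (u x) (u x) = b x ((u ^^ 2) x)" using H_adj[OF W_H[OF that]] by (simp add: numeral_2_eq_2)
    then show ?thesis using Phi_power[OF assms that] by simp
  qed
  show "q \<in> L x"
  proof (rule mem_L[OF x(1)])
    show "q \<in> U" using P_subset_U[OF x(2)] \<open>q \<in> P x\<close> by blast
    fix p assume "p \<in> P x"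
    then obtain u c where p: "u \<in> W" "p = u x + scale c x" by (rule P_E)
    have "b (u x) (v x) + b (v x) (u x) = 0"
      using sq[OF W_add[OF p(1) q(1)]] sq[OF p(1)] sq[OF q(1)] by (simp add: add.commute)
    then show "btr p q = 0" using 0[OF p(1)] 0[OF q(1)] x(3) by (simp add: btr_def p q)
  qed
qed

lemma P_singular: "x \<in> Phi \<Longrightarrow> p \<in> P x \<Longrightarrow> q \<in> P x \<Longrightarrow> b p q = 0"
  using Phi_L_P P_subset_L by blast

text \<open>Expanding b(x, (v + t w)^3 x) = 0 leaves t A + t^2 B = 0, and t = 1, t =
  \<open>t0\<close> give A = 0. Two of the three terms of A pair v(v x) with w x, both in the
  totally singular P x; the third is the value in question.\<close>

lemma Phi_cubic:
  assumes "x \<in> Phi" "v \<in> W" "w \<in> W"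
  shows "b (v x) (w (v x)) = 0"
proof -
  note vw = H_simps[OF W_H[OF assms(2)]] H_simps[OF W_H[OF assms(3)]]
  note adj = H_adj[OF W_H[OF assms(2)]] H_adj[OF W_H[OF assms(3)]]
  have iso: "iso x" using Phi_iso[OF assms(1)] .
  define A where "A = b x (v (v (w x))) + b x (v (w (v x))) + b x (w (v (v x)))"
  define B where "B = b x (v (w (w x))) + b x (w (v (w x))) + b x (w (w (v x)))"
  have v3: "b x (v (v (v x))) = 0" "b x (w (w (w x))) = 0"
    using Phi_power[OF assms(1), of _ 3] assms(2,3) by (auto simp: numeral_3_eq_3)
  have "t * (A + t * B) = 0" if "t \<in> K" for t
  proof -
    have "b x (((v + fscale t w) ^^ 3) x) = 0"
      using Phi_power[OF assms(1) W_add[OF assms(2) W_scale[OF that assms(3)]]] .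
    then show ?thesis using v3 by (simp add: numeral_3_eq_3 vw A_def B_def algebra_simps)
  qed
  from this[OF t0(1)] this[of 1] t0 have AB: "A + t0 * B = 0" "A + B = 0" by (auto simp: K_iff)
  have "(t0 - 1) * B = (A + t0 * B) - (A + B)" by (simp add: algebra_simps)
  then have "(t0 - 1) * B = 0" using AB by simp
  then have "A = 0" using AB t0 by simp
  moreover have "b (v (v x)) (w x) = 0" "b (w x) (v (v x)) = 0"
    using P_singular[OF assms(1)] square_in_P[OF iso assms(2)] P_I0[OF assms(3)] by auto
  ultimately show ?thesis by (simp add: A_def adj)
qed

lemma P_subset_Phi:
  assumes "x \<in> Phi" "q \<in> P x" "q \<noteq> 0"
  shows "q \<in> Phi"
proof (rule Phi_I[OF _ assms(3)])
  have x: "x \<in> U" using assms by (auto simp: Phi_def iso_def)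
  show "q \<in> U" using P_subset_U[OF x] assms by blast
  show "b q q = 0" using P_singular assms by blast
  fix w assume w: "w \<in> W"
  obtain v c where q: "v \<in> W" "q = v x + scale c x" using assms(2) by (rule P_E)
  have "b (v x) (w x) = 0" "b (w x) (v x) = 0" using P_singular[OF assms(1)] P_I0 q(1) w by blast+
  moreover have "b x (w (v x)) = b (w x) (v x)" using H_adj[OF W_H[OF w]] by simp
  moreover have "b x (w x) = 0" using assms(1) w by (simp add: Phi_def)
  ultimately show "b q (w q) = 0" using Phi_cubic[OF assms(1) q(1) w] by (simp add: q H_simps[OF W_H[OF w]])
qed

end

context hermitian_space
begin

text \<open>A nonzero determinant would make u injective on the plane, against nilpotency. With
  determinant zero, u^2 = (p + s) u there, so a nonzero trace would be an eigenvalue unless u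
  vanishes on the plane.\<close>

lemma nilpotent_plane:
  assumes u: "u \<in> H" "nilpotent_endo u"
    and e: "u e1 = scale p e1 + scale r e2" "u e2 = scale q e1 + scale s e2"
    and indep: "\<And>c d. scale c e1 + scale d e2 = 0 \<Longrightarrow> c = 0 \<and> d = 0"
  shows "p + s = 0" "p * s = q * r"
proof -
  obtain n where n: "u ^^ n = (\<lambda>x. 0)" using u(2) by (auto simp: nilpotent_endo_def)
  let ?S = "{v. \<exists>c d. v = scale c e1 + scale d e2}"
  have uS: "u (scale c e1 + scale d e2) = scale (c * p + d * q) e1 + scale (c * r + d * s) e2" for c d
    by (simp add: H_simps[OF u(1)] e algebra_simps)
  show det: "p * s = q * r"
  proof (rule ccontr)
    assume D: "p * s \<noteq> q * r"
    have step: "u v \<noteq> 0 \<and> u v \<in> ?S" if nz: "v \<noteq> 0" and vS: "v \<in> ?S" for v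
    proof -
      obtain c d where v: "v = scale c e1 + scale d e2" using vS by blast
      have "u v \<noteq> 0"
      proof
        assume "u v = 0"
        then have 1: "c * p + d * q = 0" "c * r + d * s = 0" using indep uS v by metis+
        have "c * (p * s - q * r) = (c * p + d * q) * s - (c * r + d * s) * q" by (simp add: algebra_simps)
        then have "c = 0" using 1 D by simp
        have "d * (p * s - q * r) = (c * r + d * s) * p - (c * p + d * q) * r" by (simp add: algebra_simps)
        then have "d = 0" using 1 D by simp
        then show False using \<open>c = 0\<close> v nz by simp
      qed
      then show ?thesis using uS v by blast
    qed
    have "e1 \<noteq> 0" using indep[of 1 0] by auto
    moreover have "e1 = scale 1 e1 + scale 0 e2" by simp
    ultimately have e1: "e1 \<noteq> 0 \<and> e1 \<in> ?S" by blast
    have "(u ^^ k) e1 \<noteq> 0 \<and> (u ^^ k) e1 \<in> ?S" for k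
      by (induction k) (use e1 step in auto)
    then show False using n by metis
  qed
  show "p + s = 0"
  proof (rule ccontr)
    assume T: "p + s \<noteq> 0"
    have sq: "u (u v) = scale (p + s) (u v)" if v: "v \<in> ?S" for v
    proof -
      obtain c d where v: "v = scale c e1 + scale d e2" using v by blast
      have "u (u v) = scale ((c * p + d * q) * p + (c * r + d * s) * q) e1 + scale ((c * p + d * q) * r + (c * r + d * s) * s) e2"
        by (simp only: v uS)
      moreover have "(c * p + d * q) * p + (c * r + d * s) * q = (p + s) * (c * p + d * q) - c * (p * s - q * r)"
        by (simp add: algebra_simps)
      moreover have "(c * p + d * q) * r + (c * r + d * s) * s = (p + s) * (c * r + d * s) - d * (p * s - q * r)"
        by (simp add: algebra_simps)
      ultimately have "u (u v) = scale ((p + s) * (c * p + d * q)) e1 + scale ((p + s) * (c * r + d * s)) e2"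
        using det by simp
      then show ?thesis by (simp add: v uS scale_right_distrib)
    qed
    have "u v = 0" if v: "v \<in> ?S" for v
    proof -
      have "u (u v) = scale (p + s) (u v)" using sq[OF v] .
      then show ?thesis using nilpotent_no_eigenvalue[OF u, of "u v" "p + s"] T by blast
    qed
    moreover have "e1 = scale 1 e1 + scale 0 e2" "e2 = scale 0 e1 + scale 1 e2" by simp_all
    then have "e1 \<in> ?S" "e2 \<in> ?S" by blast+
    ultimately have "u e1 = 0" "u e2 = 0" by blast+
    then have "p = 0" "s = 0" using indep[of p r] indep[of q s] e by auto
    then show False using T by simp
  qed
qed

end

context nil_space
begin

text \<open>Polarizing the quadratic identity at \<open>u1\<close> leaves only the cross term \<open>\<alpha> u1 * \<gamma> u\<close>.\<close>

lemma quadratic_vanishing: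
  fixes \<alpha> \<beta> \<gamma> :: "('v \<Rightarrow> 'v) \<Rightarrow> 'a"
  assumes add: "\<And>u v. u \<in> W \<Longrightarrow> v \<in> W \<Longrightarrow> \<alpha> (u + v) = \<alpha> u + \<alpha> v" "\<And>u v. u \<in> W \<Longrightarrow> v \<in> W \<Longrightarrow> \<beta> (u + v) = \<beta> u + \<beta> v"
      "\<And>u v. u \<in> W \<Longrightarrow> v \<in> W \<Longrightarrow> \<gamma> (u + v) = \<gamma> u + \<gamma> v"
    and q: "\<And>u. u \<in> W \<Longrightarrow> \<beta> u * \<beta> u + \<alpha> u * \<gamma> u = 0"
    and u1: "u1 \<in> W" "\<beta> u1 = 0" "\<alpha> u1 \<noteq> 0" and u: "u \<in> W"
  shows "\<beta> u = 0" "\<gamma> u = 0"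
proof -
  have g1: "\<gamma> u1 = 0" using q[OF u1(1)] u1 by simp
  have "\<beta> u * \<beta> u + (\<alpha> u + \<alpha> u1) * \<gamma> u = 0" using q[OF W_add[OF u u1(1)]] u1 u g1 by (simp add: add)
  moreover have "\<beta> u * \<beta> u + (\<alpha> u + \<alpha> u1) * \<gamma> u = (\<beta> u * \<beta> u + \<alpha> u * \<gamma> u) + \<alpha> u1 * \<gamma> u"
    by (simp add: algebra_simps)
  ultimately have "\<alpha> u1 * \<gamma> u = 0" using q[OF u] by simp
  then show g: "\<gamma> u = 0" using u1 by simp
  then show "\<beta> u = 0" using q[OF u] by simp
qed

lemma ex_dual:
  assumes "subspace S" "S \<subseteq> U" "e \<in> U" "e \<notin> S"
  shows "\<exists>z\<in>U. (\<forall>s\<in>S. b s z = 0) \<and> b e z = c"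
proof -
  obtain g where g: "g \<in> U" "\<forall>s\<in>S. b s g = 0" "b g e \<noteq> 0"
    using mem_subspace_by_perp[OF U(3,1,2) assms(1-3)] assms(4) by blast
  have "b e g \<noteq> 0" using g b_eq_0_comm by blast
  then show ?thesis using g U(1) by (intro bexI[of _ "scale (c / b e g) g"]) (auto simp: subspace_scale)
qed

end

context max_space
begin

text \<open>In the reduced space \<open>P z\<close> is just Fz, so maximality puts the tensor of z
  with every vector orthogonal to z into \<open>W2\<close>. Its lift to W agrees with it up to the
  kernel of the compression, that is, up to a tensor of x.\<close>

lemma lift_sym:
  assumes xy: "x \<in> U" "y \<in> U" "b x x = 0" "b x y = 1"
    and z: "z \<in> U2 x y" "z \<noteq> 0" "b z z = 0" "\<forall>u\<in>W2 x y. u z = 0"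
    and g: "g \<in> U" "b x g = 0" "b z g = 0"
  shows "\<exists>h\<in>U. b x h = 0 \<and> sym_tensor z g + sym_tensor x h \<in> W"
proof -
  obtain k where "max_space scale st b (U2 x y) (W2 x y) (N - 4) t0 k" using max_reduction(2)[OF xy] by blast
  then interpret R: max_space scale st b "U2 x y" "W2 x y" "N - 4" t0 k .
  have zU: "z \<in> U" "b x z = 0" "b y z = 0" using z by (auto simp: U2_def)
  then have zx: "b z x = 0" using b_eq_0_comm by blast
  define g' where "g' = pr x y g"
  have g'U: "g' \<in> U2 x y" unfolding g'_def by (rule pr_in_U2[OF xy g(1)])
  have g': "g' = g - scale (b y g) x" unfolding g'_def by (rule pr_perp_diff[OF g(2)])
  have zg': "b z g' = 0" using g zx by (simp add: g')
  have isoz: "R.iso z" using z by (simp add: R.iso_def)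
  have "g' \<in> R.L z"
  proof (rule R.mem_L[OF isoz g'U])
    fix q assume "q \<in> R.P z"
    then obtain u c where "u \<in> W2 x y" "q = u z + scale c z" by (rule R.P_E)
    then have "q = scale c z" using z(4) by simp
    then show "btr q g' = 0" using zg' b_eq_0_comm[of z g'] by (simp add: btr_def)
  qed
  then have "sym_tensor z g' \<in> W2 x y" by (simp add: R.L_def)
  then obtain u where u: "u \<in> W" "u x = 0" "sym_tensor z g' = pr x y \<circ> u \<circ> pr x y" by (rule W2_E)
  define v where "v = u + sym_tensor z (- g')"
  have symm: "sym_tensor z (- g') w = - sym_tensor z g' w" for w by (simp add: sym_tensor_def)
  have g'x: "b g' x = 0" using g'U b_eq_0_comm[of x g'] by (simp add: U2_def)
  have "\<exists>h\<in>U. b x h = 0 \<and> v = sym_tensor x h"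
  proof (rule compression_kernel[OF xy])
    show "v \<in> H" unfolding v_def by (rule H_plus[OF W_H[OF u(1)] sym_in_H])
    have "g' \<in> U" using g'U by (simp add: U2_def)
    then show "v w \<in> U" for w using W_range[OF u(1)] zU U(1)
      by (simp add: v_def sym_tensor_def subspace_diff subspace_add subspace_scale subspace_neg)
    show "v x = 0" using u zx g'x by (simp add: v_def sym_tensor_def)
    show "pr x y \<circ> v \<circ> pr x y = 0"
    proof
      fix w
      have "pr x y (sym_tensor z g' (pr x y w)) = pr x y (u (pr x y w))" unfolding u(3) by (simp add: pr_idem[OF xy(3,4)])
      then show "(pr x y \<circ> v \<circ> pr x y) w = 0 w"
        by (simp add: v_def symm H_simps[OF pr_in_H])
    qed
  qed
  then obtain h' where h': "h' \<in> U" "b x h' = 0" "v = sym_tensor x h'" by blast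
  \<comment> \<open>Passing from \<open>g'\<close> back to g adds b(y,g) x to the second factor. The
    tensor of z with that multiple of x is the tensor of x with \<open>scale (st (b y g)) z\<close>,
    so h absorbs it.\<close>
  define h where "h = h' - scale (st (b y g)) z"
  have "sym_tensor z g + sym_tensor x h = u"
  proof
    fix w
    have "sym_tensor x h' w = u w - sym_tensor z g' w" using fun_cong[OF h'(3), of w] by (simp add: v_def symm)
    moreover have "(sym_tensor z g + sym_tensor x h) w = sym_tensor z g' w + sym_tensor x h' w"
      by (simp add: sym_tensor_def h_def g' algebra_simps)
    ultimately show "(sym_tensor z g + sym_tensor x h) w = u w" by simp
  qed
  moreover have "h \<in> U" unfolding h_def by (rule subspace_diff[OF U(1) h'(1) subspace_scale[OF U(1) zU(1)]])
  moreover have "b x h = 0" using h' zU by (simp add: h_def)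
  ultimately show ?thesis using u(1) by (intro bexI[of _ h]) simp_all
qed

text \<open>K may have no third nonzero scalar, so E1, E2, E3 cannot be separated. Elimination
  between t = 1 and t = \<open>t0\<close> expresses E1 and E2 by E3 with extra powers of s, which
  controls their low coefficients.\<close>

lemma rank3_zero:
  assumes "u \<in> W" "r \<in> W"
    and r: "\<And>z. r z = scale (b g1 z) x1 + scale (b g2 z) x2 + scale (b g3 z) x3"
    and m: "mm = qpoly u"
  defines "E3 \<equiv> (mm g1 x1 * mm g2 x2 * mm g3 x3 + mm g1 x2 * mm g2 x3 * mm g3 x1 + mm g1 x3 * mm g2 x1 * mm g3 x2
          - mm g1 x1 * mm g2 x3 * mm g3 x2 - mm g1 x2 * mm g2 x1 * mm g3 x3 - mm g1 x3 * mm g2 x2 * mm g3 x1)"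
  shows "mm g1 x1 + mm g2 x2 + mm g3 x3 = [:0, 0, t0:] * E3"
    "mm g1 x1 * mm g2 x2 - mm g1 x2 * mm g2 x1 + (mm g1 x1 * mm g3 x3 - mm g1 x3 * mm g3 x1)
          + (mm g2 x2 * mm g3 x3 - mm g2 x3 * mm g3 x2) = [:0, t0 + 1:] * E3"
proof -
  let ?E1 = "mm g1 x1 + mm g2 x2 + mm g3 x3"
  let ?E2 = "mm g1 x1 * mm g2 x2 - mm g1 x2 * mm g2 x1 + (mm g1 x1 * mm g3 x3 - mm g1 x3 * mm g3 x1)
          + (mm g2 x2 * mm g3 x3 - mm g2 x3 * mm g3 x2)"
  define c :: "'a poly" where "c = [:0, 1:]"
  define T :: "'a poly" where "T = [:t0:]"
  have c: "[:0, 1:] = c" "[:0, t0:] = T * c" "[:0, 0, t0:] = T * c * c" "[:0, t0 + 1:] = (T + 1) * c"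
    by (simp_all add: c_def T_def one_pCons)
  have "?E1 - [:0, 1:] * ?E2 + [:0, 1:]^2 * E3 = 0"
    unfolding E3_def by (rule rank3_identity[OF assms(1,2) _ _ r m]) (simp_all add: K_iff)
  then have 1: "?E1 = c * ?E2 - c * c * E3" unfolding c power2_eq_square by (simp add: algebra_simps)
  have "?E1 - [:0, t0:] * ?E2 + [:0, t0:]^2 * E3 = 0"
    unfolding E3_def by (rule rank3_identity[OF assms(1,2) t0(1,2) r m])
  then have 2: "?E1 = T * c * ?E2 - T * c * (T * c) * E3" unfolding c power2_eq_square by (simp add: algebra_simps)
  have "c * (T - 1) * (?E2 - (T + 1) * c * E3) = (T * c * ?E2 - T * c * (T * c) * E3) - (c * ?E2 - c * c * E3)"
    by (simp only: algebra_simps mult_1)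
  also have "\<dots> = 0" using 1 2 by (simp only: diff_self)
  finally have "c * (T - 1) * (?E2 - (T + 1) * c * E3) = 0" .
  moreover have "c \<noteq> 0" "T - 1 \<noteq> 0" using t0 by (simp_all add: c_def T_def one_pCons)
  ultimately have E2: "?E2 = (T + 1) * c * E3" by (simp only: mult_eq_0_iff right_minus_eq simp_thms)
  then show "?E2 = [:0, t0 + 1:] * E3" by (simp only: c)
  have "?E1 = c * ((T + 1) * c * E3) - c * c * E3" using 1 unfolding E2 .
  then show "?E1 = [:0, 0, t0:] * E3" unfolding c(3) by (simp add: algebra_simps)
qed

lemma ex_iso:
  assumes "m \<noteq> 0"
  shows "\<exists>u\<in>W. \<exists>x. u \<noteq> 0 \<and> iso x \<and> u x = 0"
proof -
  obtain d where d: "kf.kd W d" "d + m * (2 * m + 1) = m * N" using W_max by blast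
  have "2 * m + 1 < N" using assms m_le by linarith
  then have "m * (2 * m + 1) < m * N" using assms by (intro mult_strict_left_mono) auto
  then have "d \<noteq> 0" using d by linarith
  then have "W \<noteq> {0}" using d(1) kf.kd_unique[OF kf.kd_zero, of d] by auto
  then obtain u where u: "u \<in> W" "u \<noteq> 0" using W_zero by blast
  obtain x where "x \<in> range u" "x \<noteq> 0" "b x x = 0" "u x = 0"
    using nilpotent_last_power[OF W_H[OF u(1)] W_nil[OF u(1)] u(2)] by blast
  then show ?thesis using u W_range[OF u(1)] by (auto simp: iso_def)
qed

text \<open>Some \<open>u1\<close> has b(x, u1 x) nonzero. The s coefficient of E2 then makes all of
  L x isotropic, and the s^2 coefficient is the identity that \<open>quadratic_vanishing\<close>
  asks for. So a translate of y along x lies in \<open>Phi\<close> unless it is zero.\<close>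

lemma no_Phi_L:
  assumes "Phi = {}" "iso x" "y \<in> L x"
  shows "\<exists>c. y = scale c x \<and> c + st c = 0"
proof -
  have x: "x \<in> U" "b x x = 0" "x \<noteq> 0" using assms(2) by (auto simp: iso_def)
  obtain u1 where u1: "u1 \<in> W" "b x (u1 x) \<noteq> 0" using assms(1,2) by (auto simp: Phi_def)
  have facts: "b y (u x) + b x (u y) = 0 \<and> b y y * b x (u x) = 0
      \<and> (b y y = 0 \<longrightarrow> b y (u x) * b y (u x) + b x (u x) * b y (u y) = 0)"
    if y: "y \<in> L x" and u: "u \<in> W" for y u
  proof -
    note c = coeff_qpoly[OF W_H[OF u] W_nil[OF u]]
    have y': "sym_tensor x y \<in> W" "b x y = 0" "b y x = 0" using y b_eq_0_comm[of x y] by (auto simp: L_def)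
    note I = sym_identities[OF u y'(1)]
    have 1: "b y (u x) + b x (u y) = 0" using arg_cong[OF I(1), of "\<lambda>p. coeff p 1"] by (simp add: c)
    have 2: "b y y * b x (u x) = 0"
      using arg_cong[OF I(2), of "\<lambda>p. coeff p 1"] x y' by (simp add: c coeff_mult)
    have 3: "b y (u x) * b x (u y) - b y (u y) * b x (u x) = 0" if "b y y = 0"
      using arg_cong[OF I(2), of "\<lambda>p. coeff p 2"] x y' that by (simp add: c coeff_mult numeral_2_eq_2)
    have "b x (u y) = - b y (u x)" using 1 by (simp add: eq_neg_iff_add_eq_0 add.commute)
    then have "b y (u x) * b y (u x) + b x (u x) * b y (u y) = - (b y (u x) * b x (u y) - b y (u y) * b x (u x))"
      by (simp add: mult.commute)
    then show ?thesis using 1 2 3 by simp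
  qed
  define \<alpha> where "\<alpha> = b x (u1 x)"
  have \<alpha>: "\<alpha> \<noteq> 0" "st \<alpha> = \<alpha>" using u1 b_self_in_K[OF W_H[OF u1(1)], of x] by (simp_all only: \<alpha>_def K_iff not_False_eq_True)
  define c where "c = b x (u1 y) / \<alpha>"
  have stc: "st c = b y (u1 x) / \<alpha>" using \<alpha> H_adj[OF W_H[OF u1(1)], of y x] by (simp add: c_def)
  have "c + st c = (b x (u1 y) + b y (u1 x)) / \<alpha>" unfolding stc by (simp add: c_def add_divide_distrib)
  then have trc: "c + st c = 0" using facts[OF assms(3) u1(1)] by (simp add: add.commute)
  \<comment> \<open>The correction by a trace-zero multiple of \<open>x\<close> stays in \<open>L x\<close> and kills the value at \<open>u1\<close>.\<close>
  define y' where "y' = y - scale c x"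
  have "sym_tensor x y' = sym_tensor x y"
  proof
    fix z
    have "sym_tensor x y' z = sym_tensor x y z - scale ((c + st c) * b x z) x" by (simp add: sym_tensor_def y'_def algebra_simps)
    then show "sym_tensor x y' z = sym_tensor x y z" by (simp only: trc) simp
  qed
  then have y'L: "y' \<in> L x" using assms(3) x U(1) by (simp add: L_def y'_def subspace_diff subspace_scale)
  have yy: "b y' y' = 0" using facts[OF y'L u1(1)] u1 by simp
  have "b y' (u y') = 0" if u: "u \<in> W" for u
  proof (rule quadratic_vanishing(2)[of "\<lambda>u. b x (u x)" "\<lambda>u. b y' (u x)" "\<lambda>u. b y' (u y')", OF _ _ _ _ u1(1) _ u1(2) u])
    show "b y' (u1 x) = 0" using \<alpha> by (simp add: y'_def stc) (simp add: \<alpha>_def)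
  qed (use facts[OF y'L] yy in auto)
  then have "y' \<in> Phi" if "y' \<noteq> 0" using that yy y'L by (intro Phi_I) (auto simp: L_def)
  then have "y' = 0" using assms(1) by blast
  then show ?thesis using trc by (intro exI[of _ c]) (simp add: y'_def)
qed

text \<open>The trace orthogonal of the trace-zero multiples of x consists of the z with b(x,z) in
  K, so P x contains all of these. Testing against g orthogonal to x expresses equality modulo
  Fx.\<close>

lemma no_Phi_values:
  assumes "Phi = {}" "iso x" "z \<in> U" "b x z \<in> K"
  shows "\<exists>v\<in>W. \<forall>g. b g x = 0 \<longrightarrow> b g (v x) = b g z"
proof -
  have "z \<in> P x"
  proof (rule mem_P[OF assms(2,3)])
    fix y assume "y \<in> L x"
    then obtain c where c: "y = scale c x" "c + st c = 0" using no_Phi_L[OF assms(1,2)] by blast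
    have "b z x = b x z" using assms(4) b_comm[of z x] by (simp add: K_iff del: st_b)
    then have "btr y z = (c + st c) * b x z" by (simp add: btr_def c(1) algebra_simps)
    then show "btr y z = 0" using c by simp
  qed
  then obtain v c where "v \<in> W" "z = v x + scale c x" by (rule P_E)
  then show ?thesis by (intro bexI[of _ v]) simp_all
qed

end

section \<open>Existence of a common isotropic kernel vector\<close>

context max_space
begin

text \<open>With \<open>Phi\<close> empty, the values v x are almost free by
  \<open>no_Phi_values\<close>. Well-chosen ones, inserted into the low coefficients for an operator
  r lifted from the reduced space, force r to be the rank-one map of an isotropic vector, which then
  lies in \<open>Phi\<close>.\<close>

lemma Phi_nonempty:
  assumes m: "m \<noteq> 0"
    and IH: "\<And>x y. x \<in> U \<Longrightarrow> y \<in> U \<Longrightarrow> b x x = 0 \<Longrightarrow> b x y = 1 \<Longrightarrow> m \<noteq> 1 \<Longrightarrow>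
        \<exists>z\<in>U2 x y. z \<noteq> 0 \<and> b z z = 0 \<and> (\<forall>u\<in>W2 x y. u z = 0)"
  shows "Phi \<noteq> {}"
proof
  assume none: "Phi = {}"
  obtain u x where u: "u \<in> W" "u \<noteq> 0" "u x = 0" and iso: "iso x" using ex_iso[OF m] by blast
  have x: "x \<in> U" "b x x = 0" "x \<noteq> 0" using iso by (auto simp: iso_def)
  obtain y where y: "y \<in> U" "b x y = 1" using ex_partner x by blast
  note xy = x(1) y(1) x(2) y(2)
  show False
  proof (cases "m = 1")
    case True
    obtain k where k: "m = Suc k" "max_space scale st b (U2 x y) (W2 x y) (N - 4) t0 k" using max_reduction(2)[OF xy] by blast
    interpret R: max_space scale st b "U2 x y" "W2 x y" "N - 4" t0 k by (rule k(2))
    \<comment> \<open>The reduced space is anisotropic, so u compresses to zero; it is then the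
      tensor of x with a trace-zero multiple of x, which is zero.\<close>
    have "k = 0" using k True by simp
    then have "W2 x y = {0}" using R.W_eq_zero R.witt_le_0 R.witt by blast
    then have "pr x y \<circ> u \<circ> pr x y = 0" using W2_I[OF u(1,3), of y] by simp
    then obtain h where h: "h \<in> U" "b x h = 0" "u = sym_tensor x h"
      using compression_kernel[OF xy W_H[OF u(1)] W_range[OF u(1)] u(3)] by blast
    then have "h \<in> L x" using u by (simp add: L_def)
    then obtain c where c: "h = scale c x" "c + st c = 0" using no_Phi_L[OF none iso] by blast
    have "u = 0" unfolding h(3) c(1) sym_self c(2) by (simp add: fun_eq_iff)
    then show False using u by simp
  next
    case False
    obtain e where e: "e \<in> U2 x y" "e \<noteq> 0" "b e e = 0" "\<forall>u\<in>W2 x y. u e = 0" using IH[OF xy False] by blast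
    have eU: "e \<in> U" "b x e = 0" "b y e = 0" using e by (auto simp: U2_def)
    have ex: "b e x = 0" using eU b_eq_0_comm by blast
    have yx: "b y x = 1" using y(2) b_comm[of y x] by (simp del: st_b)
    have e_line: "e \<notin> range (\<lambda>c. scale c x)"
    proof
      assume "e \<in> range (\<lambda>c. scale c x)"
      then obtain c where "e = scale c x" by blast
      then show False using eU(3) yx e(2) by simp
    qed
    \<comment> \<open>The choice g = \<open>scale tau e\<close> makes the leading tensor the
      rank-one map of e, so the lift has rank at most three.\<close>
    obtain h where h: "h \<in> U" "b x h = 0" "sym_tensor e (scale tau e) + sym_tensor x h \<in> W"
      using lift_sym[OF xy e, of "scale tau e"] eU e(3) U(1) subspace_scale by fastforce
    define r where "r = sym_tensor e (scale tau e) + sym_tensor x h"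
    have rW: "r \<in> W" using h r_def by simp
    have r: "r z = scale (b e z) e + scale (b h z) x + scale (b x z) h" for z
      unfolding r_def sym_tau by (simp add: sym_tensor_def algebra_simps)
    have hx: "b h x = 0" using h b_eq_0_comm by blast
    \<comment> \<open>These are the coefficients of s in E2, of s in E1 and of s^2 in E2. By
      \<open>rank3_zero\<close> they vanish: the x row of the matrix has constant terms zero, and
      under the extra hypotheses all entries do.\<close>
    have coeffs: "b e (v x) * b h e + b e h * b x (v e) + b h h * b x (v x) = 0"
      "b e h = 0 \<Longrightarrow> b h e = 0 \<Longrightarrow> b h h = 0 \<Longrightarrow> b e (v e) + b h (v x) + b x (v h) = 0"
      "b e h = 0 \<Longrightarrow> b h e = 0 \<Longrightarrow> b h h = 0 \<Longrightarrow>
        b e (v e) * b h (v x) - b e (v x) * b h (v e) + (b e (v e) * b x (v h) - b e (v h) * b x (v e))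
          + (b h (v x) * b x (v h) - b h (v h) * b x (v x)) = 0"
      if v: "v \<in> W" for v
    proof -
      note c = coeff_qpoly[OF W_H[OF v] W_nil[OF v]]
      note I = rank3_zero[OF v rW r refl]
      have "b e (v x) * b h e + b e h * b x (v e) + b h h * b x (v x) = 0 - coeff (qpoly v e e * qpoly v h x - qpoly v e x * qpoly v h e +
             (qpoly v e e * qpoly v x h - qpoly v e h * qpoly v x e) + (qpoly v h x * qpoly v x h - qpoly v h h * qpoly v x x)) 1"
        using x h(2) hx eU ex e(3) by (simp add: c coeff_mult)
      also have "\<dots> = 0" unfolding I(2) using x h(2) hx eU ex e(3) by (simp add: c coeff_mult_0)
      finally show "b e (v x) * b h e + b e h * b x (v e) + b h h * b x (v x) = 0" .
      show "b e (v e) + b h (v x) + b x (v h) = 0"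
        using arg_cong[OF I(1), of "\<lambda>p. coeff p 1"] by (simp add: c)
      assume z: "b e h = 0" "b h e = 0" "b h h = 0"
      have "b e (v e) * b h (v x) - b e (v x) * b h (v e) + (b e (v e) * b x (v h) - b e (v h) * b x (v e))
          + (b h (v x) * b x (v h) - b h (v h) * b x (v x)) = coeff (qpoly v e e * qpoly v h x - qpoly v e x * qpoly v h e +
             (qpoly v e e * qpoly v x h - qpoly v e h * qpoly v x e) + (qpoly v h x * qpoly v x h - qpoly v h h * qpoly v x x)) 2"
        using x h(2) hx eU ex e(3) z by (simp add: c coeff_mult numeral_2_eq_2)
      also have "\<dots> = 0" unfolding I(2)
        using x h(2) hx eU ex e(3) z by (simp add: c coeff_mult numeral_2_eq_2)
      finally show "b e (v e) * b h (v x) - b e (v x) * b h (v e) + (b e (v e) * b x (v h) - b e (v h) * b x (v e))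
          + (b h (v x) * b x (v h) - b h (v h) * b x (v x)) = 0" .
    qed
    have line: "subspace (range (\<lambda>c. scale c x))" "range (\<lambda>c. scale c x) \<subseteq> U"
      using subspace_line x U(1) subspace_scale by blast+
    have ex_v: "\<exists>v\<in>W. b x (v x) = 0 \<and> b e (v x) = c" for c
    proof -
      obtain z where z: "z \<in> U" "\<forall>s\<in>range (\<lambda>c. scale c x). b s z = 0" "b e z = c"
        using ex_dual[OF line eU(1) e_line] by blast
      have "b (scale 1 x) z = 0" using z(2) by blast
      then have xz: "b x z = 0" by simp
      then obtain v where "v \<in> W" "\<forall>g. b g x = 0 \<longrightarrow> b g (v x) = b g z"
        using no_Phi_values[OF none iso z(1)] by (auto simp: K_iff)
      then show ?thesis using x ex xz z(3) by (intro bexI[of _ v]) auto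
    qed
    have st_flip: "b p (v q) = st (b q (v p))" if "v \<in> W" for p q v using b_st_adj[OF W_H[OF that]] .
    have he: "b h e = 0"
    proof (rule ccontr)
      assume ne: "b h e \<noteq> 0"
      \<comment> \<open>The value is chosen so that the first identity would say that
        \<open>tau\<close> has trace zero.\<close>
      obtain v where v: "v \<in> W" "b x (v x) = 0" "b e (v x) = tau / b h e" using ex_v by blast
      have "b x (v e) = st tau / b e h" using st_flip[OF v(1), of x e] v(3) by simp
      moreover have "b e h \<noteq> 0" using ne b_eq_0_comm by blast
      ultimately have "b e (v x) * b h e + b e h * b x (v e) + b h h * b x (v x) = tau + st tau" using v ne by simp
      then show False using coeffs(1)[OF v(1)] tau by simp
    qed
    then have eh: "b e h = 0" using b_eq_0_comm by blast
    have hh: "b h h = 0"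
    proof -
      obtain z where z: "z \<in> U" "b x z = 1" using xy by blast
      then obtain v where v: "v \<in> W" "\<forall>g. b g x = 0 \<longrightarrow> b g (v x) = b g z"
        using no_Phi_values[OF none iso z(1)] by (auto simp: K_iff)
      have "b x (v x) = 1" using v x z by simp
      then show ?thesis using coeffs(1)[OF v(1)] he eh by simp
    qed
    let ?S = "{s + scale c e | s c. s \<in> range (\<lambda>c. scale c x)}"
    have S: "subspace ?S" "?S \<subseteq> U"
      using subspace_insert_line[OF line(1)] x(1) eU(1) U(1) by (auto intro!: subspace_add subspace_scale)
    have "scale 1 x + scale 0 e \<in> ?S" "scale 0 x + scale 1 e \<in> ?S" by blast+
    then have xeS: "x \<in> ?S" "e \<in> ?S" by simp_all
    have "h \<in> ?S"
    proof (rule ccontr)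
      assume "h \<notin> ?S"
      \<comment> \<open>The trace-zero value \<open>jj\<close> cancels in the second identity, which
        leaves b(e, v e) = 0; the third then reads \<open>jj * st jj = 0\<close>.\<close>
      then obtain z where z: "z \<in> U" "\<forall>s\<in>?S. b s z = 0" "b h z = jj" using ex_dual[OF S h(1)] by blast
      have z0: "b x z = 0" "b e z = 0" using z(2) xeS by blast+
      then obtain v where v: "v \<in> W" "\<forall>g. b g x = 0 \<longrightarrow> b g (v x) = b g z"
        using no_Phi_values[OF none iso z(1)] by (auto simp: K_iff)
      have 1: "b x (v x) = 0" "b e (v x) = 0" "b h (v x) = jj" using v(2) x ex hx z0 z(3) by simp_all
      have 2: "b x (v e) = 0" "b x (v h) = st jj" 
        using st_flip[OF v(1), of x e] st_flip[OF v(1), of x h] unfolding 1 by simp_all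
      have "b e (v e) = 0" using coeffs(2)[OF v(1) eh he hh] 1 2 jj(2) by (simp add: add.assoc)
      then have "jj * st jj = 0" using coeffs(3)[OF v(1) eh he hh] 1 2 by simp
      then show False using jj(1) by simp
    qed
    then obtain \<mu> l where hl: "h = scale \<mu> x + scale l e" by blast
    obtain v where v: "v \<in> W" "b x (v x) = 0" "b e (v x) = 1" using ex_v by blast
    have xe: "b x (v e) = 1" using st_flip[OF v(1), of x e] v(3) by simp
    note vs = H_simps[OF W_H[OF v(1)]]
    \<comment> \<open>Exactly the condition under which r becomes the rank-one map of e + st(l)
      x.\<close>
    have tr: "l * st l = \<mu> + st \<mu>"
      using coeffs(3)[OF v(1) eh he hh] v xe by (simp add: hl vs algebra_simps)
    define e' where "e' = e + scale (st l) x"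
    have "r = (\<lambda>z. scale (b e' z) e')"
    proof
      fix z
      have "r z = scale (b e z) e + scale (st l * b e z) x + scale (l * b x z) e + scale ((\<mu> + st \<mu>) * b x z) x"
        unfolding r hl by (simp add: algebra_simps)
      also have "\<dots> = scale (b e' z) e'" unfolding tr[symmetric] by (simp add: e'_def algebra_simps)
      finally show "r z = scale (b e' z) e'" .
    qed
    moreover have "iso e'"
    proof -
      have "e' \<noteq> 0"
      proof
        assume "e' = 0"
        then have "e = scale (- st l) x" by (simp add: e'_def eq_neg_iff_add_eq_0)
        then show False using e_line by blast
      qed
      moreover have "e' \<in> U" using eU x U(1) by (simp add: e'_def subspace_add subspace_scale)
      moreover have "b e' e' = 0" using e(3) ex eU(2) x by (simp add: e'_def)
      ultimately show ?thesis by (simp add: iso_def)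
    qed
    ultimately have "e' \<in> Phi" using Phi_tensor_I rW by simp
    then show False using none by simp
  qed
qed

text \<open>If W moves x, the kernel vector e of the reduced space lies in P x, and some z = e - p x
  has all its images under W in the plane of x and e. Either W kills z, or W kills a nonzero image
  of z.\<close>

lemma Phi_imp_kernel_vector:
  assumes x: "x \<in> Phi"
    and IH: "\<And>x y. x \<in> U \<Longrightarrow> y \<in> U \<Longrightarrow> b x x = 0 \<Longrightarrow> b x y = 1 \<Longrightarrow> m \<noteq> 1 \<Longrightarrow>
        \<exists>z\<in>U2 x y. z \<noteq> 0 \<and> b z z = 0 \<and> (\<forall>u\<in>W2 x y. u z = 0)"
  shows "\<exists>z. iso z \<and> (\<forall>u\<in>W. u z = 0)"
proof (cases "\<forall>u\<in>W. u x = 0")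
  case True
  then show ?thesis using Phi_iso[OF x] by blast
next
  case False
  then obtain v0 where v0: "v0 \<in> W" "v0 x \<noteq> 0" by blast
  have isox: "iso x" using Phi_iso[OF x] .
  then have xU: "x \<in> U" "b x x = 0" "x \<noteq> 0" by (auto simp: iso_def)
  obtain y where y: "y \<in> U" "b x y = 1" using ex_partner xU by blast
  note xy = xU(1) y(1) xU(2) y(2)
  have yx: "b y x = 1" using y(2) b_comm[of y x] by (simp del: st_b)
  note subP = subspace_P[OF x]
  have xP: "scale c x \<in> P x" "x \<in> P x" for c using x_in_P[of _ x] x_in_P[of 1 x] by simp_all
  \<comment> \<open>For m = 1, P x would be a totally singular F-subspace of K-dimension greater
    than 2.\<close>
  have "m \<noteq> 1"
  proof
    assume m: "m = 1"
    obtain a where a: "kv.kd (Wx x) a" using kv.kd_subset_exists[OF U(3) ksub_Wx Wx_subset_U] by blast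
    have "v0 x \<in> Wx x" using v0 by (simp add: Wx_def)
    then have "Wx x \<noteq> {0}" using v0(2) by blast
    then have "a \<noteq> 0" using a kv.kd_0_iff[of "Wx x"] by metis
    moreover have "a + 2 \<le> 2 * m"
      by (rule witt_leD[OF witt subP P_subset_U[OF xU(1)] _ kd_P[OF xU(3) a]]) (use P_singular[OF x] in blast)
    ultimately show False using m by simp
  qed
  then obtain e where e: "e \<in> U2 x y" "e \<noteq> 0" "b e e = 0" "\<forall>u\<in>W2 x y. u e = 0" using IH[OF xy] by blast
  have eU: "e \<in> U" "b x e = 0" "b y e = 0" using e by (auto simp: U2_def)
  have ex: "b e x = 0" using eU b_eq_0_comm by blast
  let ?S = "{s + scale c e | s c. s \<in> range (\<lambda>c. scale c x)}"
  have S: "subspace ?S" "?S \<subseteq> U"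
    using subspace_insert_line[OF subspace_line] xU(1) eU(1) U(1) by (auto intro!: subspace_add subspace_scale)
  have "scale 1 x + scale 0 e \<in> ?S" "scale 0 x + scale 1 e \<in> ?S" by blast+
  then have xeS: "x \<in> ?S" "e \<in> ?S" by simp_all
  have memS: "q \<in> ?S" if q: "q \<in> U" "\<And>g. g \<in> U \<Longrightarrow> b x g = 0 \<Longrightarrow> b e g = 0 \<Longrightarrow> b g q = 0" for q
    by (rule mem_subspace_by_perp[OF U(3,1,2) S q(1)]) (use q(2) xeS in blast)
  have lift: "\<exists>h\<in>U. b x h = 0 \<and> sym_tensor e g + sym_tensor x h \<in> W" if "g \<in> U" "b x g = 0" "b e g = 0" for g
    by (rule lift_sym[OF xy e that])
  have stable: "c q \<in> P x" if c: "c \<in> W" "c x = 0" and q: "q \<in> P x" for c q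
  proof -
    obtain u d where u: "u \<in> W" "q = u x + scale d x" using q by (rule P_E)
    have "c (u x) + u (c x) \<in> P x" by (rule jordan_in_P[OF isox c(1) u(1)])
    then show ?thesis using u c by (simp add: H_simps[OF W_H])
  qed
  \<comment> \<open>The operator lifted from e and g kills x, hence preserves P x. Its part coming
    from h only adds multiples of x, since x is orthogonal to P x.\<close>
  have gP: "scale (b e q) g + scale (b g q) e \<in> P x" if g: "g \<in> U" "b x g = 0" "b e g = 0" and q: "q \<in> P x" for g q
  proof -
    obtain h where h: "h \<in> U" "b x h = 0" "sym_tensor e g + sym_tensor x h \<in> W" using lift[OF g] by blast
    have "b g x = 0" "b h x = 0" using g h b_eq_0_comm by blast+
    then have "(sym_tensor e g + sym_tensor x h) x = 0" using ex xU by (simp add: sym_tensor_def)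
    then have "(sym_tensor e g + sym_tensor x h) q \<in> P x" using stable[OF h(3) _ q] by blast
    then have "(sym_tensor e g + sym_tensor x h) q - scale (b h q) x \<in> P x" using xP(1) subspace_diff[OF subP] by blast
    moreover have "b x q = 0" using P_singular[OF x xP(2) q] .
    ultimately show ?thesis by (simp add: sym_tensor_def)
  qed
  have line_P: "c = 0" if "scale c e \<in> P x" "e \<notin> P x" for c
  proof (rule ccontr)
    assume "c \<noteq> 0"
    then have "scale (inverse c) (scale c e) = e" by simp
    then show False using that subspace_scale[OF subP] by metis
  qed
  \<comment> \<open>Otherwise \<open>gP\<close> confines P x to the line Fx; then
    \<open>v0 x\<close> is a multiple of x, and nilpotency makes it zero.\<close>
  have eP: "e \<in> P x"
  proof (rule ccontr)
    assume ne: "e \<notin> P x"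
    have 1: "b e q = 0" if q: "q \<in> P x" for q
    proof -
      have "scale (b e q) (scale tau e) + scale (b (scale tau e) q) e \<in> P x"
        by (rule gP[OF _ _ _ q]) (use eU e(3) U(1) subspace_scale in auto)
      then have "scale ((tau + st tau) * b e q) e \<in> P x" by (simp add: algebra_simps)
      then show ?thesis using line_P[OF _ ne] tau by simp
    qed
    have 2: "q \<in> range (\<lambda>c. scale c x)" if q: "q \<in> P x" for q
    proof -
      have "q \<in> ?S"
      proof (rule memS)
        show "q \<in> U" using q P_subset_U[OF xU(1)] by blast
        fix g assume g: "g \<in> U" "b x g = 0" "b e g = 0"
        have "scale (b g q) e \<in> P x" using gP[OF g q] 1[OF q] by simp
        then show "b g q = 0" using line_P ne by blast
      qed
      then obtain a c where q': "q = scale a x + scale c e" by blast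
      then have "scale c e = q - scale a x" by simp
      then have "scale c e \<in> P x" using subspace_diff[OF subP q xP(1)] by simp
      then have "c = 0" using line_P ne by blast
      then show ?thesis using q' by auto
    qed
    obtain c where c: "v0 x = scale c x" using 2[OF P_I0[OF v0(1)]] by blast
    then have "c = 0" using nilpotent_no_eigenvalue[OF W_H[OF v0(1)] W_nil[OF v0(1)] c xU(3)] by simp
    then show False using c v0 by simp
  qed
  have ePhi: "e \<in> Phi" by (rule P_subset_Phi[OF x eP e(2)])
  have eL: "e \<in> L x" using P_subset_L[OF x] eP by blast
  \<comment> \<open>On the orbits of \<open>e\<close> and \<open>x\<close> the lifted operator acts with rank two, which makes \<open>a e\<close> and \<open>a x\<close> proportional against \<open>g\<close>.\<close>
  have ratio: "\<exists>p. \<forall>a\<in>W. b g (a e) = p * b g (a x)" if g: "g \<in> U" "b x g = 0" "b e g = 0" for g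
  proof -
    obtain h where h: "h \<in> U" "b x h = 0" "sym_tensor e g + sym_tensor x h \<in> W" using lift[OF g] by blast
    have gx: "b g x = 0" "b h x = 0" "b g e = 0" using g h b_eq_0_comm by blast+
    have r: "(sym_tensor e g + sym_tensor x h) ((w ^^ k) z) = scale (b g ((w ^^ k) z)) e + scale (b h ((w ^^ k) z)) x"
      if w: "w \<in> W" and z: "z \<in> {e, x}" for w k z
    proof -
      have "b x ((w ^^ k) e) = b ((w ^^ k) x) e" using H_adj[OF H_power[OF W_H[OF w]]] by simp
      also have "\<dots> = 0" using Phi_L_power[OF x eL w] b_eq_0_comm by blast
      finally have "b x ((w ^^ k) z) = 0" "b e ((w ^^ k) z) = 0"
        using z Phi_power[OF x w] Phi_power[OF ePhi w] Phi_L_power[OF x eL w] by auto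
      then show ?thesis by (simp add: sym_tensor_def)
    qed
    have q: "b g (a e) * b g (a e) + b g (a x) * b h (a e) = 0" if a: "a \<in> W" for a
    proof -
      have id: "qpoly c g e + qpoly c h x = 0" "qpoly c g e * qpoly c h x - qpoly c g x * qpoly c h e = 0" if "c \<in> W" for c
        by (rule rank2_zero[OF that h(3) t0 r refl]; assumption)+
      note c = coeff_qpoly[OF W_H W_nil]
      have 1: "b g (a e) + b h (a x) = 0" using arg_cong[OF id(1)[OF a], of "\<lambda>p. coeff p 1"] by (simp add: c[OF a a])
      have 2: "b g (c x) * b h e = 0" if "c \<in> W" for c
        using arg_cong[OF id(2)[OF that], of "\<lambda>p. coeff p 1"] gx by (simp add: coeff_qpoly[OF W_H[OF that] W_nil[OF that]] coeff_mult)
      have 3: "b g (a e) * b h (a x) - (b g (a x) * b h (a e) + b g (a (a x)) * b h e) = 0"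
        using arg_cong[OF id(2)[OF a], of "\<lambda>p. coeff p 2"] gx by (simp add: c[OF a a] coeff_mult numeral_2_eq_2)
      \<comment> \<open>By \<open>square_in_P\<close>, a(a x) is a value v x modulo Fx, and g is
        orthogonal to x, so 2 applies to v.\<close>
      have 4: "b g (a (a x)) * b h e = 0"
      proof (cases "b h e = 0")
        case False
        obtain v d where "v \<in> W" "a (a x) = v x + scale d x" using square_in_P[OF isox a] by (rule P_E)
        then show ?thesis using 2[of v] False gx by simp
      qed simp
      have "b h (a x) = - b g (a e)" using 1 by (simp add: eq_neg_iff_add_eq_0 add.commute)
      then have "b g (a e) * b g (a e) + b g (a x) * b h (a e) = - (b g (a e) * b h (a x) - (b g (a x) * b h (a e) + b g (a (a x)) * b h e))"
        using 4 by simp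
      then show ?thesis using 3 by simp
    qed
    show ?thesis
    proof (cases "\<forall>a\<in>W. b g (a x) = 0")
      case True
      then show ?thesis using q by (intro exI[of _ 0]) simp
    next
      case False
      then obtain a1 where a1: "a1 \<in> W" "b g (a1 x) \<noteq> 0" by blast
      \<comment> \<open>\<open>quadratic_vanishing\<close> wants its middle function to be zero at
        \<open>a1\<close>, hence the shift by p times the first one. The third function below is the
        one for which the quadratic identity survives this shift.\<close>
      define p where "p = b g (a1 e) / b g (a1 x)"
      have "b g (a e) - p * b g (a x) = 0" if a: "a \<in> W" for a
      proof (rule quadratic_vanishing(1)[of "\<lambda>a. b g (a x)" "\<lambda>a. b g (a e) - p * b g (a x)"
            "\<lambda>a. 2 * p * (b g (a e) - p * b g (a x)) + p * p * b g (a x) + b h (a e)", OF _ _ _ _ a1(1) _ a1(2) a])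
        show "b g (a1 e) - p * b g (a1 x) = 0" using a1 by (simp add: p_def)
        fix u assume u: "u \<in> W"
        have "(\<beta> - p * \<alpha>) * (\<beta> - p * \<alpha>) + \<alpha> * (2 * p * (\<beta> - p * \<alpha>) + p * p * \<alpha> + \<gamma>) = \<beta> * \<beta> + \<alpha> * \<gamma>" for \<alpha> \<beta> \<gamma> :: 'a
          by (simp add: algebra_simps)
        then show "(b g (u e) - p * b g (u x)) * (b g (u e) - p * b g (u x)) +
            b g (u x) * (2 * p * (b g (u e) - p * b g (u x)) + p * p * b g (u x) + b h (u e)) = 0" using q[OF u] by simp
      qed (simp_all add: algebra_simps)
      then show ?thesis by (intro exI[of _ p]) simp
    qed
  qed
  have "\<exists>p. \<forall>g\<in>U. b x g = 0 \<longrightarrow> b e g = 0 \<longrightarrow> (\<forall>a\<in>W. b g (a e) = p * b g (a x))"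
  proof (cases "\<exists>g0\<in>U. b x g0 = 0 \<and> b e g0 = 0 \<and> (\<exists>a\<in>W. b g0 (a x) \<noteq> 0)")
    case False
    have "b g (a e) = 0 * b g (a x)" if g: "g \<in> U" "b x g = 0" "b e g = 0" and a: "a \<in> W" for g a
    proof -
      obtain p where "\<forall>a\<in>W. b g (a e) = p * b g (a x)" using ratio[OF g] by blast
      then show ?thesis using a False g by simp
    qed
    then show ?thesis by blast
  next
    case True
    then obtain g0 a0 where g0: "g0 \<in> U" "b x g0 = 0" "b e g0 = 0" and a0: "a0 \<in> W" "b g0 (a0 x) \<noteq> 0" by blast
    obtain p where p: "\<forall>a\<in>W. b g0 (a e) = p * b g0 (a x)" using ratio[OF g0] by blast
    have "b g (a e) = p * b g (a x)" if g: "g \<in> U" "b x g = 0" "b e g = 0" and a: "a \<in> W" for g a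
    proof -
      \<comment> \<open>Subtracting this multiple of \<open>g0\<close> makes \<open>g1\<close>
        vanish on \<open>a0 x\<close>. Evaluation at \<open>a0\<close> then shows that
        \<open>g1 + g0\<close> has ratio p, so \<open>g1\<close> satisfies the relation with p, and
        so does g.\<close>
      define c where "c = st (b g (a0 x) / b g0 (a0 x))"
      define g1 where "g1 = g - scale c g0"
      have g1: "g1 \<in> U" "b x g1 = 0" "b e g1 = 0" using g g0 U(1) by (simp_all add: g1_def subspace_diff subspace_scale)
      have g1a0: "b g1 (a0 x) = 0" using a0 by (simp add: g1_def c_def del: st_b)
      have g2: "g1 + g0 \<in> U" "b x (g1 + g0) = 0" "b e (g1 + g0) = 0" using g1 g0 U(1) by (simp_all add: subspace_add)
      obtain p1 where p1: "\<forall>a\<in>W. b g1 (a e) = p1 * b g1 (a x)" using ratio[OF g1] by blast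
      obtain p2 where p2: "\<forall>a\<in>W. b (g1 + g0) (a e) = p2 * b (g1 + g0) (a x)" using ratio[OF g2] by blast
      have "p * b g0 (a0 x) = p2 * b g0 (a0 x)" using bspec[OF p a0(1)] bspec[OF p1 a0(1)] bspec[OF p2 a0(1)] g1a0 by simp
      then have "p2 = p" using a0 by simp
      then have "b g1 (a e) = p * b g1 (a x)" using bspec[OF p a] bspec[OF p2 a] by (simp add: algebra_simps)
      moreover have "b g (a v) = b g1 (a v) + st c * b g0 (a v)" for v by (simp add: g1_def)
      ultimately show ?thesis using bspec[OF p a] by (simp add: algebra_simps)
    qed
    then show ?thesis by blast
  qed
  then obtain p where p: "\<And>g a. g \<in> U \<Longrightarrow> b x g = 0 \<Longrightarrow> b e g = 0 \<Longrightarrow> a \<in> W \<Longrightarrow> b g (a e) = p * b g (a x)" by blast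
  \<comment> \<open>The common ratio p makes each a z orthogonal to all g orthogonal to x and e,
    which puts it into the plane of x and e.\<close>
  define z where "z = e - scale p x"
  have ez: "e = z + scale p x" by (simp add: z_def)
  have zP: "z \<in> P x" unfolding z_def using subspace_diff[OF subP eP xP(1)] .
  have z0: "z \<noteq> 0"
  proof
    assume "z = 0"
    then have "e = scale p x" using ez by simp
    then show False using eU(3) yx e(2) by simp
  qed
  have zPhi: "z \<in> Phi" by (rule P_subset_Phi[OF x zP z0])
  have isoz: "iso z" using Phi_iso[OF zPhi] .
  have zS: "z \<in> ?S" unfolding z_def using subspace_diff[OF S(1) xeS(2) subspace_scale[OF S(1) xeS(1)]] .
  have azS: "a z \<in> ?S" if a: "a \<in> W" for a
  proof (rule memS[OF W_range[OF a]])
    fix g assume "g \<in> U" "b x g = 0" "b e g = 0"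
    then show "b g (a z) = 0" using p[OF _ _ _ a] by (simp add: z_def H_simps[OF W_H[OF a]])
  qed
  have PzS: "P z \<subseteq> ?S"
  proof
    fix q assume "q \<in> P z"
    then obtain u c where u: "u \<in> W" "q = u z + scale c z" by (rule P_E)
    show "q \<in> ?S" unfolding u(2) by (rule subspace_add[OF S(1) azS[OF u(1)] subspace_scale[OF S(1) zS]])
  qed
  show ?thesis
  proof (cases "\<forall>a\<in>W. a z = 0")
    case True
    then show ?thesis using isoz by blast
  next
    case False
    then obtain a0 where a0: "a0 \<in> W" "a0 z \<noteq> 0" by blast
    define x' where "x' = a0 z"
    have x'P: "x' \<in> P z" unfolding x'_def by (rule P_I0[OF a0(1)])
    obtain s c where "x' = scale s x + scale c e" using PzS x'P by blast
    then obtain \<alpha> where x': "x' = scale \<alpha> x + scale c z" by (intro that[of "s + c * p"]) (simp add: ez algebra_simps)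
    have \<alpha>: "\<alpha> \<noteq> 0"
    proof
      assume "\<alpha> = 0"
      then have eig: "a0 z = scale c z" using x' by (simp add: x'_def)
      then have "c = 0" by (rule nilpotent_no_eigenvalue[OF W_H[OF a0(1)] W_nil[OF a0(1)] _ z0])
      then show False using eig a0 by simp
    qed
    have dec: "\<exists>l k. v = scale l x' + scale k z" if v: "v \<in> ?S" for v
    proof -
      obtain s2 c2 where "v = scale s2 x + scale c2 e" using v by blast
      then have "v = scale (s2 + c2 * p) x + scale c2 z" by (simp add: ez algebra_simps)
      moreover have "x = scale (inverse \<alpha>) x' - scale (inverse \<alpha> * c) z" using \<alpha> by (simp add: x' algebra_simps)
      ultimately have "v = scale (s2 + c2 * p) (scale (inverse \<alpha>) x' - scale (inverse \<alpha> * c) z) + scale c2 z" by simp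
      also have "\<dots> = scale ((s2 + c2 * p) * inverse \<alpha>) x' + scale (c2 - (s2 + c2 * p) * inverse \<alpha> * c) z"
        by (simp add: algebra_simps)
      finally have "v = scale ((s2 + c2 * p) * inverse \<alpha>) x' + scale (c2 - (s2 + c2 * p) * inverse \<alpha> * c) z" .
      then show ?thesis by blast
    qed
    have indep: "l = 0 \<and> k = 0" if lk: "scale l x' + scale k z = 0" for l k
    proof -
      have "l = 0"
      proof (rule ccontr)
        assume "l \<noteq> 0"
        have "scale l x' = scale (- k) z" using lk by (simp add: eq_neg_iff_add_eq_0)
        then have "scale (inverse l) (scale l x') = scale (inverse l) (scale (- k) z)" by simp
        then have eig: "a0 z = scale (inverse l * - k) z" using \<open>l \<noteq> 0\<close> by (simp add: x'_def)
        then have "inverse l * - k = 0" by (rule nilpotent_no_eigenvalue[OF W_H[OF a0(1)] W_nil[OF a0(1)] _ z0])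
        then show False using eig a0 by simp
      qed
      then show ?thesis using lk z0 by simp
    qed
    note subPz = subspace_P[OF zPhi]
    have a0x': "a0 x' \<in> P z" unfolding x'_def by (rule square_in_P[OF isoz a0(1)])
    \<comment> \<open>The Jordan product of a and \<open>a0\<close> at z gives a x' up to
      \<open>a0 (a z)\<close>, which lies in P z because a z is a combination of x' and z.\<close>
    have ax'P: "a x' \<in> P z" if a: "a \<in> W" for a
    proof -
      obtain l k where lk: "a z = scale l x' + scale k z" using dec[OF azS[OF a]] by blast
      have "a0 (a z) = scale l (a0 x') + scale k x'" by (simp add: lk H_simps[OF W_H[OF a0(1)]]) (simp add: x'_def)
      also have "\<dots> \<in> P z" using a0x' x'P subspace_add[OF subPz] subspace_scale[OF subPz] by blast
      finally have 1: "a0 (a z) \<in> P z" .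
      have "a x' + a0 (a z) \<in> P z" unfolding x'_def by (rule jordan_in_P[OF isoz a a0(1)])
      then have "a x' + a0 (a z) - a0 (a z) \<in> P z" using subspace_diff[OF subPz _ 1] by blast
      then show ?thesis by simp
    qed
    have "a x' = 0" if a: "a \<in> W" for a
    proof -
      obtain \<rho> \<sigma> where 0: "a0 x' = scale \<rho> x' + scale \<sigma> z" using dec PzS a0x' by blast
      have "a0 z = scale 1 x' + scale 0 z" by (simp add: x'_def)
      from nilpotent_plane[OF W_H[OF a0(1)] W_nil[OF a0(1)] 0 this indep]
      have "\<rho> = 0" "\<sigma> = 0" by auto
      then have a00: "a0 x' = 0" using 0 by simp
      obtain l1 k1 where 1: "a x' = scale l1 x' + scale k1 z" using dec PzS ax'P[OF a] by blast
      obtain l k where 2: "a z = scale l x' + scale k z" using dec[OF azS[OF a]] by blast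
      \<comment> \<open>As \<open>a0\<close> kills x', adding it changes a single matrix entry. Both
        determinants vanish, which forces \<open>k1 = 0\<close>; trace and determinant then give
        \<open>l1 = 0\<close>.\<close>
      have 3: "(a + a0) x' = scale l1 x' + scale k1 z" "(a + a0) z = scale (l + 1) x' + scale k z"
        using 1 2 a00 by (simp_all add: scale_left_distrib x'_def)
      note n1 = nilpotent_plane[OF W_H[OF a] W_nil[OF a] 1 2 indep]
      note n2 = nilpotent_plane[OF W_H[OF W_add[OF a a0(1)]] W_nil[OF W_add[OF a a0(1)]] 3 indep]
      have "k1 = 0" using n1(2) n2(2) by (simp add: algebra_simps)
      moreover have "k = - l1" using n1(1) by (simp add: eq_neg_iff_add_eq_0 add.commute)
      ultimately have "l1 = 0" using n1(2) by simp
      then show ?thesis using 1 \<open>k1 = 0\<close> by simp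
    qed
    moreover have "iso x'" using Phi_iso[OF P_subset_Phi[OF zPhi x'P]] a0 by (simp add: x'_def)
    ultimately show ?thesis by blast
  qed
qed

end

lemma (in hermitian_space) max_space_kernel_vector:
  assumes "max_space scale st b U W N t0 m" "m \<noteq> 0"
  shows "\<exists>z\<in>U. z \<noteq> 0 \<and> b z z = 0 \<and> (\<forall>u\<in>W. u z = 0)"
  using assms
proof (induction m arbitrary: U W N)
  case 0
  then show ?case by simp
next
  case (Suc m)
  interpret max_space scale st b U W N t0 "Suc m" by (rule Suc.prems(1))
  have IH: "\<exists>z\<in>U2 x y. z \<noteq> 0 \<and> b z z = 0 \<and> (\<forall>u\<in>W2 x y. u z = 0)"
    if xy: "x \<in> U" "y \<in> U" "b x x = 0" "b x y = 1" and ne: "Suc m \<noteq> 1" for x y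
  proof -
    have "max_space scale st b (U2 x y) (W2 x y) (N - 4) t0 m" using max_reduction(2)[OF xy] by auto
    then show ?thesis using Suc.IH ne by simp
  qed
  obtain x where "x \<in> Phi" using Phi_nonempty[OF _ IH] by blast
  then obtain z where "iso z" "\<forall>u\<in>W. u z = 0" using Phi_imp_kernel_vector[OF _ IH] by blast
  then show ?case by (auto simp: iso_def)
qed

section \<open>The singular flag\<close>

context hermitian_space
begin

definition flag_in :: "'v set \<Rightarrow> nat \<Rightarrow> (nat \<Rightarrow> 'v set) \<Rightarrow> bool" where
  "flag_in U m Fl \<longleftrightarrow> (\<forall>i\<le>m. subspace (Fl i) \<and> Fl i \<subseteq> U \<and> kv.kd (Fl i) (2 * i)) \<and> (\<forall>i<m. Fl i \<subseteq> Fl (Suc i))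
    \<and> (\<forall>v\<in>Fl m. \<forall>w\<in>Fl m. b v w = 0)"

definition flag_endos :: "'v set \<Rightarrow> nat \<Rightarrow> (nat \<Rightarrow> 'v set) \<Rightarrow> ('v \<Rightarrow> 'v) set" where
  "flag_endos U m Fl = {u\<in>H. range u \<subseteq> U \<and> nilpotent_endo u \<and> (\<forall>i\<le>m. u ` Fl i \<subseteq> Fl i)}"

text \<open>The flag is the preimage in z^perp of the flag of the reduced space, for z killed by W.
  Conversely, a nilpotent map preserving it kills z, and its compression lies in \<open>W2\<close>,
  so it differs from an element of W by a tensor of z.\<close>

lemma max_space_flag:
  assumes "max_space scale st b U W N t0 m"
  shows "\<exists>Fl. flag_in U m Fl \<and> W = flag_endos U m Fl"
  using assms
proof (induction m arbitrary: U W N)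
  case 0
  interpret max_space scale st b U W N t0 0 by (rule 0)
  have aniso: "x = 0" if "x \<in> U" "b x x = 0" for x using witt_le_0[OF witt] that .
  have "u = 0" if u: "u \<in> H" "range u \<subseteq> U" "nilpotent_endo u" for u
    using nilpotent_last_power[OF u(1,3)] aniso u(2) by blast
  moreover have "W = {0}" using W_eq_zero aniso by blast
  moreover have "W \<subseteq> {u\<in>H. range u \<subseteq> U \<and> nilpotent_endo u}" using W_H W_nil W_range by blast
  ultimately have W: "W = {u\<in>H. range u \<subseteq> U \<and> nilpotent_endo u}" by blast
  have "W = flag_endos U 0 (\<lambda>i. {0})"
    unfolding W flag_endos_def using H_0 by auto
  moreover have "flag_in U 0 (\<lambda>i. {0})"
    unfolding flag_in_def using subspace_single_0 subspace_0[OF U(1)] kv.kd_zero by auto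
  ultimately show ?case by blast
next
  case (Suc m)
  interpret max_space scale st b U W N t0 "Suc m" by (rule Suc.prems)
  obtain z where z: "z \<in> U" "z \<noteq> 0" "b z z = 0" and Wz: "\<forall>u\<in>W. u z = 0"
    using max_space_kernel_vector[OF Suc.prems Suc_not_Zero] by auto
  obtain y where y: "y \<in> U" "b z y = 1" using ex_partner z by blast
  note zy = z(1) y(1) z(3) y(2)
  have yz: "b y z = 1" using y(2) b_comm[of y z] by (simp del: st_b)
  have max2: "max_space scale st b (U2 z y) (W2 z y) (N - 4) t0 m" using max_reduction(2)[OF zy] by auto
  obtain G where flagG: "flag_in (U2 z y) m G" and GW: "W2 z y = flag_endos (U2 z y) m G"
    using Suc.IH[OF max2] by blast
  have G: "subspace (G i) \<and> G i \<subseteq> U2 z y \<and> kv.kd (G i) (2 * i)" if "i \<le> m" for i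
    using flagG that by (simp add: flag_in_def)
  have Gchain: "G i \<subseteq> G (Suc i)" if "i < m" for i using flagG that by (simp add: flag_in_def)
  have Gsing: "b v w = 0" if "v \<in> G m" "w \<in> G m" for v w using flagG that by (simp add: flag_in_def)
  define Fl where "Fl = (\<lambda>i. case i of 0 \<Rightarrow> {0} | Suc j \<Rightarrow> {s + scale c z | s c. s \<in> G j})"
  have Fl0: "Fl 0 = {0}" and FlS: "Fl (Suc j) = {s + scale c z | s c. s \<in> G j}" for j by (simp_all add: Fl_def)
  have pz: "pr z y z = 0" using zy yz by (simp add: pr_def)
  have Gpr: "pr z y s = s" "b z s = 0" "s \<in> U" if "s \<in> G j" "j \<le> m" for s j
    using G[OF that(2)] that(1) pr_id by (auto simp: U2_def)
  have 1: "subspace (Fl i) \<and> Fl i \<subseteq> U \<and> kv.kd (Fl i) (2 * i)" if i: "i \<le> Suc m" for i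
  proof (cases i)
    case 0
    then show ?thesis using Fl0 subspace_single_0 subspace_0[OF U(1)] kv.kd_zero by simp
  next
    case (Suc j)
    then have j: "j \<le> m" using i by simp
    have "z \<notin> G j" using G[OF j] yz by (auto simp: U2_def)
    then have "kv.kd (Fl i) (2 * i)" unfolding Suc FlS using kd_subspace_insert[of "G j" "2 * j" z] G[OF j] by simp
    moreover have "subspace (Fl i)" unfolding Suc FlS using subspace_insert_line G[OF j] by simp
    moreover have "Fl i \<subseteq> U" unfolding Suc FlS using Gpr(3)[OF _ j] z(1) U(1) by (auto intro!: subspace_add subspace_scale)
    ultimately show ?thesis by simp
  qed
  have 2: "Fl i \<subseteq> Fl (Suc i)" if i: "i < Suc m" for i
  proof (cases i)
    case 0
    then show ?thesis using Fl0 subspace_0 1[of "Suc 0"] by simp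
  next
    case (Suc j)
    then have "G j \<subseteq> G (Suc j)" using Gchain i by simp
    then show ?thesis unfolding Suc FlS by blast
  qed
  have 3: "b v w = 0" if vw: "v \<in> Fl (Suc m)" "w \<in> Fl (Suc m)" for v w
  proof -
    obtain s c s' c' where *: "s \<in> G m" "s' \<in> G m" "v = s + scale c z" "w = s' + scale c' z" using vw unfolding FlS by blast
    have "b z s' = 0" "b s z = 0" using Gpr(2)[OF *(1)] Gpr(2)[OF *(2)] b_eq_0_comm[of z s] by simp_all
    then show ?thesis using Gsing[OF *(1,2)] z(3) by (simp add: *)
  qed
  have 4: "W = flag_endos U (Suc m) Fl"
  proof (intro set_eqI iffI)
    fix u assume u: "u \<in> W"
    have uz: "u z = 0" using Wz u by blast
    have comp: "pr z y \<circ> u \<circ> pr z y \<in> W2 z y" by (rule W2_I[OF u uz])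
    have "u ` Fl i \<subseteq> Fl i" if i: "i \<le> Suc m" for i
    proof (cases i)
      case 0
      then show ?thesis using Fl0 H_0[OF W_H[OF u]] by simp
    next
      case (Suc j)
      then have j: "j \<le> m" using i by simp
      have "u v \<in> Fl (Suc j)" if v: "v \<in> Fl (Suc j)" for v
      proof -
        obtain s c where s: "s \<in> G j" "v = s + scale c z" using v unfolding FlS by blast
        have "(pr z y \<circ> u \<circ> pr z y) s \<in> G j" using comp s(1) j unfolding GW flag_endos_def by blast
        then have "pr z y (u s) \<in> G j" using Gpr(1)[OF s(1) j] by simp
        moreover have "b z (u s) = 0" using H_adj[OF W_H[OF u], of z s] uz by simp
        then have "u s = pr z y (u s) + scale (b y (u s)) z" by (simp add: pr_perp_diff)
        moreover have "u v = u s" using uz by (simp add: s(2) H_simps[OF W_H[OF u]])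
        ultimately show ?thesis unfolding FlS by (metis (mono_tags, lifting) mem_Collect_eq)
      qed
      then show ?thesis using Suc by blast
    qed
    then show "u \<in> flag_endos U (Suc m) Fl" unfolding flag_endos_def using W_H[OF u] W_nil[OF u] W_range[OF u] by auto
  next
    fix u assume "u \<in> flag_endos U (Suc m) Fl"
    then have u: "u \<in> H" "\<And>v. u v \<in> U" "nilpotent_endo u" and st: "\<And>i v. i \<le> Suc m \<Longrightarrow> v \<in> Fl i \<Longrightarrow> u v \<in> Fl i"
      unfolding flag_endos_def by blast+
    have "G 0 = {0}" using G[of 0] by (simp add: kv.kd_0_iff)
    then have Fl1: "Fl (Suc 0) = range (\<lambda>c. scale c z)" unfolding FlS by auto
    have "scale 1 z \<in> Fl (Suc 0)" unfolding Fl1 by blast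
    then have "u z \<in> range (\<lambda>c. scale c z)" using st[of "Suc 0" z] Fl1 by simp
    then obtain c where c: "u z = scale c z" by blast
    then have "c = 0" using nilpotent_no_eigenvalue[OF u(1,3) c z(2)] by simp
    then have uz: "u z = 0" using c by simp
    have "pr z y \<circ> u \<circ> pr z y \<in> W2 z y"
      unfolding GW flag_endos_def
    proof (intro CollectI conjI allI impI)
      show "pr z y \<circ> u \<circ> pr z y \<in> H" by (rule compression_in_H[OF u(1)])
      show "range (pr z y \<circ> u \<circ> pr z y) \<subseteq> U2 z y" using pr_in_U2[OF zy] u(2) by auto
      show "nilpotent_endo (pr z y \<circ> u \<circ> pr z y)" by (rule compression_nilpotent[OF u(1) uz u(3) zy(3,4)])
      fix i assume i: "i \<le> m"
      have "pr z y (u s) \<in> G i" if s: "s \<in> G i" for s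
      proof -
        have "s + scale 0 z \<in> Fl (Suc i)" unfolding FlS using s by blast
        then have "u s \<in> Fl (Suc i)" using st[of "Suc i" s] i by simp
        then obtain s' c' where s': "s' \<in> G i" "u s = s' + scale c' z" unfolding FlS by blast
        then have "pr z y (u s) = s'" using Gpr(1)[OF s'(1) i] pz by (simp add: H_simps[OF pr_in_H])
        then show ?thesis using s' by simp
      qed
      then show "(pr z y \<circ> u \<circ> pr z y) ` G i \<subseteq> G i" using Gpr(1)[OF _ i] by auto
    qed
    then obtain w where w: "w \<in> W" "w z = 0" "pr z y \<circ> u \<circ> pr z y = pr z y \<circ> w \<circ> pr z y" by (rule W2_E)
    define v where "v = u + fscale (- 1) w"
    have "\<exists>h\<in>U. b z h = 0 \<and> v = sym_tensor z h"
    proof (rule compression_kernel[OF zy])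
      show "v \<in> H" unfolding v_def by (intro H_plus H_fscale u(1) W_H[OF w(1)]) (simp add: K_iff)
      show "v x \<in> U" for x using u(2) W_range[OF w(1)] U(1) by (simp add: v_def subspace_diff)
      show "v z = 0" using uz w by (simp add: v_def)
      show "pr z y \<circ> v \<circ> pr z y = 0"
      proof
        fix x
        show "(pr z y \<circ> v \<circ> pr z y) x = 0 x" using fun_cong[OF w(3), of x] by (simp add: v_def H_simps[OF pr_in_H])
      qed
    qed
    then obtain h where h: "h \<in> U" "b z h = 0" "v = sym_tensor z h" by blast
    \<comment> \<open>As W kills z, \<open>P z\<close> is Fz, so by maximality L z contains every h
      orthogonal to z.\<close>
    have "iso z" using z by (simp add: iso_def)
    then have "h \<in> L z"
    proof (rule mem_L[OF _ h(1)])
      fix q assume "q \<in> P z"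
      then obtain w' c' where "w' \<in> W" "q = w' z + scale c' z" by (rule P_E)
      then have "q = scale c' z" using Wz by simp
      then show "btr q h = 0" using h(2) b_eq_0_comm[of z h] by (simp add: btr_def)
    qed
    then have "v + w \<in> W" using h(3) W_add[OF _ w(1)] by (simp add: L_def)
    moreover have "v + w = u" by (simp add: v_def fun_eq_iff)
    ultimately show "u \<in> W" by simp
  qed
  have "flag_in U (Suc m) Fl" unfolding flag_in_def using 1 2 3 by auto
  then show ?case using 4 by blast
qed

section \<open>Passage to the notions of the theorem\<close>

lemma sum_fun_apply: "(sum f S) x = (\<Sum>u\<in>S. f u x)" for f :: "'c \<Rightarrow> 'v \<Rightarrow> 'v"
  by (induction S rule: infinite_finite_induct) simp_all

lemma K_independent_iff: "K_independent K scale S \<longleftrightarrow> kf.kindep S"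
  unfolding K_independent_def kf.kindep_def by (simp add: fun_eq_iff sum_fun_apply)

lemma K_dim_eq: "kf.kd W d \<Longrightarrow> K_dim K scale W = d"
  unfolding K_dim_def K_independent_iff using kf.kd_Max by simp

text \<open>Since \<open>jj\<close> and \<open>tau\<close> span F over K, F has at most |K|^2
  elements.\<close>

lemma ex_K_not_0_1:
  assumes "infinite (UNIV :: 'a set) \<or> card (UNIV :: 'a set) > 4"
  shows "\<exists>t\<in>K. t \<noteq> 0 \<and> t \<noteq> 1"
proof (rule ccontr)
  assume "\<not> ?thesis"
  then have K: "K \<subseteq> {0, 1}" by blast
  then have fin: "finite K" and card: "card K \<le> 2"
    using finite_subset card_mono[of "{0, 1::'a}" K] by auto
  have UNIV: "(UNIV :: 'a set) = (\<lambda>(k, l). k * jj + l * tau) ` (K \<times> K)"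
    using K_decomposition by (auto simp: image_iff)
  have "card (UNIV :: 'a set) \<le> card (K \<times> K)" unfolding UNIV using fin by (intro card_image_le) simp
  also have "\<dots> \<le> 2 * 2" unfolding card_cartesian_product using card by (intro mult_le_mono)
  finally have "card (UNIV :: 'a set) \<le> 4" by simp
  moreover have "finite (UNIV :: 'a set)" unfolding UNIV using fin by simp
  ultimately show False using assms by simp
qed

end

theorem mainTheorem17:
  fixes st :: "'a::field \<Rightarrow> 'a"
    and scale :: "'a \<Rightarrow> 'v::ab_group_add \<Rightarrow> 'v"
    and b :: "'v \<Rightarrow> 'v \<Rightarrow> 'a"
    and W :: "('v \<Rightarrow> 'v) set"
    and n :: nat
  assumes inv: "field_involution st" and nonid: "\<exists>x. st x \<noteq> x"
    and vs: "vector_space scale"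
    and fin: "\<exists>B. finite B \<and> module.span scale B = UNIV"
    and n_def: "n = vector_space.dim scale (UNIV :: 'v set)"
    and sesq: "sesquilinear st scale b" and herm: "hermitian_form st b"
    and nondeg: "nondegenerate b"
    and Wsub: "K_subspace (fixed_field st) scale W" and WH: "W \<subseteq> herm_endos scale b"
    and Wnil: "\<forall>u\<in>W. nilpotent_endo u"
  shows "int (K_dim (fixed_field st) scale W)
           \<le> int (witt_index scale b) * (2 * int n - 2 * int (witt_index scale b) - 1)
         \<and> ((infinite (UNIV :: 'a set) \<or> card (UNIV :: 'a set) > 4) \<and>
              int (K_dim (fixed_field st) scale W)
                = int (witt_index scale b) * (2 * int n - 2 * int (witt_index scale b) - 1)
            \<longrightarrow> (\<exists>Fl. max_singular_flag scale b Fl \<and> W = WH scale b Fl))"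
proof -
  interpret vector_space scale by (rule vs)
  interpret hermitian_space scale st b by unfold_locales (rule inv nonid sesq herm)+
  obtain B where B: "finite B" "span B = UNIV" using fin by blast
  have kdS: "kv.kd S (2 * dim S)" if "subspace S" for S using kd_subspace_dim[OF that _ B(1)] B(2) by simp
  have kdU: "kv.kd UNIV (2 * n)" using kdS[OF subspace_UNIV] n_def by simp
  interpret nil_space scale st b UNIV W "2 * n"
  proof
    show "nondeg_on UNIV" using nondeg by (simp add: nondegenerate_def nondeg_on_def)
    show "kf.ksub W" using Wsub by (simp add: K_subspace_def kf.ksub_def zero_fun_def plus_fun_def)
  qed (use WH Wnil kdU subspace_UNIV in auto)
  define \<nu> where "\<nu> = witt_index scale b"
  \<comment> \<open>\<open>Max\<close> determines the Witt index only on a finite nonempty set; the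
    bound n and the zero subspace provide this.\<close>
  let ?D = "{dim X | X. totally_singular scale b X}"
  have "dim X \<le> n" if "totally_singular scale b X" for X
    using kv.kd_le[OF kdU kdS] that by (simp add: totally_singular_def)
  then have finD: "finite ?D" by (intro finite_subset[of ?D "{..n}"]) auto
  have "totally_singular scale b {0}" using subspace_single_0 by (simp add: totally_singular_def)
  then have "?D \<noteq> {}" by blast
  then have "\<nu> \<in> ?D" unfolding \<nu>_def witt_index_def using Max_in[OF finD] by simp
  then obtain X where X: "subspace X" "\<forall>x\<in>X. \<forall>y\<in>X. b x y = 0" "dim X = \<nu>" by (auto simp: totally_singular_def)
  have le\<nu>: "dim G \<le> \<nu>" if "subspace G" "\<forall>x\<in>G. \<forall>y\<in>G. b x y = 0" for G
    unfolding \<nu>_def witt_index_def using that by (intro Max_ge[OF finD]) (auto simp: totally_singular_def)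
  have witt: "witt_le UNIV \<nu>"
    unfolding witt_le_def
  proof (intro allI impI)
    fix G k assume G: "subspace G" "\<forall>x\<in>G. \<forall>y\<in>G. b x y = 0" "kv.kd G k"
    then show "k \<le> 2 * \<nu>" using kv.kd_unique[OF kdS[OF G(1)] G(3)] le\<nu>[OF G(1,2)] by simp
  qed
  \<comment> \<open>A totally singular subspace lies in its own orthogonal, so its dimension is at
    most n/2.\<close>
  have le: "4 * \<nu> \<le> 2 * n"
  proof -
    have kX: "kv.kd X (2 * \<nu>)" using kdS[OF X(1)] X(3) by simp
    note p = kd_perp[OF U(3,1,2) kX subset_UNIV]
    have "X \<subseteq> perp UNIV X" unfolding perp_subspace[OF X(1)] using X(2) by blast
    then have "2 * \<nu> \<le> 2 * n - 2 * \<nu>" using kv.kd_le[OF p(1) kX] by simp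
    then show ?thesis using p(2) by simp
  qed
  obtain d where d: "kf.kd W d" "d + \<nu> * (2 * \<nu> + 1) \<le> \<nu> * (2 * n)"
    using nil_space_bound[OF nil_space_axioms le witt] by blast
  note Kd = K_dim_eq[OF d(1)]
  have int_eq: "int \<nu> * (2 * int n - 2 * int \<nu> - 1) = int (\<nu> * (2 * n)) - int (\<nu> * (2 * \<nu> + 1))"
    by (simp add: algebra_simps)
  have bound: "int d \<le> int \<nu> * (2 * int n - 2 * int \<nu> - 1)" unfolding int_eq using d(2) by linarith
  have flag: "\<exists>Fl. max_singular_flag scale b Fl \<and> W = WH scale b Fl"
    if card: "infinite (UNIV :: 'a set) \<or> card (UNIV :: 'a set) > 4"
      and eq: "int d = int \<nu> * (2 * int n - 2 * int \<nu> - 1)"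
  proof -
    obtain t0 where t0: "t0 \<in> K" "t0 \<noteq> 0" "t0 \<noteq> 1" using ex_K_not_0_1[OF card] by blast
    have "d + \<nu> * (2 * \<nu> + 1) = \<nu> * (2 * n)" using eq unfolding int_eq by linarith
    then have "max_space scale st b UNIV W (2 * n) t0 \<nu>"
      by unfold_locales (use t0 le witt d(1) in auto)
    from max_space_flag[OF this] obtain Fl where Fl: "flag_in UNIV \<nu> Fl" "W = flag_endos UNIV \<nu> Fl"
      by blast
    have "dim (Fl i) = i" if "i \<le> \<nu>" for i
      using kv.kd_unique[OF kdS, of "Fl i" "2 * i"] Fl(1) that by (simp add: flag_in_def)
    then have "max_singular_flag scale b Fl"
      unfolding max_singular_flag_def totally_singular_def \<nu>_def[symmetric] using Fl(1) by (simp add: flag_in_def)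
    moreover have "W = WH scale b Fl" unfolding WH_def \<nu>_def[symmetric] using Fl(2) by (simp add: flag_endos_def)
    ultimately show ?thesis by blast
  qed
  show ?thesis unfolding Kd \<nu>_def[symmetric] using bound flag by blast
qed

end
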